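(* Let $f\colon M\rightarrow\mathbb{R}^{2n+2}$ be a $\widetilde{J}$-tangent affine hypersphere with an involutive distribution $\mathcal{D}$. Then $f$ can be locally expressed in the form $$f(x_1,\ldots,x_{2n},z)=\widetilde{J}g(x_1,\ldots,x_{2n})\cosh z-g(x_1,\ldots,x_{2n})\sinh z,\qquad( * )$$ where $g$ is a proper para-complex affine hypersphere. Moreover, the converse is also true in the sense that if $g$ is a proper para-complex affine hypersphere then $f$ given by the formula $( * )$ is a $\widetilde{J}$-tangent affine hypersphere with an involutive distribution $\mathcal{D}$.
   Context: $M$ is a manifold of dimension $2n+1$. $\widetilde{J}$ is the standard para-complex structure on $\mathbb{R}^{2n+2}$: $\widetilde{J}(x_1,\ldots,x_{n+1},y_1,\ldots,y_{n+1})=(y_1,\ldots,y_{n+1},x_1,\ldots,x_{n+1})$. $\mathrm{D}$ is the usual flat connection on $\mathbb{R}^{2n+2}$. Affine hyperspheres. For an immersion $f\colon M^{N}\to\mathbb{R}^{N+1}$ ($M$ connected, orientable) with transversal vector field $C$, the objects $\nabla,h,S,\tau$ are defined by $\mathrm{D}_Xf_*Y=f_*(\nabla_XY)+h(X,Y)C$, $\mathrm{D}_XC=-f_*(SX)+\tau(X)C$. $f$ is nondegenerate if $h$ is nondegenerate. For nondegenerate $f$ the affine normal (Blaschke) field is the transversal field $C$, unique up to sign, such that the metric volume form $\omega_h(X_1,\ldots,X_N)=|\det[h(X_i,X_j)]|^{1/2}$ (for bases positively oriented with respect to $\Theta$) is $\nabla$-parallel and coincides with the induced volume form $\Theta(X_1,\ldots,X_N)=\det[f_*X_1,\ldots,f_*X_N,C]$.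 With this $C$, $f$ is an affine hypersphere if $S=\lambda I$ with $\lambda$ constant (proper if $\lambda\neq0$, improper if $\lambda=0$). For $f\colon M\to\mathbb{R}^{2n+2}$, a transversal field $C$ is $\widetilde{J}$-tangent if $\widetilde{J}C_x\in f_*(T_xM)$ for all $x\in M$; a $\widetilde{J}$-tangent affine hypersphere is an affine hypersphere whose Blaschke field is $\widetilde{J}$-tangent. The distribution $\mathcal{D}$ is the biggest $\widetilde{J}$-invariant distribution on $M$: $\mathcal{D}_x=f_*^{-1}(f_*(T_xM)\cap\widetilde{J}(f_*(T_xM)))$ (of constant dimension $2n$ when there is a $\widetilde{J}$-tangent transversal field). Para-complex affine hyperspheres. An immersion $g$ of a $2n$-dimensional manifold $U$ (here an open subset of $\mathbb{R}^{2n}$ with coordinates $x_1,\ldots,x_{2n}$) into $\mathbb{R}^{2n+2}$ is a para-holomorphic hypersurface if each $g_*(T_pU)$ is $\widetilde{J}$-invariant and $\widetilde{J}$ restricted to it is a para-complex structure (the eigenspaces for $\pm1$ both have dimension $n$). Given a vector field $\zeta$ along $g$ such that $\{\zeta,\widetilde{J}\zeta\}$ spans a bundle transversal to $g$, one writes $\mathrm{D}_Xg_*Y=g_*(\nabla_XY)+h_1(X,Y)\zeta+h_2(X,Y)\widetilde{J}\zeta$ and $\mathrm{D}_X\zeta=-g_*(SX)+\tau_1(X)\zeta+\tau_2(X)\widetilde{J}\zeta$. $g$ is nondegenerate if $h_1$ is nondegenerate. Put $\theta_\zeta(X_1,\ldots,X_{2n})=\det(g_*X_1,\ldots,g_*X_{2n},\zeta,\widetilde{J}\zeta)$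 and $H_\zeta=\det[h_1(X_i,X_j)]$ for any local basis with $\theta_\zeta(X_1,\ldots,X_{2n})=1$. For nondegenerate $g$, such a $\zeta$ is an affine normal vector field if $|H_\zeta|=1$ and $\tau_1=0$. $g$ is a proper para-complex affine hypersphere if it is a nondegenerate para-holomorphic hypersurface and there exists an affine normal vector field $\zeta$ with $S=\alpha I$, $\alpha\in\mathbb{R}\setminus\{0\}$, and $\tau_2=0$. "Locally expressed" means that every point of $M$ has a neighbourhood with coordinates $(x_1,\ldots,x_{2n},z)$ ranging over $V\times I$ ($V\subset\mathbb{R}^{2n}$ open, $I$ an open interval) in which $f$ is given by the formula, with $g$ defined on $V$. In the converse, $z$ ranges over an open interval.
   Formalization: Formula ( * ) is false for hyperspheres not centred at the origin, so the centre c (common point of the affine normals) is proved to exist and f, respectively g, is replaced by f − c, respectively g − c; in the converse the domain of g is connected, as M is. *)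

theory Defs
  imports "HOL-Analysis.Analysis"
begin

section \<open>Smooth maps and vector fields on open sets\<close>

fun Ck_on :: "nat \<Rightarrow> 'a::real_normed_vector set \<Rightarrow> ('a \<Rightarrow> 'b::real_normed_vector) \<Rightarrow> bool" where
  "Ck_on 0 W F \<longleftrightarrow> continuous_on W F"
| "Ck_on (Suc k) W F \<longleftrightarrow> (\<forall>x\<in>W. F differentiable (at x)) \<and>
     (\<forall>v. Ck_on k W (\<lambda>x. frechet_derivative F (at x) v))"

text \<open>Only used for open \<open>W\<close>, so that \<open>at x\<close> is not affected by the values outside \<open>W\<close>.\<close>

definition smooth_on :: "'a::real_normed_vector set \<Rightarrow> ('a \<Rightarrow> 'b::real_normed_vector) \<Rightarrow> bool" where
  "smooth_on W F \<longleftrightarrow> (\<forall>k. Ck_on k W F)"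

text \<open>The flat connection \<open>D\<^sub>X F\<close> of a vector-valued function \<open>F\<close> along a vector field \<open>X\<close>.
  In particular \<open>flat_D Y f\<close> is the pushforward \<open>f\<^sub>* Y\<close>.\<close>

definition flat_D :: "('a::real_normed_vector \<Rightarrow> 'a) \<Rightarrow> ('a \<Rightarrow> 'b::real_normed_vector) \<Rightarrow> 'a \<Rightarrow> 'b" where
  "flat_D X F x = frechet_derivative F (at x) (X x)"

abbreviation pushf :: "('a::real_normed_vector \<Rightarrow> 'b::real_normed_vector) \<Rightarrow> ('a \<Rightarrow> 'a) \<Rightarrow> 'a \<Rightarrow> 'b" where
  "pushf f Y \<equiv> flat_D Y f"

definition lie_bracket :: "('a::real_normed_vector \<Rightarrow> 'a) \<Rightarrow> ('a \<Rightarrow> 'a) \<Rightarrow> 'a \<Rightarrow> 'a" where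
  "lie_bracket X Y x = flat_D X Y x - flat_D Y X x"

abbreviation tangent_image :: "('a::real_normed_vector \<Rightarrow> 'b::real_normed_vector) \<Rightarrow> 'a \<Rightarrow> 'b set" where
  "tangent_image f x \<equiv> range (frechet_derivative f (at x))"

definition immersion_on :: "'a::real_normed_vector set \<Rightarrow> ('a \<Rightarrow> 'b::real_normed_vector) \<Rightarrow> bool" where
  "immersion_on W f \<longleftrightarrow> smooth_on W f \<and> (\<forall>x\<in>W. inj (frechet_derivative f (at x)))"

definition nondegenerate_on :: "'a::real_vector set \<Rightarrow> ('a \<Rightarrow> 'a \<Rightarrow> 'a \<Rightarrow> real) \<Rightarrow> bool" where
  "nondegenerate_on W h \<longleftrightarrow> (\<forall>x\<in>W. \<forall>v. (\<forall>w. h x v w = 0) \<longrightarrow> v = 0)"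


section \<open>Affine hypersurfaces in a chart\<close>

text \<open>A hypersurface has domain an open subset \<open>W\<close> of a Euclidean space \<open>'e\<close> and values in
  \<open>(real, 'i option) vec\<close>, where \<open>CARD('i) = DIM('e) = N\<close>: the index set \<open>'i option\<close> has the
  \<open>N + 1\<close> elements needed for \<open>\<real>\<^sup>N\<^sup>+\<^sup>1\<close>, and families \<open>X\<^sub>1, \<dots>, X\<^sub>N\<close> of tangent
  vectors are functions \<open>'i \<Rightarrow> 'e\<close>.  The ordering of the index set can only affect the
  sign of determinants, i.e. the choice of orientation of the ambient space.\<close>

definition transversal_on ::
  "'e::euclidean_space set \<Rightarrow> ('e \<Rightarrow> (real, 'i::finite option) vec) \<Rightarrow> ('e \<Rightarrow> (real, 'i option) vec) \<Rightarrow> bool" where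
  "transversal_on W f C \<longleftrightarrow> smooth_on W C \<and> (\<forall>x\<in>W. C x \<notin> tangent_image f x)"

text \<open>The Gauss and Weingarten formulas; for an immersion \<open>f\<close> and a transversal field \<open>C\<close>
  they determine \<open>\<nabla>\<close>, \<open>h\<close>, \<open>S\<close>, \<open>\<tau>\<close> on \<open>W\<close>.\<close>

definition induced_objects ::
  "'e::euclidean_space set \<Rightarrow> ('e \<Rightarrow> (real, 'i::finite option) vec) \<Rightarrow> ('e \<Rightarrow> (real, 'i option) vec) \<Rightarrow>
   (('e \<Rightarrow> 'e) \<Rightarrow> ('e \<Rightarrow> 'e) \<Rightarrow> 'e \<Rightarrow> 'e) \<Rightarrow> ('e \<Rightarrow> 'e \<Rightarrow> 'e \<Rightarrow> real) \<Rightarrow>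
   ('e \<Rightarrow> 'e \<Rightarrow> 'e) \<Rightarrow> ('e \<Rightarrow> 'e \<Rightarrow> real) \<Rightarrow> bool" where
  "induced_objects W f C nabla h S \<tau> \<longleftrightarrow>
     (\<forall>X Y. smooth_on W X \<and> smooth_on W Y \<longrightarrow>
        (\<forall>x\<in>W. flat_D X (pushf f Y) x = pushf f (nabla X Y) x + h x (X x) (Y x) *\<^sub>R C x)) \<and>
     (\<forall>X. smooth_on W X \<longrightarrow>
        (\<forall>x\<in>W. flat_D X C x = - pushf f (\<lambda>y. S y (X y)) x + \<tau> x (X x) *\<^sub>R C x))"

definition induced_volume ::
  "('e::euclidean_space \<Rightarrow> (real, 'i::finite option) vec) \<Rightarrow> ('e \<Rightarrow> (real, 'i option) vec) \<Rightarrow>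
   'e \<Rightarrow> ('i \<Rightarrow> 'e) \<Rightarrow> real" where
  "induced_volume f C x X =
     det (\<chi> k. case k of None \<Rightarrow> C x | Some i \<Rightarrow> frechet_derivative f (at x) (X i))"

text \<open>\<open>|det [h(X\<^sub>i, X\<^sub>j)]|\<^sup>1\<^sup>/\<^sup>2\<close> on bases positively oriented with respect to the induced volume
  form, extended as an alternating form: negative on negatively oriented bases, \<open>0\<close> on
  dependent families.\<close>

definition metric_volume ::
  "('e::euclidean_space \<Rightarrow> (real, 'i::finite option) vec) \<Rightarrow> ('e \<Rightarrow> (real, 'i option) vec) \<Rightarrow>
   ('e \<Rightarrow> 'e \<Rightarrow> 'e \<Rightarrow> real) \<Rightarrow> 'e \<Rightarrow> ('i \<Rightarrow> 'e) \<Rightarrow> real" where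
  "metric_volume f C h x X =
     sgn (induced_volume f C x X) * sqrt \<bar>det ((\<chi> i j. h x (X i) (X j)) :: real^'i^'i)\<bar>"

text \<open>\<open>(\<nabla>\<^sub>Z \<omega>)(X\<^sub>1, \<dots>, X\<^sub>N) = Z(\<omega>(X\<^sub>1, \<dots>, X\<^sub>N)) - \<Sum>\<^sub>i \<omega>(X\<^sub>1, \<dots>, \<nabla>\<^sub>Z X\<^sub>i, \<dots>, X\<^sub>N) = 0\<close>.\<close>

definition parallel_form ::
  "'e::euclidean_space set \<Rightarrow> (('e \<Rightarrow> 'e) \<Rightarrow> ('e \<Rightarrow> 'e) \<Rightarrow> 'e \<Rightarrow> 'e) \<Rightarrow>
   ('e \<Rightarrow> ('i::finite \<Rightarrow> 'e) \<Rightarrow> real) \<Rightarrow> bool" where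
  "parallel_form W nabla \<omega> \<longleftrightarrow>
     (\<forall>Z X. smooth_on W Z \<and> (\<forall>i. smooth_on W (X i)) \<longrightarrow>
        (\<forall>x\<in>W. flat_D Z (\<lambda>y. \<omega> y (\<lambda>i. X i y)) x =
           (\<Sum>i\<in>UNIV. \<omega> x ((\<lambda>j. X j x)(i := nabla Z (X i) x)))))"

definition hypersphere_on ::
  "'e::euclidean_space set \<Rightarrow> ('e \<Rightarrow> (real, 'i::finite option) vec) \<Rightarrow> ('e \<Rightarrow> (real, 'i option) vec) \<Rightarrow>
   real \<Rightarrow> bool" where
  "hypersphere_on W f C lam \<longleftrightarrow>
     immersion_on W f \<and> transversal_on W f C \<and>
     (\<exists>nabla h S \<tau>.
        induced_objects W f C nabla h S \<tau> \<and>
        nondegenerate_on W h \<and>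
        parallel_form W nabla (metric_volume f C h) \<and>
        (\<forall>x\<in>W. \<forall>X. metric_volume f C h x X = induced_volume f C x X) \<and>
        (\<forall>x\<in>W. \<forall>v. S x v = lam *\<^sub>R v))"


section \<open>Manifolds\<close>

type_synonym ('p, 'e) chart = "'p set \<times> ('p \<Rightarrow> 'e)"

definition is_chart :: "'p topology \<Rightarrow> ('p, 'e::euclidean_space) chart \<Rightarrow> bool" where
  "is_chart M = (\<lambda>(U, \<phi>). openin M U \<and> open (\<phi> ` U) \<and>
     homeomorphic_map (subtopology M U) (top_of_set (\<phi> ` U)) \<phi>)"

definition smooth_manifold :: "'p topology \<Rightarrow> ('p, 'e::euclidean_space) chart set \<Rightarrow> bool" where
  "smooth_manifold M A \<longleftrightarrow>
     Hausdorff_space M \<and> second_countable M \<and>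
     (\<forall>c\<in>A. is_chart M c) \<and> \<Union>(fst ` A) = topspace M \<and>
     (\<forall>(U, \<phi>)\<in>A. \<forall>(V, \<psi>)\<in>A. smooth_on (\<phi> ` (U \<inter> V)) (\<psi> \<circ> inv_into U \<phi>))"

text \<open>A chart of the smooth structure generated by the atlas \<open>A\<close>.\<close>

definition compatible_chart ::
  "'p topology \<Rightarrow> ('p, 'e::euclidean_space) chart set \<Rightarrow> ('p, 'e) chart \<Rightarrow> bool" where
  "compatible_chart M A c \<longleftrightarrow> smooth_manifold M (insert c A)"

text \<open>An affine hypersphere \<open>f : M \<rightarrow> \<real>\<^sup>N\<^sup>+\<^sup>1\<close> with Blaschke field \<open>C\<close> and \<open>S = \<lambda> I\<close>.  Orientability of
  \<open>M\<close> needs no separate clause: the induced volume form vanishes nowhere.\<close>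

definition affine_hypersphere ::
  "'p topology \<Rightarrow> ('p, 'e::euclidean_space) chart set \<Rightarrow> ('p \<Rightarrow> (real, 'i::finite option) vec) \<Rightarrow>
   ('p \<Rightarrow> (real, 'i option) vec) \<Rightarrow> real \<Rightarrow> bool" where
  "affine_hypersphere M A f C lam \<longleftrightarrow>
     smooth_manifold M A \<and> connected_space M \<and>
     (\<forall>(U, \<phi>)\<in>A. hypersphere_on (\<phi> ` U) (f \<circ> inv_into U \<phi>) (C \<circ> inv_into U \<phi>) lam)"

text \<open>\<open>c\<close> is the common point of all affine normal lines of a proper affine hypersphere.\<close>

definition hypersphere_centre ::
  "'p topology \<Rightarrow> ('p, 'e::euclidean_space) chart set \<Rightarrow> ('p \<Rightarrow> (real, 'i::finite option) vec) \<Rightarrow>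
   (real, 'i option) vec \<Rightarrow> bool" where
  "hypersphere_centre M A f c \<longleftrightarrow>
     (\<exists>C lam. affine_hypersphere M A f C lam \<and> lam \<noteq> 0 \<and>
        (\<forall>p\<in>topspace M. C p = - lam *\<^sub>R (f p - c)))"


section \<open>The standard para-complex structure\<close>

text \<open>With \<open>n = CARD('n)\<close>, the index type of \<open>\<real>\<^sup>2\<^sup>n\<close> is \<open>'n + 'n\<close> and that of \<open>\<real>\<^sup>2\<^sup>n\<^sup>+\<^sup>2\<close> is
  \<open>('n + 'n) option option\<close>.  The coordinates \<open>x\<^sub>1, \<dots>, x\<^sub>n\<close> are those indexed by
  \<open>Some (Some (Inl i))\<close>, and \<open>x\<^sub>n\<^sub>+\<^sub>1\<close> by \<open>Some None\<close>; the coordinates \<open>y\<^sub>1, \<dots>, y\<^sub>n\<close> are those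
  indexed by \<open>Some (Some (Inr i))\<close>, and \<open>y\<^sub>n\<^sub>+\<^sub>1\<close> by \<open>None\<close>.  The model space of
  \<open>(2n+1)\<close>-dimensional manifolds is \<open>\<real>\<^sup>2\<^sup>n \<times> \<real>\<close>.\<close>

type_synonym 'n ambient = "(real, ('n + 'n) option option) vec"
type_synonym 'n base = "(real, 'n + 'n) vec"
type_synonym 'n model = "(real, 'n + 'n) vec \<times> real"

fun swap_xy :: "('n + 'n) option option \<Rightarrow> ('n + 'n) option option" where
  "swap_xy (Some (Some (Inl i))) = Some (Some (Inr i))"
| "swap_xy (Some (Some (Inr i))) = Some (Some (Inl i))"
| "swap_xy (Some None) = None"
| "swap_xy None = Some None"

definition Jt :: "'n::finite ambient \<Rightarrow> 'n ambient" where
  "Jt v = (\<chi> k. v $ swap_xy k)"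

definition Jt_tangent_hypersphere ::
  "'p topology \<Rightarrow> ('p, 'n::finite model) chart set \<Rightarrow> ('p \<Rightarrow> 'n ambient) \<Rightarrow> bool" where
  "Jt_tangent_hypersphere M A f \<longleftrightarrow>
     (\<exists>C lam. affine_hypersphere M A f C lam \<and>
        (\<forall>(U, \<phi>)\<in>A. \<forall>p\<in>U. Jt (C p) \<in> tangent_image (f \<circ> inv_into U \<phi>) (\<phi> p)))"

definition invariant_distribution :: "('n::finite model \<Rightarrow> 'n ambient) \<Rightarrow> 'n model \<Rightarrow> 'n model set" where
  "invariant_distribution f x =
     frechet_derivative f (at x) -` (tangent_image f x \<inter> Jt ` tangent_image f x)"

definition involutive_on ::
  "'e::real_normed_vector set \<Rightarrow> ('e \<Rightarrow> 'e set) \<Rightarrow> bool" where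
  "involutive_on W D \<longleftrightarrow>
     (\<forall>W' X Y. open W' \<and> W' \<subseteq> W \<and> smooth_on W' X \<and> smooth_on W' Y \<and>
        (\<forall>x\<in>W'. X x \<in> D x \<and> Y x \<in> D x) \<longrightarrow> (\<forall>x\<in>W'. lie_bracket X Y x \<in> D x))"

definition involutive_invariant_distribution ::
  "('p, 'n::finite model) chart set \<Rightarrow> ('p \<Rightarrow> 'n ambient) \<Rightarrow> bool" where
  "involutive_invariant_distribution A f \<longleftrightarrow>
     (\<forall>(U, \<phi>)\<in>A. involutive_on (\<phi> ` U) (invariant_distribution (f \<circ> inv_into U \<phi>)))"


section \<open>Para-complex affine hyperspheres\<close>

definition para_holomorphic_hypersurface ::
  "'n::finite base set \<Rightarrow> ('n base \<Rightarrow> 'n ambient) \<Rightarrow> bool" where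
  "para_holomorphic_hypersurface U g \<longleftrightarrow>
     open U \<and> immersion_on U g \<and>
     (\<forall>x\<in>U. Jt ` tangent_image g x \<subseteq> tangent_image g x \<and>
        dim {v \<in> tangent_image g x. Jt v = v} = CARD('n) \<and>
        dim {v \<in> tangent_image g x. Jt v = - v} = CARD('n))"

definition pc_transversal_on ::
  "'n::finite base set \<Rightarrow> ('n base \<Rightarrow> 'n ambient) \<Rightarrow> ('n base \<Rightarrow> 'n ambient) \<Rightarrow> bool" where
  "pc_transversal_on U g \<zeta> \<longleftrightarrow>
     smooth_on U \<zeta> \<and>
     (\<forall>x\<in>U. tangent_image g x \<inter> span {\<zeta> x, Jt (\<zeta> x)} = {0} \<and>
        {v + w | v w. v \<in> tangent_image g x \<and> w \<in> span {\<zeta> x, Jt (\<zeta> x)}} = UNIV)"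

definition pc_induced_objects ::
  "'n::finite base set \<Rightarrow> ('n base \<Rightarrow> 'n ambient) \<Rightarrow> ('n base \<Rightarrow> 'n ambient) \<Rightarrow>
   (('n base \<Rightarrow> 'n base) \<Rightarrow> ('n base \<Rightarrow> 'n base) \<Rightarrow> 'n base \<Rightarrow> 'n base) \<Rightarrow>
   ('n base \<Rightarrow> 'n base \<Rightarrow> 'n base \<Rightarrow> real) \<Rightarrow> ('n base \<Rightarrow> 'n base \<Rightarrow> 'n base \<Rightarrow> real) \<Rightarrow>
   ('n base \<Rightarrow> 'n base \<Rightarrow> 'n base) \<Rightarrow>
   ('n base \<Rightarrow> 'n base \<Rightarrow> real) \<Rightarrow> ('n base \<Rightarrow> 'n base \<Rightarrow> real) \<Rightarrow> bool" where
  "pc_induced_objects U g \<zeta> nabla h1 h2 S \<tau>1 \<tau>2 \<longleftrightarrow>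
     (\<forall>X Y. smooth_on U X \<and> smooth_on U Y \<longrightarrow>
        (\<forall>x\<in>U. flat_D X (pushf g Y) x =
           pushf g (nabla X Y) x + h1 x (X x) (Y x) *\<^sub>R \<zeta> x + h2 x (X x) (Y x) *\<^sub>R Jt (\<zeta> x))) \<and>
     (\<forall>X. smooth_on U X \<longrightarrow>
        (\<forall>x\<in>U. flat_D X \<zeta> x =
           - pushf g (\<lambda>y. S y (X y)) x + \<tau>1 x (X x) *\<^sub>R \<zeta> x + \<tau>2 x (X x) *\<^sub>R Jt (\<zeta> x)))"

definition pc_volume ::
  "('n::finite base \<Rightarrow> 'n ambient) \<Rightarrow> ('n base \<Rightarrow> 'n ambient) \<Rightarrow>
   'n base \<Rightarrow> ('n + 'n \<Rightarrow> 'n base) \<Rightarrow> real" where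
  "pc_volume g \<zeta> x X =
     det (\<chi> k. case k of None \<Rightarrow> Jt (\<zeta> x) | Some None \<Rightarrow> \<zeta> x
            | Some (Some i) \<Rightarrow> frechet_derivative g (at x) (X i))"

text \<open>A proper para-complex affine hypersphere with affine normal field \<open>\<zeta>\<close> and \<open>S = \<alpha> I\<close>.
  The clause on \<open>pc_volume\<close> says \<open>|H\<^sub>\<zeta>| = 1\<close>.\<close>

definition pc_hypersphere_with ::
  "'n::finite base set \<Rightarrow> ('n base \<Rightarrow> 'n ambient) \<Rightarrow> ('n base \<Rightarrow> 'n ambient) \<Rightarrow> real \<Rightarrow> bool" where
  "pc_hypersphere_with U g \<zeta> \<alpha> \<longleftrightarrow>
     para_holomorphic_hypersurface U g \<and> pc_transversal_on U g \<zeta> \<and> \<alpha> \<noteq> 0 \<and>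
     (\<exists>nabla h1 h2 S \<tau>1 \<tau>2.
        pc_induced_objects U g \<zeta> nabla h1 h2 S \<tau>1 \<tau>2 \<and>
        nondegenerate_on U h1 \<and>
        (\<forall>x\<in>U. \<forall>X. pc_volume g \<zeta> x X = 1 \<longrightarrow>
           \<bar>det ((\<chi> i j. h1 x (X i) (X j)) :: real^('n + 'n)^('n + 'n))\<bar> = 1) \<and>
        (\<forall>x\<in>U. \<forall>v. \<tau>1 x v = 0) \<and>
        (\<forall>x\<in>U. \<forall>v. S x v = \<alpha> *\<^sub>R v) \<and>
        (\<forall>x\<in>U. \<forall>v. \<tau>2 x v = 0))"

definition proper_pc_hypersphere ::
  "'n::finite base set \<Rightarrow> ('n base \<Rightarrow> 'n ambient) \<Rightarrow> bool" where
  "proper_pc_hypersphere U g \<longleftrightarrow> (\<exists>\<zeta> \<alpha>. pc_hypersphere_with U g \<zeta> \<alpha>)"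

definition pc_hypersphere_centre ::
  "'n::finite base set \<Rightarrow> ('n base \<Rightarrow> 'n ambient) \<Rightarrow> 'n ambient \<Rightarrow> bool" where
  "pc_hypersphere_centre U g c \<longleftrightarrow>
     (\<exists>\<zeta> \<alpha>. pc_hypersphere_with U g \<zeta> \<alpha> \<and> (\<forall>x\<in>U. \<zeta> x = - \<alpha> *\<^sub>R (g x - c)))"

text \<open>\<open>(x, z) \<mapsto> J g(x) cosh z - g(x) sinh z\<close>.  This formula presupposes that the hyperspheres
  are centred at the origin: it is not stable under translating \<open>g\<close>, whereas being an affine
  hypersphere is.\<close>

definition hyperbolic_form :: "('n::finite base \<Rightarrow> 'n ambient) \<Rightarrow> 'n model \<Rightarrow> 'n ambient" where
  "hyperbolic_form g = (\<lambda>(x, z). cosh z *\<^sub>R Jt (g x) - sinh z *\<^sub>R g x)"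

end

theory Submission
  imports Defs "HOL-Combinatorics.Permutations"
begin

text \<open>Let \<open>f\<close> be a \<open>J\<close>-tangent affine hypersphere with Blaschke field \<open>C\<close> and \<open>J C = f\<^sub>* \<xi>\<close>.  If \<open>C\<close> were constant,
  differentiating \<open>J C\<close> would give \<open>h(X, \<xi>) = 0\<close> for all \<open>X\<close>, so \<open>f\<close> is proper and \<open>C = - \<lambda> F\<close> with
  \<open>F = f - c\<close>.  Then \<open>J F = F\<^sub>* \<zeta>\<close> for a field \<open>\<zeta>\<close>, and \<open>J F\<^sub>* X = F\<^sub>*(\<dots>) + \<eta>(X) F\<close> defines a one-form with
  kernel \<open>\<D>\<close>, with \<open>\<eta>(\<zeta>) = 1\<close> and \<open>d\<eta>(\<zeta>, \<cdot>) = 0\<close>.  Involutivity of \<open>\<D>\<close> therefore makes \<open>\<eta>\<close> closed, and no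
  Frobenius theorem is needed: \<open>\<eta> = dt\<close> locally, the map \<open>J exp (- t J) F\<close> is constant along \<open>\<zeta>\<close>, and it
  descends to the required \<open>g\<close> on a transversal, with \<open>z = - t\<close>.

  For \<open>F = J g cosh z - g sinh z\<close> with \<open>- \<alpha> g\<close> as affine normal of \<open>g\<close>, the second fundamental forms satisfy
  \<open>h = (\<alpha> h\<^sub>1 - dz\<^sup>2) / \<lambda>\<close>, and the two volume normalisations agree exactly if
  \<open>\<bar>\<alpha>\<bar>\<^sup>2\<^sup>n\<^sup>+\<^sup>4 = \<bar>\<lambda>\<bar>\<^sup>2\<^sup>n\<^sup>+\<^sup>3\<close>.\<close>

section \<open>Smooth maps\<close>

text \<open>Both kinds of hyperspheres are defined through an unspecified connection and arbitrary
  vector fields. They are first reduced to pointwise conditions on first and second derivatives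
  (\<open>sphere_data\<close>, \<open>pc_data\<close>), with the volume condition squared so that
  orientation signs vanish. These conditions survive reparametrisation and translation, and the
  volume condition can be tested on one frame.

  That d\<eta>(\<zeta>, .) = 0 comes from a symmetry: as J F is tangent, the hypersurface is locally
  preserved by the linear flow exp(s J), which commutes with J and so preserves \<eta>; Cartan's
  formula with \<eta>(\<zeta>) = 1 does the rest. The flow itself is replaced by a computation with
  the conormal field.

  A second obstacle: the centre and the J-tangency are each given with a Blaschke field of their
  own. Uniqueness up to sign lets the tangency pass from one to the other.\<close>

abbreviation fd :: "('a::real_normed_vector \<Rightarrow> 'b::real_normed_vector) \<Rightarrow> 'a \<Rightarrow> 'a \<Rightarrow> 'b" where
  "fd F x \<equiv> frechet_derivative F (at x)"

lemma fd_eqI: "(F has_derivative F') (at x) \<Longrightarrow> fd F x = F'"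
  by (rule frechet_derivative_at[symmetric])

text \<open>Functions that agree near \<open>x\<close> have the same derivatives at
  \<open>x\<close>, so the \<open>SOME\<close> inside \<open>frechet_derivative\<close> picks the
  same map for both, whether or not a derivative exists.\<close>

lemma fd_cong:
  assumes "open W" "x \<in> W" "\<And>x. x \<in> W \<Longrightarrow> F x = G x"
  shows "fd F x = fd G x"
  unfolding frechet_derivative_def
  using has_derivative_transform_within_open[OF _ assms(1,2)] assms(3) by metis

lemma differentiable_cong_open:
  assumes "open W" "x \<in> W" "\<And>x. x \<in> W \<Longrightarrow> F x = G x" "F differentiable (at x)"
  shows "G differentiable (at x)"
  using assms has_derivative_transform_within_open unfolding differentiable_def by blast

lemma Ck_on_cong:
  assumes "open W" "\<And>x. x \<in> W \<Longrightarrow> F x = G x" "Ck_on k W F"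
  shows "Ck_on k W G"
  using assms(2,3)
proof (induction k arbitrary: F G)
  case 0
  then show ?case by (metis Ck_on.simps(1) continuous_on_cong)
next
  case (Suc k)
  have "Ck_on k W (\<lambda>x. fd G x v)" for v
  proof (rule Suc.IH)
    show "Ck_on k W (\<lambda>x. fd F x v)" using Suc.prems by simp
    show "\<And>x. x \<in> W \<Longrightarrow> fd F x v = fd G x v"
      using fd_cong[OF assms(1)] Suc.prems(1) by metis
  qed
  moreover have "G differentiable (at x)" if "x \<in> W" for x
    using differentiable_cong_open[OF assms(1) that] Suc.prems that by auto
  ultimately show ?case by simp
qed

lemma Ck_on_subset: "Ck_on k W F \<Longrightarrow> W' \<subseteq> W \<Longrightarrow> Ck_on k W' F"
  by (induction k arbitrary: F) (auto intro: continuous_on_subset)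

lemma Ck_on_SucD: "Ck_on (Suc k) W F \<Longrightarrow> Ck_on k W F"
proof (induction k arbitrary: F)
  case 0
  then show ?case
    by (simp add: differentiable_at_imp_differentiable_on differentiable_imp_continuous_on)
qed simp

lemma smooth_on_cong:
  assumes "open W" "\<And>x. x \<in> W \<Longrightarrow> F x = G x" "smooth_on W F"
  shows "smooth_on W G"
  using assms Ck_on_cong unfolding smooth_on_def by blast

lemma smooth_on_subset: "smooth_on W F \<Longrightarrow> W' \<subseteq> W \<Longrightarrow> smooth_on W' F"
  unfolding smooth_on_def using Ck_on_subset by blast

lemma smooth_on_empty: "smooth_on {} F"
  unfolding smooth_on_def
proof
  show "Ck_on k {} F" for k by (induction k arbitrary: F) auto
qed

text \<open>Level \<open>Suc k\<close> of \<open>F\<close> is level \<open>k\<close> of its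
  directional derivatives, so quantifying over all \<open>k\<close> makes smoothness a fixed point
  of this step.\<close>

lemma smooth_on_iff:
  "smooth_on W F \<longleftrightarrow> (\<forall>x\<in>W. F differentiable (at x)) \<and> (\<forall>v. smooth_on W (\<lambda>x. fd F x v))"
proof
  assume "smooth_on W F"
  then have F: "Ck_on (Suc k) W F" for k by (simp only: smooth_on_def)
  show "(\<forall>x\<in>W. F differentiable (at x)) \<and> (\<forall>v. smooth_on W (\<lambda>x. fd F x v))"
    using F by (simp add: smooth_on_def)
next
  assume R: "(\<forall>x\<in>W. F differentiable (at x)) \<and> (\<forall>v. smooth_on W (\<lambda>x. fd F x v))"
  then have "Ck_on (Suc k) W F" for k by (simp add: smooth_on_def)
  then show "smooth_on W F" by (simp add: smooth_on_def Ck_on_SucD)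
qed

lemma smooth_on_differentiable: "smooth_on W F \<Longrightarrow> x \<in> W \<Longrightarrow> F differentiable (at x)"
  using smooth_on_iff by blast

lemma smooth_on_fd: "smooth_on W F \<Longrightarrow> smooth_on W (\<lambda>x. fd F x v)"
  using smooth_on_iff by blast

lemma smooth_on_has_derivative: "smooth_on W F \<Longrightarrow> x \<in> W \<Longrightarrow> (F has_derivative fd F x) (at x)"
  using smooth_on_differentiable frechet_derivative_works by blast

lemma smooth_on_linear_fd: "smooth_on W F \<Longrightarrow> x \<in> W \<Longrightarrow> linear (fd F x)"
  using smooth_on_has_derivative has_derivative_linear by blast

lemma smooth_on_continuous_on: "smooth_on W F \<Longrightarrow> continuous_on W F"
  unfolding smooth_on_def by (metis Ck_on.simps(1))

text \<open>Replaces the derivative in the recursion of \<open>Ck_on\<close> by any explicitly known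
  one; every closure property below is an induction through this rule.\<close>

lemma Ck_on_SucI:
  assumes "open W" "\<And>x. x \<in> W \<Longrightarrow> (F has_derivative F' x) (at x)"
    and "\<And>v. Ck_on k W (\<lambda>x. F' x v)"
  shows "Ck_on (Suc k) W F"
proof -
  have "Ck_on k W (\<lambda>x. fd F x v)" for v
    using fd_eqI[OF assms(2)] by (intro Ck_on_cong[OF assms(1) _ assms(3)[of v]]) simp
  then show ?thesis
    using assms(2) by (auto simp: differentiable_def)
qed

lemma Ck_on_Suc_has_derivative:
  "Ck_on (Suc k) W F \<Longrightarrow> x \<in> W \<Longrightarrow> (F has_derivative fd F x) (at x)"
  by (simp add: frechet_derivative_works)

section \<open>Closure properties of \<open>Ck_on\<close> and \<open>smooth_on\<close>\<close>

lemma Ck_on_const: "Ck_on k W (\<lambda>x. c)"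
  by (induction k arbitrary: c) simp_all

lemma Ck_on_add: "open W \<Longrightarrow> Ck_on k W F \<Longrightarrow> Ck_on k W G \<Longrightarrow> Ck_on k W (\<lambda>x. F x + G x)"
proof (induction k arbitrary: F G)
  case 0
  then show ?case by (auto intro: continuous_intros)
next
  case (Suc k)
  show ?case
  proof (rule Ck_on_SucI[OF Suc.prems(1)])
    show "((\<lambda>x. F x + G x) has_derivative (\<lambda>v. fd F x v + fd G x v)) (at x)" if "x \<in> W" for x
      using Suc.prems that by (intro has_derivative_add Ck_on_Suc_has_derivative)
    show "Ck_on k W (\<lambda>x. fd F x v + fd G x v)" for v
      using Suc by simp
  qed
qed

lemma Ck_on_bounded_linear:
  assumes "bounded_linear L" "open W"
  shows "Ck_on k W F \<Longrightarrow> Ck_on k W (\<lambda>x. L (F x))"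
proof (induction k arbitrary: F)
  case 0
  then show ?case using assms bounded_linear.continuous_on by auto
next
  case (Suc k)
  show ?case
  proof (rule Ck_on_SucI[OF assms(2)])
    show "((\<lambda>x. L (F x)) has_derivative (\<lambda>v. L (fd F x v))) (at x)" if "x \<in> W" for x
      using Suc.prems that
      by (intro bounded_linear.has_derivative[OF assms(1)] Ck_on_Suc_has_derivative)
    show "Ck_on k W (\<lambda>x. L (fd F x v))" for v
      using Suc by simp
  qed
qed

lemma Ck_on_ident: "Ck_on k W (\<lambda>x. x)"
  by (cases k) (simp_all add: Ck_on_const)

lemma Ck_on_bounded_bilinear:
  assumes "bounded_bilinear B" "open W"
  shows "Ck_on k W F \<Longrightarrow> Ck_on k W G \<Longrightarrow> Ck_on k W (\<lambda>x. B (F x) (G x))"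
proof (induction k arbitrary: F G)
  case 0
  then show ?case using bounded_bilinear.continuous_on[OF assms(1)] by auto
next
  case (Suc k)
  show ?case
  proof (rule Ck_on_SucI[OF assms(2)])
    show "((\<lambda>x. B (F x) (G x)) has_derivative (\<lambda>v. B (F x) (fd G x v) + B (fd F x v) (G x))) (at x)"
      if "x \<in> W" for x
      using Suc.prems that by (intro bounded_bilinear.FDERIV[OF assms(1)] Ck_on_Suc_has_derivative)
    have "Ck_on k W F" "Ck_on k W G"
      using Suc.prems Ck_on_SucD by blast+
    moreover have "Ck_on k W (\<lambda>x. fd F x v)" "Ck_on k W (\<lambda>x. fd G x v)" for v
      using Suc.prems by simp_all
    ultimately show "Ck_on k W (\<lambda>x. B (F x) (fd G x v) + B (fd F x v) (G x))" for v
      by (intro Ck_on_add assms Suc.IH)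
  qed
qed

lemma Ck_on_sum:
  assumes "open W"
  shows "finite S \<Longrightarrow> (\<And>i. i \<in> S \<Longrightarrow> Ck_on k W (F i)) \<Longrightarrow> Ck_on k W (\<lambda>x. \<Sum>i\<in>S. F i x)"
  by (induction S rule: finite_induct) (auto intro: Ck_on_add assms Ck_on_const)

lemma linear_eq_sum_Basis:
  fixes L :: "'a::euclidean_space \<Rightarrow> 'b::real_vector"
  assumes "linear L"
  shows "L v = (\<Sum>b\<in>Basis. (v \<bullet> b) *\<^sub>R L b)"
proof -
  have "L v = L (\<Sum>b\<in>Basis. (v \<bullet> b) *\<^sub>R b)"
    by (simp add: euclidean_representation)
  then show ?thesis
    by (simp add: linear_sum[OF assms] linear_cmul[OF assms])
qed

text \<open>\<open>Ck_on\<close> controls derivatives in fixed directions only, but the chain rule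
  evaluates \<open>fd G\<close> in the moving direction \<open>fd F x v\<close>. Expanding that
  direction in the basis of the middle space leaves fixed directions with varying
  coefficients.\<close>

lemma Ck_on_compose:
  fixes F :: "'a::real_normed_vector \<Rightarrow> 'b::euclidean_space"
  assumes "open W" "open V" "\<And>x. x \<in> W \<Longrightarrow> F x \<in> V"
  shows "Ck_on k V G \<Longrightarrow> Ck_on k W F \<Longrightarrow> Ck_on k W (\<lambda>x. G (F x))"
proof (induction k arbitrary: G)
  case 0
  then show ?case using assms(3) continuous_on_compose2[of V G W F] by auto
next
  case (Suc k)
  show ?case
  proof (rule Ck_on_SucI[OF assms(1)])
    fix x assume x: "x \<in> W"
    have hd: "((\<lambda>x. G (F x)) has_derivative (\<lambda>v. fd G (F x) (fd F x v))) (at x)"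
      by (rule has_derivative_compose[OF Ck_on_Suc_has_derivative[OF Suc.prems(2) x]
            Ck_on_Suc_has_derivative[OF Suc.prems(1) assms(3)[OF x]]])
    have lin: "linear (fd G (F x))"
      using Suc.prems(1) assms(3)[OF x] by (simp add: linear_frechet_derivative)
    show "((\<lambda>x. G (F x)) has_derivative (\<lambda>v. \<Sum>b\<in>Basis. (fd F x v \<bullet> b) *\<^sub>R fd G (F x) b)) (at x)"
      by (rule has_derivative_eq_rhs[OF hd], rule ext, rule linear_eq_sum_Basis[OF lin])
  next
    fix v
    show "Ck_on k W (\<lambda>x. \<Sum>b\<in>Basis. (fd F x v \<bullet> b) *\<^sub>R fd G (F x) b)"
    proof (intro Ck_on_sum assms Ck_on_bounded_bilinear[OF bounded_bilinear_scaleR] finite_Basis)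
      fix b :: 'b
      show "Ck_on k W (\<lambda>x. fd F x v \<bullet> b)"
        using Suc.prems(2) by (intro Ck_on_bounded_linear[OF bounded_linear_inner_left] assms) auto
      show "Ck_on k W (\<lambda>x. fd G (F x) b)"
        using Suc.prems Ck_on_SucD by (intro Suc.IH) auto
    qed
  qed
qed

lemma smooth_on_const: "smooth_on W (\<lambda>x. c)"
  and smooth_on_ident: "smooth_on W (\<lambda>x. x)"
  by (auto simp: smooth_on_def Ck_on_const Ck_on_ident)

lemma smooth_on_bounded_linear:
  "bounded_linear L \<Longrightarrow> open W \<Longrightarrow> smooth_on W F \<Longrightarrow> smooth_on W (\<lambda>x. L (F x))"
  by (auto simp: smooth_on_def Ck_on_bounded_linear)

lemma smooth_on_bounded_bilinear:
  "bounded_bilinear B \<Longrightarrow> open W \<Longrightarrow> smooth_on W F \<Longrightarrow> smooth_on W G \<Longrightarrow> smooth_on W (\<lambda>x. B (F x) (G x))"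
  by (auto simp: smooth_on_def Ck_on_bounded_bilinear)

lemma smooth_on_add: "open W \<Longrightarrow> smooth_on W F \<Longrightarrow> smooth_on W G \<Longrightarrow> smooth_on W (\<lambda>x. F x + G x)"
  by (auto simp: smooth_on_def Ck_on_add)

lemma smooth_on_sum:
  "open W \<Longrightarrow> finite S \<Longrightarrow> (\<And>i. i \<in> S \<Longrightarrow> smooth_on W (F i)) \<Longrightarrow> smooth_on W (\<lambda>x. \<Sum>i\<in>S. F i x)"
  by (auto simp: smooth_on_def Ck_on_sum)

lemma smooth_on_compose:
  fixes F :: "'a::real_normed_vector \<Rightarrow> 'b::euclidean_space"
  assumes "open W" "open V" "\<And>x. x \<in> W \<Longrightarrow> F x \<in> V" "smooth_on V G" "smooth_on W F"
  shows "smooth_on W (\<lambda>x. G (F x))"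
  using assms by (auto simp: smooth_on_def intro: Ck_on_compose)

lemmas smooth_on_scaleR = smooth_on_bounded_bilinear[OF bounded_bilinear_scaleR]
lemmas smooth_on_inner = smooth_on_bounded_bilinear[OF bounded_bilinear_inner]
lemmas smooth_on_uminus = smooth_on_bounded_linear[OF bounded_linear_minus[OF bounded_linear_ident]]

lemma smooth_on_diff:
  "open W \<Longrightarrow> smooth_on W F \<Longrightarrow> smooth_on W G \<Longrightarrow> smooth_on W (\<lambda>x. F x - G x)"
  using smooth_on_add[of W F "\<lambda>x. - G x"] smooth_on_uminus by auto

lemma smooth_on_prod:
  fixes F :: "'i \<Rightarrow> 'a::real_normed_vector \<Rightarrow> real"
  assumes "open W"
  shows "finite S \<Longrightarrow> (\<And>i. i \<in> S \<Longrightarrow> smooth_on W (F i)) \<Longrightarrow> smooth_on W (\<lambda>x. \<Prod>i\<in>S. F i x)"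
  by (induction S rule: finite_induct)
    (auto intro: smooth_on_bounded_bilinear[OF bounded_bilinear_mult] assms smooth_on_const)

lemma smooth_on_Pair:
  assumes "open W" "smooth_on W F" "smooth_on W G"
  shows "smooth_on W (\<lambda>x. (F x, G x))"
proof -
  have "smooth_on W (\<lambda>x. (F x, 0) + (0, G x))"
    by (intro smooth_on_add assms
        smooth_on_bounded_linear[OF bounded_linear_Pair[OF bounded_linear_ident bounded_linear_zero]]
        smooth_on_bounded_linear[OF bounded_linear_Pair[OF bounded_linear_zero bounded_linear_ident]])
  then show ?thesis by simp
qed

lemma smooth_on_vec_lambda:
  fixes F :: "'a::real_normed_vector \<Rightarrow> 'i::finite \<Rightarrow> real"
  assumes "open W" "\<And>i. smooth_on W (\<lambda>x. F x i)"
  shows "smooth_on W (\<lambda>x. \<chi> i. F x i)"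
proof -
  have "(\<lambda>x. \<chi> i. F x i) = (\<lambda>x. \<Sum>i\<in>UNIV. F x i *\<^sub>R axis i (1::real))"
    by (auto simp: vec_eq_iff axis_def if_distrib cong: if_cong)
  then show ?thesis
    using assms by (simp add: smooth_on_sum smooth_on_scaleR smooth_on_const)
qed

lemma smooth_on_vec_nth:
  fixes F :: "'a::real_normed_vector \<Rightarrow> real^'i"
  shows "open W \<Longrightarrow> smooth_on W F \<Longrightarrow> smooth_on W (\<lambda>x. F x $ i)"
  by (rule smooth_on_bounded_linear[OF bounded_linear_vec_nth])

text \<open>The derivative is a polynomial in \<open>inverse\<close> itself, so the induction on
  \<open>k\<close> feeds itself.\<close>

lemma smooth_on_inverse_real: "smooth_on (- {0::real}) inverse"
  unfolding smooth_on_def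
proof
  fix k
  have op: "open (- {0::real})" by auto
  show "Ck_on k (- {0::real}) inverse"
  proof (induction k)
    case 0
    show ?case by (auto intro!: continuous_intros)
  next
    case (Suc k)
    show ?case
    proof (rule Ck_on_SucI[OF op])
      show "(inverse has_derivative (\<lambda>v. - (inverse x * v * inverse x))) (at x)"
        if "x \<in> - {0::real}" for x
        using that has_derivative_inverse'[of x] by auto
      show "Ck_on k (- {0::real}) (\<lambda>x. - (inverse x * v * inverse x))" for v :: real
        by (intro op Suc.IH Ck_on_const Ck_on_bounded_linear[OF bounded_linear_minus[OF bounded_linear_ident]]
          Ck_on_bounded_bilinear[OF bounded_bilinear_mult])
    qed
  qed
qed

lemma smooth_on_divide:
  fixes F G :: "'a::real_normed_vector \<Rightarrow> real"
  assumes "open W" "smooth_on W F" "smooth_on W G" "\<And>x. x \<in> W \<Longrightarrow> G x \<noteq> 0"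
  shows "smooth_on W (\<lambda>x. F x / G x)"
  unfolding divide_inverse using assms
  by (intro smooth_on_bounded_bilinear[OF bounded_bilinear_mult]
      smooth_on_compose[OF _ _ _ smooth_on_inverse_real]) auto

lemma smooth_on_cosh_sinh: "smooth_on UNIV (cosh :: real \<Rightarrow> real)" "smooth_on UNIV (sinh :: real \<Rightarrow> real)"
proof -
  have hc: "(cosh has_derivative (\<lambda>v. sinh x * v)) (at x)"
    and hs: "(sinh has_derivative (\<lambda>v. cosh x * v)) (at x)" for x :: real
    by (auto intro!: derivative_eq_intros simp: field_simps)
  \<comment> \<open>Each function is the derivative of the other, so the induction has to carry
    both.\<close>
  have "Ck_on k UNIV (cosh :: real \<Rightarrow> real) \<and> Ck_on k UNIV (sinh :: real \<Rightarrow> real)" for k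
  proof (induction k)
    case 0
    show ?case by (auto intro!: continuous_intros)
  next
    case (Suc k)
    have "Ck_on k UNIV (\<lambda>x::real. cosh x * v)" "Ck_on k UNIV (\<lambda>x::real. sinh x * v)" for v
      using Suc by (auto intro!: Ck_on_bounded_bilinear[OF bounded_bilinear_mult] Ck_on_const)
    then show ?case
      using Ck_on_SucI[OF open_UNIV hc] Ck_on_SucI[OF open_UNIV hs] by blast
  qed
  then show "smooth_on UNIV (cosh :: real \<Rightarrow> real)" "smooth_on UNIV (sinh :: real \<Rightarrow> real)"
    by (auto simp: smooth_on_def)
qed

lemma smooth_on_cosh: "open W \<Longrightarrow> smooth_on W F \<Longrightarrow> smooth_on W (\<lambda>x. cosh (F x :: real))"
  and smooth_on_sinh: "open W \<Longrightarrow> smooth_on W F \<Longrightarrow> smooth_on W (\<lambda>x. sinh (F x :: real))"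
  using smooth_on_compose[of W UNIV F] smooth_on_cosh_sinh by auto

lemma smooth_on_det:
  fixes F :: "'a::real_normed_vector \<Rightarrow> real^'k^'k"
  assumes "open W" "\<And>i j. smooth_on W (\<lambda>x. F x $ i $ j)"
  shows "smooth_on W (\<lambda>x. det (F x))"
  unfolding det_def using assms
  by (intro smooth_on_sum smooth_on_bounded_bilinear[OF bounded_bilinear_mult] smooth_on_const smooth_on_prod)
     auto

text \<open>Cramer's rule writes the solution as a quotient of determinants, which are polynomials
  in the smooth entries.\<close>

lemma smooth_on_linear_solve:
  fixes A :: "'a::real_normed_vector \<Rightarrow> real^'k^'k" and b :: "'a \<Rightarrow> real^'k"
  assumes W: "open W" and A: "\<And>i j. smooth_on W (\<lambda>x. A x $ i $ j)" and b: "smooth_on W b"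
    and det: "\<And>x. x \<in> W \<Longrightarrow> det (A x) \<noteq> 0"
  obtains y where "smooth_on W y" "\<And>x. x \<in> W \<Longrightarrow> A x *v y x = b x"
    "\<And>x u. x \<in> W \<Longrightarrow> A x *v u = b x \<Longrightarrow> u = y x"
proof
  let ?y = "\<lambda>x. \<chi> k. det (\<chi> i j. if j = k then b x $ i else A x $ i $ j) / det (A x)"
  have "smooth_on W (\<lambda>x. if j = k then b x $ i else A x $ i $ j)" for i j k
    using A smooth_on_vec_nth[OF W b] by (cases "j = k") auto
  then have "smooth_on W (\<lambda>x. det (\<chi> i j. if j = k then b x $ i else A x $ i $ j) / det (A x))" for k
    by (intro W smooth_on_divide smooth_on_det A det) auto
  then show "smooth_on W ?y"
    by (rule smooth_on_vec_lambda[OF W])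
  show *: "A x *v ?y x = b x" "A x *v u = b x \<Longrightarrow> u = ?y x" if "x \<in> W" for x u
    using cramer[OF det[OF that]] by auto
qed

section \<open>Second derivatives, closed one-forms and determinants\<close>

definition D2 :: "('a::real_normed_vector \<Rightarrow> 'b::real_normed_vector) \<Rightarrow> 'a \<Rightarrow> 'a \<Rightarrow> 'a \<Rightarrow> 'b" where
  "D2 F x v w = fd (\<lambda>y. fd F y w) x v"

lemma smooth_on_D2:
  assumes "smooth_on W F"
  shows "smooth_on W (\<lambda>x. D2 F x v w)"
  unfolding D2_def using assms by (intro smooth_on_fd)

lemma fd_has_derivative_D2:
  assumes "smooth_on W F" "x \<in> W"
  shows "((\<lambda>y. fd F y w) has_derivative (\<lambda>v. D2 F x v w)) (at x)"
  unfolding D2_def using assms by (intro smooth_on_has_derivative smooth_on_fd)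

lemma linear_D2_left:
  assumes "smooth_on W F" "x \<in> W"
  shows "linear (\<lambda>v. D2 F x v w)"
  using fd_has_derivative_D2[OF assms] has_derivative_linear by blast

lemma linear_D2_right:
  assumes "open W" "smooth_on W F" "x \<in> W"
  shows "linear (D2 F x v)"
proof (rule linearI)
  have lin: "linear (fd F y)" if "y \<in> W" for y
    using assms(2) that by (rule smooth_on_linear_fd)
  show "D2 F x v (w + w') = D2 F x v w + D2 F x v w'" for w w'
  proof -
    have "D2 F x v (w + w') = fd (\<lambda>y. fd F y w + fd F y w') x v"
      unfolding D2_def by (subst fd_cong[OF assms(1,3)]) (auto simp: linear_add lin)
    also have "\<dots> = D2 F x v w + D2 F x v w'"
      by (subst fd_eqI[OF has_derivative_add[OF fd_has_derivative_D2 fd_has_derivative_D2]])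
        (use assms in auto)
    finally show ?thesis .
  qed
  show "D2 F x v (r *\<^sub>R w) = r *\<^sub>R D2 F x v w" for r w
  proof -
    have "D2 F x v (r *\<^sub>R w) = fd (\<lambda>y. r *\<^sub>R fd F y w) x v"
      unfolding D2_def by (subst fd_cong[OF assms(1,3)]) (auto simp: linear_cmul lin)
    also have "\<dots> = r *\<^sub>R D2 F x v w"
      by (subst fd_eqI[OF has_derivative_scaleR_right[OF fd_has_derivative_D2]]) (use assms in auto)
    finally show ?thesis .
  qed
qed

section \<open>Symmetry of second derivatives\<close>

lemma has_derivative_along_line:
  assumes "(f has_derivative f') (at (p + t *\<^sub>R v))"
  shows "((\<lambda>t. f (p + t *\<^sub>R v)) has_vector_derivative f' v) (at t)"
proof -
  have "((\<lambda>t. f (p + t *\<^sub>R v)) has_derivative (\<lambda>h. f' (h *\<^sub>R v))) (at t)"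
    by (rule has_derivative_compose[where g = f and g' = f' and f = "\<lambda>t. p + t *\<^sub>R v"])
      (use assms in \<open>auto intro!: derivative_eq_intros\<close>)
  then show ?thesis
    unfolding has_vector_derivative_def
    using linear_cmul[OF has_derivative_linear[OF assms]] by simp
qed

text \<open>The mean value theorem twice: along \<open>v\<close> for the difference of
  \<open>f\<close> at two parallel segments, then along \<open>w\<close> for the derivative
  obtained. The bound on \<open>s\<close> keeps the whole parallelogram inside the ball.\<close>

lemma second_difference:
  fixes f :: "'a::real_normed_vector \<Rightarrow> real"
  assumes f: "smooth_on (ball x r) f" and s: "0 < s" "s * (norm v + norm w) < r"
  shows "\<exists>y\<in>ball x r. f (x + s *\<^sub>R v + s *\<^sub>R w) - f (x + s *\<^sub>R v) - f (x + s *\<^sub>R w) + f x = s\<^sup>2 * D2 f y w v"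
proof -
  have in_ball: "x + a *\<^sub>R v + b *\<^sub>R w \<in> ball x r" if "0 \<le> a" "a \<le> s" "0 \<le> b" "b \<le> s" for a b
  proof -
    have "norm (a *\<^sub>R v + b *\<^sub>R w) \<le> a * norm v + b * norm w"
      using norm_triangle_ineq[of "a *\<^sub>R v" "b *\<^sub>R w"] that by simp
    also have "\<dots> \<le> s * norm v + s * norm w"
      using that by (intro add_mono mult_right_mono) auto
    also have "\<dots> < r" using s by (simp add: algebra_simps)
    finally have "norm (a *\<^sub>R v + b *\<^sub>R w) < r" .
    moreover have "x - (x + a *\<^sub>R v + b *\<^sub>R w) = - (a *\<^sub>R v + b *\<^sub>R w)" by simp
    ultimately show ?thesis by (simp only: mem_ball dist_norm norm_minus_cancel)
  qed
  have der: "((\<lambda>t. f (x + s *\<^sub>R w + t *\<^sub>R v) - f (x + t *\<^sub>R v)) has_real_derivative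
      fd f (x + s *\<^sub>R w + t *\<^sub>R v) v - fd f (x + t *\<^sub>R v) v) (at t)" if "0 \<le> t" "t \<le> s" for t
  proof -
    have "x + s *\<^sub>R w + t *\<^sub>R v \<in> ball x r" "x + t *\<^sub>R v \<in> ball x r"
      using in_ball[of t s] in_ball[of t 0] that s by (simp_all add: algebra_simps)
    then show ?thesis
      unfolding has_real_derivative_iff_has_vector_derivative
      by (intro has_vector_derivative_diff has_derivative_along_line smooth_on_has_derivative[OF f])
  qed
  obtain t where t: "0 < t" "t < s"
    and eq: "f (x + s *\<^sub>R w + s *\<^sub>R v) - f (x + s *\<^sub>R v) - (f (x + s *\<^sub>R w) - f x) =
      s * (fd f (x + s *\<^sub>R w + t *\<^sub>R v) v - fd f (x + t *\<^sub>R v) v)"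
    using MVT2[OF s(1) der] by auto
  have der': "((\<lambda>u. fd f (x + t *\<^sub>R v + u *\<^sub>R w) v) has_real_derivative D2 f (x + t *\<^sub>R v + u *\<^sub>R w) w v) (at u)"
    if "0 \<le> u" "u \<le> s" for u
  proof -
    have "x + t *\<^sub>R v + u *\<^sub>R w \<in> ball x r" using in_ball t that by auto
    then show ?thesis
      unfolding has_real_derivative_iff_has_vector_derivative
      by (intro has_derivative_along_line fd_has_derivative_D2[OF f])
  qed
  obtain u where u: "0 < u" "u < s"
    and eq': "fd f (x + t *\<^sub>R v + s *\<^sub>R w) v - fd f (x + t *\<^sub>R v) v = s * D2 f (x + t *\<^sub>R v + u *\<^sub>R w) w v"
    using MVT2[OF s(1) der'] by auto
  show ?thesis
  proof (rule bexI)
    show "x + t *\<^sub>R v + u *\<^sub>R w \<in> ball x r" using in_ball t u by auto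
    show "f (x + s *\<^sub>R v + s *\<^sub>R w) - f (x + s *\<^sub>R v) - f (x + s *\<^sub>R w) + f x
        = s\<^sup>2 * D2 f (x + t *\<^sub>R v + u *\<^sub>R w) w v"
      using eq eq' by (simp add: algebra_simps power2_eq_square)
  qed
qed

text \<open>The second difference is symmetric in \<open>v\<close> and \<open>w\<close>, so the two
  mixed derivatives coincide, though at two different points near \<open>x\<close>. Continuity, with
  \<open>e\<close> half of the supposed gap at \<open>x\<close>, contradicts the gap.\<close>

lemma D2_sym_real:
  fixes f :: "'a::real_normed_vector \<Rightarrow> real"
  assumes W: "open W" "x \<in> W" and f: "smooth_on W f"
  shows "D2 f x v w = D2 f x w v"
proof (rule ccontr)
  assume ne: "D2 f x v w \<noteq> D2 f x w v"
  define e where "e = dist (D2 f x v w) (D2 f x w v) / 2"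
  have e: "e > 0" using ne by (simp add: e_def)
  have cont: "\<exists>d>0. \<forall>y. dist y x < d \<longrightarrow> dist (D2 f y a b) (D2 f x a b) < e" for a b
    using smooth_on_continuous_on[OF smooth_on_D2[OF f]] W e
    by (metis continuous_at continuous_on_eq_continuous_at continuous_at_eps_delta)
  obtain d1 where d1: "d1 > 0" "\<And>y. dist y x < d1 \<Longrightarrow> dist (D2 f y v w) (D2 f x v w) < e"
    using cont by blast
  obtain d2 where d2: "d2 > 0" "\<And>y. dist y x < d2 \<Longrightarrow> dist (D2 f y w v) (D2 f x w v) < e"
    using cont by blast
  obtain d3 where d3: "d3 > 0" "ball x d3 \<subseteq> W"
    using W open_contains_ball by blast
  define r where "r = min d1 (min d2 d3)"
  have r: "r > 0" "r \<le> d1" "r \<le> d2" "ball x r \<subseteq> W"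
    using d1 d2 d3 by (auto simp: r_def)
  \<comment> \<open>The summand 1 keeps the denominator positive when both vectors vanish and makes
    the bound for \<open>second_difference\<close> strict.\<close>
  define s where "s = r / (norm v + norm w + 1)"
  have pos: "norm v + norm w + 1 > 0" using norm_ge_zero[of v] norm_ge_zero[of w] by linarith
  have s: "0 < s" using r pos by (simp add: s_def)
  have "s * (norm v + norm w) < s * (norm v + norm w + 1)" using s by simp
  also have "\<dots> = r" using pos by (simp add: s_def)
  finally have sr: "s * (norm v + norm w) < r" .
  have fr: "smooth_on (ball x r) f" using smooth_on_subset[OF f r(4)] .
  obtain y where y: "y \<in> ball x r"
    "f (x + s *\<^sub>R v + s *\<^sub>R w) - f (x + s *\<^sub>R v) - f (x + s *\<^sub>R w) + f x = s\<^sup>2 * D2 f y w v"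
    using second_difference[OF fr s sr] by blast
  obtain z where z: "z \<in> ball x r"
    "f (x + s *\<^sub>R w + s *\<^sub>R v) - f (x + s *\<^sub>R w) - f (x + s *\<^sub>R v) + f x = s\<^sup>2 * D2 f z v w"
    using second_difference[OF fr s, of w v] sr by (auto simp: add.commute)
  have "s\<^sup>2 * D2 f y w v = s\<^sup>2 * D2 f z v w"
    using y(2) z(2) by (simp add: algebra_simps)
  then have "D2 f y w v = D2 f z v w" using s by simp
  moreover have "dist (D2 f y w v) (D2 f x w v) < e" "dist (D2 f z v w) (D2 f x v w) < e"
    using d1(2)[of z] d2(2)[of y] y(1) z(1) r by (auto simp: dist_commute)
  moreover have "dist (D2 f x v w) (D2 f x w v)
      \<le> dist (D2 f z v w) (D2 f x v w) + dist (D2 f z v w) (D2 f x w v)"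
    by (rule dist_triangle3)
  ultimately show False unfolding e_def by simp
qed

lemma D2_sym:
  fixes F :: "'a::real_normed_vector \<Rightarrow> 'b::euclidean_space"
  assumes W: "open W" "x \<in> W" and F: "smooth_on W F"
  shows "D2 F x v w = D2 F x w v"
proof (rule euclidean_eqI)
  fix b :: 'b assume "b \<in> Basis"
  have fd: "fd (\<lambda>x. F x \<bullet> b) y u = fd F y u \<bullet> b" if "y \<in> W" for y u
    by (subst fd_eqI[OF has_derivative_inner_left[OF smooth_on_has_derivative[OF F that]]]) simp
  have *: "D2 (\<lambda>x. F x \<bullet> b) x v w = D2 F x v w \<bullet> b" for v w
  proof -
    have "D2 (\<lambda>x. F x \<bullet> b) x v w = fd (\<lambda>y. fd F y w \<bullet> b) x v"
      unfolding D2_def using fd_cong[OF W, of "\<lambda>y. fd (\<lambda>x. F x \<bullet> b) y w"] fd by metis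
    also have "\<dots> = D2 F x v w \<bullet> b"
      by (subst fd_eqI[OF has_derivative_inner_left[OF fd_has_derivative_D2[OF F W(2)]]]) simp
    finally show ?thesis .
  qed
  have "smooth_on W (\<lambda>x. F x \<bullet> b)"
    by (rule smooth_on_bounded_linear[OF bounded_linear_inner_left W(1) F])
  then show "D2 F x v w \<bullet> b = D2 F x w v \<bullet> b"
    using D2_sym_real[OF W, of "\<lambda>x. F x \<bullet> b"] * by metis
qed

section \<open>Smooth inverse functions\<close>

lemma det_nonzeroI:
  fixes A :: "real^'k^'k"
  assumes "\<And>y. A *v y = 0 \<Longrightarrow> y = 0"
  shows "det A \<noteq> 0"
proof -
  have "\<exists>B. B ** A = mat 1"
    unfolding matrix_left_invertible_ker using assms by blast
  then show ?thesis
    by (simp add: invertible_det_nz[symmetric] invertible_left_inverse)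
qed

text \<open>Bootstrapping: for fixed \<open>v\<close>, the field \<open>Z v\<close> solving
  \<open>fd \<Phi> x (Z v x) = v\<close> is smooth by Cramer's rule, and the derivative of \<Psi> is
  \<open>Z v\<close> evaluated at \<Psi>. Hence class k of \<Psi> yields class k + 1. The
  enumeration \<open>e\<close> of the basis turns \<open>fd \<Phi> x\<close> into a matrix.\<close>

lemma smooth_on_inverse_map:
  fixes \<Phi> \<Psi> :: "'a::euclidean_space \<Rightarrow> 'a" and e :: "'k::finite \<Rightarrow> 'a"
  assumes e: "bij_betw e UNIV Basis"
    and U: "open U" and V: "open V" and \<Phi>: "smooth_on U \<Phi>"
    and \<Psi>: "\<And>y. y \<in> V \<Longrightarrow> \<Psi> y \<in> U" "continuous_on V \<Psi>"
    and inj: "\<And>x. x \<in> U \<Longrightarrow> inj (fd \<Phi> x)"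
    and der: "\<And>y. y \<in> V \<Longrightarrow> (\<Psi> has_derivative \<Psi>' y) (at y)"
    and inv: "\<And>y v. y \<in> V \<Longrightarrow> fd \<Phi> (\<Psi> y) (\<Psi>' y v) = v"
  shows "smooth_on V \<Psi>"
proof -
  define A :: "'a \<Rightarrow> real^'k^'k" where "A = (\<lambda>x. \<chi> i j. fd \<Phi> x (e j) \<bullet> e i)"
  have eB: "e i \<in> Basis" for i using e by (auto simp: bij_betw_def)
  have Bsum: "(\<Sum>b\<in>Basis. f b) = (\<Sum>i\<in>UNIV. f (e i))" for f :: "'a \<Rightarrow> 'a"
    using sum.reindex_bij_betw[OF e] by metis
  have A_mult: "A x *v y = (\<chi> i. fd \<Phi> x (\<Sum>j\<in>UNIV. y $ j *\<^sub>R e j) \<bullet> e i)" if "x \<in> U" for x y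
  proof -
    have lin: "linear (fd \<Phi> x)" by (rule smooth_on_linear_fd[OF \<Phi> that])
    have "(\<Sum>j\<in>UNIV. (fd \<Phi> x (e j) \<bullet> e i) * y $ j) = fd \<Phi> x (\<Sum>j\<in>UNIV. y $ j *\<^sub>R e j) \<bullet> e i" for i
      unfolding linear_sum[OF lin] linear_cmul[OF lin] inner_sum_left by (simp add: mult.commute)
    then show ?thesis
      by (simp add: A_def matrix_vector_mult_def)
  qed
  have eqI: "u = u'" if "\<And>i. u \<bullet> e i = u' \<bullet> e i" for u u' :: 'a
  proof (rule euclidean_eqI)
    fix b :: 'a assume "b \<in> Basis"
    then obtain i where "b = e i" using e by (auto simp: bij_betw_def)
    then show "u \<bullet> b = u' \<bullet> b" using that by simp
  qed
  have coord: "(\<Sum>j\<in>UNIV. (u \<bullet> e j) *\<^sub>R e j) = u" for u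
    using Bsum[of "\<lambda>b. (u \<bullet> b) *\<^sub>R b"] euclidean_representation[of u] by simp
  have indep: "y = 0" if "(\<Sum>j\<in>UNIV. y $ j *\<^sub>R e j) = 0" for y :: "real^'k"
  proof -
    have "y $ i = (\<Sum>j\<in>UNIV. y $ j *\<^sub>R e j) \<bullet> e i" for i
    proof -
      have "e j \<bullet> e i = (if j = i then 1 else 0)" for j
        using eB e by (auto simp: inner_Basis bij_betw_def inj_on_def)
      then have "(\<Sum>j\<in>UNIV. y $ j * (e j \<bullet> e i)) = (\<Sum>j\<in>UNIV. if j = i then y $ i else 0)"
        by (intro sum.cong) (auto split: if_splits)
      then show ?thesis by (simp add: inner_sum_left)
    qed
    then show ?thesis using that by (simp add: vec_eq_iff)
  qed
  have det: "det (A x) \<noteq> 0" if "x \<in> U" for x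
  proof (rule det_nonzeroI)
    fix y assume "A x *v y = 0"
    then have "fd \<Phi> x (\<Sum>j\<in>UNIV. y $ j *\<^sub>R e j) = 0"
      using A_mult[OF that] by (intro eqI) (simp add: vec_eq_iff)
    then have "(\<Sum>j\<in>UNIV. y $ j *\<^sub>R e j) = 0"
      using inj[OF that] linear_injective_0[OF smooth_on_linear_fd[OF \<Phi> that]] by blast
    then show "y = 0" by (rule indep)
  qed
  have smA: "smooth_on U (\<lambda>x. A x $ i $ j)" for i j
    unfolding A_def by (simp add: smooth_on_bounded_linear[OF bounded_linear_inner_left U smooth_on_fd[OF \<Phi>]])
  have "\<exists>y. smooth_on U y \<and> (\<forall>x\<in>U. A x *v y x = (\<chi> i. v \<bullet> e i))" for v
    by (rule smooth_on_linear_solve[OF U smA smooth_on_const[of U "\<chi> i. v \<bullet> e i"] det]) blast+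
  then obtain Y where Y: "\<And>v. smooth_on U (Y v)" "\<And>v x. x \<in> U \<Longrightarrow> A x *v Y v x = (\<chi> i. v \<bullet> e i)"
    by metis
  define Z where "Z v x = (\<Sum>j\<in>UNIV. Y v x $ j *\<^sub>R e j)" for v x
  have Zs: "smooth_on U (Z v)" for v
    unfolding Z_def
    by (intro U smooth_on_sum finite smooth_on_scaleR smooth_on_vec_nth smooth_on_const Y)
  have Z: "fd \<Phi> x (Z v x) = v" if "x \<in> U" for x v
    using Y(2)[OF that, of v] A_mult[OF that] by (intro eqI) (simp add: vec_eq_iff Z_def)
  have \<Psi>'Z: "\<Psi>' y v = Z v (\<Psi> y)" if "y \<in> V" for y v
    by (rule injD[OF inj[OF \<Psi>(1)[OF that]]]) (simp add: inv[OF that] Z[OF \<Psi>(1)[OF that]])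
  have der': "(\<Psi> has_derivative (\<lambda>v. Z v (\<Psi> y))) (at y)" if "y \<in> V" for y
    by (rule has_derivative_eq_rhs[OF der[OF that]], rule ext, rule \<Psi>'Z[OF that])
  have "Ck_on k V \<Psi>" for k
  proof (induction k)
    case 0
    show ?case using \<Psi>(2) by simp
  next
    case (Suc k)
    show ?case
    proof (rule Ck_on_SucI[OF V der'])
      show "Ck_on k V (\<lambda>y. Z v (\<Psi> y))" for v
        using Zs[of v] Suc by (intro Ck_on_compose[OF V U \<Psi>(1), where G = "Z v"]) (simp_all add: smooth_on_def)
    qed
  qed
  then show ?thesis by (simp add: smooth_on_def)
qed

text \<open>The inverse function theorem yields a differentiable local inverse from a derivative
  that is continuous as a bounded linear map, which on a Euclidean space can be checked vector by
  vector; \<open>smooth_on_inverse_map\<close> then raises the regularity.\<close>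

lemma smooth_inverse_function:
  fixes \<Phi> :: "'a::euclidean_space \<Rightarrow> 'a" and e :: "'k::finite \<Rightarrow> 'a"
  assumes e: "bij_betw e UNIV Basis"
    and B: "open B" and \<Phi>: "smooth_on B \<Phi>" and x0: "x0 \<in> B" and inj: "inj (fd \<Phi> x0)"
  obtains U V \<Psi> where "open U" "U \<subseteq> B" "x0 \<in> U" "open V" "homeomorphism U V \<Phi> \<Psi>" "smooth_on V \<Psi>"
    "\<And>y v. y \<in> V \<Longrightarrow> fd \<Phi> (\<Psi> y) (fd \<Psi> y v) = v"
    "\<And>y v. y \<in> V \<Longrightarrow> fd \<Psi> y (fd \<Phi> (\<Psi> y) v) = v"
proof -
  define f' where "f' x = Blinfun (fd \<Phi> x)" for x
  have f': "blinfun_apply (f' x) = fd \<Phi> x" if "x \<in> B" for x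
    unfolding f'_def using smooth_on_has_derivative[OF \<Phi> that] has_derivative_bounded_linear
    by (intro bounded_linear_Blinfun_apply) blast
  have der: "(\<Phi> has_derivative blinfun_apply (f' x)) (at x)" if "x \<in> B" for x
    using smooth_on_has_derivative[OF \<Phi> that] f'[OF that] by simp
  have cont: "continuous_on B f'"
  proof (rule continuous_on_blinfun_componentwise)
    fix i :: 'a
    have "continuous_on B (\<lambda>x. fd \<Phi> x i)"
      by (rule smooth_on_continuous_on[OF smooth_on_fd[OF \<Phi>]])
    then show "continuous_on B (\<lambda>x. blinfun_apply (f' x) i)"
      by (rule continuous_on_eq) (simp add: f')
  qed
  obtain G where G: "linear G" "G \<circ> fd \<Phi> x0 = id"
    using linear_injective_left_inverse[OF smooth_on_linear_fd[OF \<Phi> x0] inj] by blast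
  have "Blinfun G o\<^sub>L f' x0 = id_blinfun"
    using G by (intro blinfun_eqI)
      (simp add: f'[OF x0] bounded_linear_Blinfun_apply linear_conv_bounded_linear fun_eq_iff)
  from inverse_function_theorem[OF B der cont x0 this]
  obtain U V \<Psi> \<Psi>' where UV: "open U" "U \<subseteq> B" "x0 \<in> U" "open V" "homeomorphism U V \<Phi> \<Psi>"
    and d\<Psi>: "\<And>y. y \<in> V \<Longrightarrow> (\<Psi> has_derivative (\<Psi>' y)) (at y)"
    and \<Psi>': "\<And>y. y \<in> V \<Longrightarrow> \<Psi>' y = inv (blinfun_apply (f' (\<Psi> y)))"
    and bij: "\<And>y. y \<in> V \<Longrightarrow> bij (blinfun_apply (f' (\<Psi> y)))"
    by metis
  have \<Psi>U: "\<Psi> y \<in> U" if "y \<in> V" for y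
    using UV(5) that by (auto simp: homeomorphism_def)
  have bij': "bij (fd \<Phi> (\<Psi> y))" if "y \<in> V" for y
    using bij[OF that] f' \<Psi>U[OF that] UV(2) by (metis subsetD)
  have inv: "\<Psi>' y = inv (fd \<Phi> (\<Psi> y))" if "y \<in> V" for y
    using \<Psi>'[OF that] f' \<Psi>U[OF that] UV(2) by (metis subsetD)
  have 1: "fd \<Phi> (\<Psi> y) (\<Psi>' y v) = v" if "y \<in> V" for y v
    using inv[OF that] bij'[OF that] by (simp add: bij_is_surj surj_f_inv_f)
  have 2: "\<Psi>' y (fd \<Phi> (\<Psi> y) v) = v" if "y \<in> V" for y v
    using inv[OF that] bij'[OF that] by (simp add: bij_is_inj)
  have sm: "smooth_on V \<Psi>"
  proof (rule smooth_on_inverse_map[OF e UV(1,4) smooth_on_subset[OF \<Phi> UV(2)]])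
    show "inj (fd \<Phi> x)" if "x \<in> U" for x
    proof -
      have "\<Phi> x \<in> V" "\<Psi> (\<Phi> x) = x" using UV(5) that by (auto simp: homeomorphism_def)
      then show ?thesis using bij' bij_is_inj by metis
    qed
    show "continuous_on V \<Psi>" using UV(5) by (simp add: homeomorphism_def)
  qed (use \<Psi>U d\<Psi> 1 in auto)
  have fd\<Psi>: "fd \<Psi> y = \<Psi>' y" if "y \<in> V" for y using fd_eqI[OF d\<Psi>[OF that]] .
  show thesis
    by (rule that[OF UV sm]) (use 1 2 fd\<Psi> in auto)
qed

text \<open>The potential is the integral of \<eta> along the segment from \<open>x0\<close> to
  \<open>y\<close>. Closedness turns the \<open>y\<close>-derivative of the integrand in direction
  \<open>v\<close> into the \<open>s\<close>-derivative of \<open>s * \<eta> (c y s) v\<close>,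
  which integrates to \<open>\<eta> y v\<close>.\<close>

lemma poincare_lemma_one_forms:
  fixes \<eta> :: "'a::euclidean_space \<Rightarrow> 'a \<Rightarrow> real"
  assumes lin: "\<And>y. y \<in> ball x0 r \<Longrightarrow> linear (\<eta> y)"
    and sm: "\<And>v. smooth_on (ball x0 r) (\<lambda>y. \<eta> y v)"
    and closed: "\<And>y v w. y \<in> ball x0 r \<Longrightarrow> fd (\<lambda>z. \<eta> z w) y v = fd (\<lambda>z. \<eta> z v) y w"
  obtains t where "\<And>y. y \<in> ball x0 r \<Longrightarrow> (t has_derivative \<eta> y) (at y)"
proof -
  let ?B = "ball x0 r"
  define c where "c y s = x0 + s *\<^sub>R (y - x0)" for y :: 'a and s :: real
  have cB: "c y s \<in> ?B" if "y \<in> ?B" "s \<in> cbox 0 1" for y s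
  proof -
    have "norm (s *\<^sub>R (y - x0)) \<le> 1 * norm (y - x0)"
      using that by (simp add: mult_left_le_one_le)
    then show ?thesis using that by (simp add: c_def dist_norm norm_minus_commute)
  qed
  \<comment> \<open>The integrand \<open>\<eta> (c y s) (y - x0)\<close>, expanded in the basis so
    that \<eta> occurs in fixed directions only; \<open>f'\<close> is its derivative after
    closedness has exchanged two directions.\<close>
  define f where "f y s = (\<Sum>b\<in>Basis. ((y - x0) \<bullet> b) * \<eta> (c y s) b)" for y s
  define f' where "f' y s v = \<eta> (c y s) v + s * fd (\<lambda>z. \<eta> z v) (c y s) (y - x0)" for y s v
  have sum_b: "L u = (\<Sum>b\<in>Basis. (u \<bullet> b) * L b)" if "linear L" for L :: "'a \<Rightarrow> real" and u
    using linear_eq_sum_Basis[OF that, of u] by simp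
  have derf: "((\<lambda>y. f y s) has_derivative f' y s) (at y)" if y: "y \<in> ?B" and s: "s \<in> cbox 0 1" for y s
  proof -
    note cb = cB[OF y s]
    have dc: "((\<lambda>y. c y s) has_derivative (\<lambda>v. s *\<^sub>R v)) (at y)"
      unfolding c_def by (auto intro!: derivative_eq_intros)
    have d\<eta>: "((\<lambda>y. \<eta> (c y s) b) has_derivative (\<lambda>v. fd (\<lambda>z. \<eta> z b) (c y s) (s *\<^sub>R v))) (at y)" for b
      by (rule has_derivative_compose[OF dc smooth_on_has_derivative[OF sm cb]])
    have 1: "((\<lambda>y. f y s) has_derivative
       (\<lambda>v. \<Sum>b\<in>Basis. ((y - x0) \<bullet> b) * fd (\<lambda>z. \<eta> z b) (c y s) (s *\<^sub>R v) + (v \<bullet> b) * \<eta> (c y s) b)) (at y)"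
      unfolding f_def
      by (intro has_derivative_sum has_derivative_mult d\<eta> has_derivative_inner_left)
         (auto intro!: derivative_eq_intros)
    have "(\<Sum>b\<in>Basis. ((y - x0) \<bullet> b) * fd (\<lambda>z. \<eta> z b) (c y s) (s *\<^sub>R v) + (v \<bullet> b) * \<eta> (c y s) b)
        = f' y s v" for v
    proof -
      have l: "linear (fd (\<lambda>z. \<eta> z b) (c y s))" for b by (rule smooth_on_linear_fd[OF sm cb])
      have "(\<Sum>b\<in>Basis. ((y - x0) \<bullet> b) * fd (\<lambda>z. \<eta> z b) (c y s) (s *\<^sub>R v))
          = s * (\<Sum>b\<in>Basis. ((y - x0) \<bullet> b) * fd (\<lambda>z. \<eta> z v) (c y s) b)"
        by (simp add: linear_cmul[OF l] closed[OF cb, of _ v] sum_distrib_left mult.left_commute)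
      also have "\<dots> = s * fd (\<lambda>z. \<eta> z v) (c y s) (y - x0)"
        using sum_b[OF l[of v], of "y - x0"] by simp
      finally show ?thesis
        using sum_b[OF lin[OF cb], of v] by (simp add: f'_def sum.distrib)
    qed
    then show ?thesis
      by (intro has_derivative_eq_rhs[OF 1] ext)
  qed
  define fx where "fx y s = Blinfun (f' y s)" for y s
  have fx: "blinfun_apply (fx y s) = f' y s" if "y \<in> ?B" "s \<in> cbox 0 1" for y s
    unfolding fx_def using has_derivative_bounded_linear[OF derf[OF that]]
    by (rule bounded_linear_Blinfun_apply)
  have cont_c: "continuous_on (?B \<times> cbox 0 1) (\<lambda>p. c (fst p) (snd p))"
    unfolding c_def by (intro continuous_intros)
  have cont_comp: "continuous_on (?B \<times> cbox 0 1) (\<lambda>p. h (c (fst p) (snd p)))"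
    if "smooth_on ?B h" for h :: "'a \<Rightarrow> real"
    by (rule continuous_on_compose2[OF smooth_on_continuous_on[OF that] cont_c]) (auto intro!: cB)
  have cont_f': "continuous_on (?B \<times> cbox 0 1) (\<lambda>p. f' (fst p) (snd p) v)" for v
  proof -
    have "continuous_on (?B \<times> cbox 0 1) (\<lambda>p. \<eta> (c (fst p) (snd p)) v +
        snd p * (\<Sum>b\<in>Basis. ((fst p - x0) \<bullet> b) * fd (\<lambda>z. \<eta> z v) (c (fst p) (snd p)) b))"
      by (intro continuous_intros cont_comp sm smooth_on_fd)
    moreover have "\<eta> (c (fst p) (snd p)) v +
        snd p * (\<Sum>b\<in>Basis. ((fst p - x0) \<bullet> b) * fd (\<lambda>z. \<eta> z v) (c (fst p) (snd p)) b)
        = f' (fst p) (snd p) v" if "p \<in> ?B \<times> cbox 0 1" for p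
    proof -
      have "c (fst p) (snd p) \<in> ?B" using that by (intro cB) auto
      then show ?thesis
        using sum_b[OF smooth_on_linear_fd[OF sm[of v]], of "c (fst p) (snd p)" "fst p - x0"]
        by (simp add: f'_def)
    qed
    ultimately show ?thesis by (rule continuous_on_eq)
  qed
  have cont_fx: "continuous_on (?B \<times> cbox 0 1) (\<lambda>(y, s). fx y s)"
  proof (rule continuous_on_blinfun_componentwise)
    fix i :: 'a
    show "continuous_on (?B \<times> cbox 0 1) (\<lambda>p. blinfun_apply (case p of (y, s) \<Rightarrow> fx y s) i)"
      by (rule continuous_on_eq[OF cont_f'[of i]]) (auto simp: fx)
  qed
  have cont_slice: "continuous_on (cbox 0 1) (\<lambda>s. c y s)" for y
    unfolding c_def by (intro continuous_intros)
  have int_f: "f y integrable_on cbox 0 1" if y: "y \<in> ?B" for y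
  proof (rule integrable_continuous)
    have "continuous_on (cbox 0 1) (\<lambda>s. \<eta> (c y s) b)" for b
      by (rule continuous_on_compose2[OF smooth_on_continuous_on[OF sm] cont_slice]) (use cB y in auto)
    then show "continuous_on (cbox 0 1) (f y)"
      unfolding f_def by (intro continuous_intros)
  qed
  define t where "t y = integral (cbox 0 1) (f y)" for y
  show thesis
  proof (rule that)
    fix y assume y: "y \<in> ?B"
    have "(t has_derivative blinfun_apply (integral (cbox 0 1) (fx y))) (at y within ?B)"
      unfolding t_def
    proof (rule leibniz_rule[OF _ int_f cont_fx y])
      show "((\<lambda>x. f x s) has_derivative blinfun_apply (fx x s)) (at x within ?B)"
        if "x \<in> ?B" "s \<in> cbox 0 1" for x s
        using derf[OF that] fx[OF that] has_derivative_at_withinI by metis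
    qed auto
    then have 1: "(t has_derivative blinfun_apply (integral (cbox 0 1) (fx y))) (at y)"
      using y by (simp add: at_within_open[of _ ?B])
    have "blinfun_apply (integral (cbox 0 1) (fx y)) v = \<eta> y v" for v
    proof -
      have "continuous_on (cbox 0 1) (\<lambda>s. case (y, s) of (y, s) \<Rightarrow> fx y s)"
        by (rule continuous_on_compose2[OF cont_fx]) (use y in \<open>auto intro!: continuous_intros\<close>)
      then have "fx y integrable_on cbox 0 1"
        by (intro integrable_continuous) simp
      then have "blinfun_apply (integral (cbox 0 1) (fx y)) v = integral (cbox 0 1) (\<lambda>s. f' y s v)"
        by (subst blinfun_apply_integral) (auto intro!: integral_cong simp: fx[OF y])
      \<comment> \<open>\<open>f'\<close> is the derivative of \<open>s * \<eta> (c y s) v\<close>.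
        The lower boundary term carries the factor 0, and \<open>c y 1 = y\<close>.\<close>
      moreover have "((\<lambda>s. f' y s v) has_integral (1 * \<eta> (c y 1) v - 0 * \<eta> (c y 0) v)) {0..1}"
      proof (rule fundamental_theorem_of_calculus)
        fix s :: real assume s: "s \<in> {0..1}"
        have "x0 + s *\<^sub>R (y - x0) \<in> ?B"
          using cB[OF y, of s] s by (simp add: c_def)
        note has_derivative_along_line[OF smooth_on_has_derivative[OF sm[of v] this]]
        then have "((\<lambda>s. \<eta> (c y s) v) has_real_derivative fd (\<lambda>z. \<eta> z v) (c y s) (y - x0)) (at s)"
          by (simp add: c_def has_real_derivative_iff_has_vector_derivative)
        then have "((\<lambda>s. s * \<eta> (c y s) v) has_real_derivative f' y s v) (at s)"
          unfolding f'_def by (auto intro!: derivative_eq_intros)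
        then show "((\<lambda>s. s * \<eta> (c y s) v) has_vector_derivative f' y s v) (at s within {0..1})"
          by (simp add: has_real_derivative_iff_has_vector_derivative has_vector_derivative_at_within)
      qed simp
      ultimately show ?thesis
        by (simp add: c_def integral_unique)
    qed
    then show "(t has_derivative \<eta> y) (at y)"
      by (intro has_derivative_eq_rhs[OF 1] ext)
  qed
qed

section \<open>Derivatives of determinants and bordered matrices\<close>

lemma has_derivative_det:
  fixes R :: "'k::finite \<Rightarrow> 'a::real_normed_vector \<Rightarrow> real^'k"
  assumes "\<And>i. (R i has_derivative R' i) (at x)"
  shows "((\<lambda>y. det (\<chi> i. R i y)) has_derivative
    (\<lambda>v. \<Sum>i\<in>UNIV. det (\<chi> j. if j = i then R' i v else R j x))) (at x)"
proof -
  have d: "((\<lambda>y. R i y $ m) has_derivative (\<lambda>v. R' i v $ m)) (at x)" for i m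
    by (rule bounded_linear.has_derivative[OF bounded_linear_vec_nth assms])
  have 1: "((\<lambda>y. \<Sum>p\<in>{p. p permutes UNIV}. of_int (sign p) * (\<Prod>i\<in>UNIV. R i y $ p i)) has_derivative
     (\<lambda>v. \<Sum>p\<in>{p. p permutes UNIV}. of_int (sign p) * (\<Sum>i\<in>UNIV. R' i v $ p i * (\<Prod>j\<in>UNIV - {i}. R j x $ p j)))) (at x)"
    by (intro has_derivative_sum has_derivative_mult_right has_derivative_prod d)
  have 2: "(\<Sum>p\<in>{p. p permutes UNIV}. of_int (sign p) * (\<Sum>i\<in>UNIV. R' i v $ p i * (\<Prod>j\<in>UNIV - {i}. R j x $ p j)))
     = (\<Sum>i\<in>UNIV. det (\<chi> j. if j = i then R' i v else R j x))" for v
  proof -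
    have "(\<Prod>j\<in>UNIV. (if j = i then R' i v else R j x) $ p j) = R' i v $ p i * (\<Prod>j\<in>UNIV - {i}. R j x $ p j)" for i p
      by (subst prod.remove[of _ i]) (auto intro!: prod.cong)
    then have "(\<Sum>i\<in>UNIV. det (\<chi> j. if j = i then R' i v else R j x)) =
      (\<Sum>i\<in>UNIV. \<Sum>p\<in>{p. p permutes UNIV}. of_int (sign p) * (R' i v $ p i * (\<Prod>j\<in>UNIV - {i}. R j x $ p j)))"
      by (simp add: det_def)
    also have "\<dots> = (\<Sum>p\<in>{p. p permutes UNIV}. \<Sum>i\<in>UNIV. of_int (sign p) * (R' i v $ p i * (\<Prod>j\<in>UNIV - {i}. R j x $ p j)))"
      by (rule sum.swap)
    finally show ?thesis by (simp add: sum_distrib_left)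
  qed
  show ?thesis
    using has_derivative_eq_rhs[OF 1 ext[OF 2]] by (simp add: det_def)
qed

definition blk :: "real \<Rightarrow> real^'i^'i \<Rightarrow> real^('i::finite option)^('i option)" where
  "blk a A = (\<chi> k l. case k of None \<Rightarrow> (case l of None \<Rightarrow> a | Some j \<Rightarrow> 0)
     | Some i \<Rightarrow> (case l of None \<Rightarrow> 0 | Some j \<Rightarrow> A $ i $ j))"

lemma UNIV_option: "UNIV = insert None (range Some)"
  by (auto intro: option.exhaust)

lemma sum_UNIV_option: "(\<Sum>k\<in>UNIV. f k) = f None + (\<Sum>i\<in>UNIV. f (Some i))"
  for f :: "'i::finite option \<Rightarrow> 'b::comm_monoid_add"
  unfolding UNIV_option by (subst sum.insert) (auto simp: sum.reindex)

lemma prod_UNIV_option: "(\<Prod>k\<in>UNIV. f k) = f None * (\<Prod>i\<in>UNIV. f (Some i))"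
  for f :: "'i::finite option \<Rightarrow> 'b::comm_monoid_mult"
  unfolding UNIV_option by (subst prod.insert) (auto simp: prod.reindex)

text \<open>In the Leibniz sum a permutation that moves \<open>None\<close> meets a zero in row
  \<open>None\<close>; the remaining ones are the permutations of the smaller index set. Used with
  \<open>a = 1\<close> for a change of tangent frame that fixes the transversal row, and with
  \<open>a = - 1 / lam\<close> for the metric of a hyperbolic form.\<close>

lemma det_blk: "det (blk a (A :: real^'i^'i)) = a * det A"
proof -
  let ?M = "blk a A"
  let ?S = "range (Some :: 'i \<Rightarrow> 'i option)"
  define f where "f p = of_int (sign p) * (\<Prod>k\<in>UNIV. ?M $ k $ p k)" for p
  have None_fix: "q None = None" if "q permutes ?S" for q
    using that by (auto simp: permutes_def)
  have zero: "f (Transposition.transpose None b \<circ> q) = 0" if "b \<in> ?S" "q permutes ?S" for b q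
    unfolding f_def using that None_fix[of q] by (auto simp: prod_UNIV_option blk_def)
  have "det ?M = (\<Sum>p | p permutes insert None ?S. f p)"
    unfolding det_def f_def UNIV_option[symmetric] ..
  also have "\<dots> = (\<Sum>b\<in>insert None ?S. \<Sum>q | q permutes ?S. f (Transposition.transpose None b \<circ> q))"
    by (rule sum_over_permutations_insert) auto
  also have "\<dots> = (\<Sum>q | q permutes ?S. f q)"
    by (subst sum.insert) (auto simp: zero)
  also have "\<dots> = (\<Sum>p | p permutes (UNIV :: 'i set). f (map_permutation UNIV Some p))"
  proof (rule sum.reindex_bij_betw[symmetric])
    have "bij_betw Some UNIV ?S" by (simp add: bij_betw_def)
    from bij_betw_permutations[OF this]
    show "bij_betw (map_permutation UNIV Some) {p. p permutes (UNIV :: 'i set)} {q. q permutes ?S}"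
      by (simp add: map_permutation_def[abs_def] restrict_id_def[abs_def])
  qed
  also have "\<dots> = (\<Sum>p | p permutes (UNIV :: 'i set). a * (of_int (sign p) * (\<Prod>i\<in>UNIV. A $ i $ p i)))"
  proof (rule sum.cong)
    fix p assume "p \<in> {p. p permutes (UNIV :: 'i set)}"
    then have p: "p permutes UNIV" by simp
    have 1: "map_permutation UNIV Some p (Some i) = Some (p i)" for i
      by (simp add: map_permutation_apply)
    have 2: "map_permutation UNIV Some p None = None"
      using map_permutation_permutes[of Some UNIV ?S p] p None_fix by (auto simp: bij_betw_def)
    show "f (map_permutation UNIV Some p) = a * (of_int (sign p) * (\<Prod>i\<in>UNIV. A $ i $ p i))"
      unfolding f_def using p
      by (simp add: prod_UNIV_option 1 2 sign_map_permutation blk_def)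
  qed simp
  finally show ?thesis by (simp add: det_def sum_distrib_left)
qed

section \<open>Blaschke hypersurfaces in terms of second derivatives\<close>

lemma smooth_on_fd_apply:
  fixes f :: "'a::euclidean_space \<Rightarrow> 'b::real_normed_vector"
  assumes W: "open W" and f: "smooth_on W f" and Y: "smooth_on W Y"
  shows "smooth_on W (\<lambda>y. fd f y (Y y))"
proof (rule smooth_on_cong[OF W])
  show "(\<Sum>b\<in>Basis. (Y y \<bullet> b) *\<^sub>R fd f y b) = fd f y (Y y)" if "y \<in> W" for y
    using linear_eq_sum_Basis[OF smooth_on_linear_fd[OF f that]] by metis
  show "smooth_on W (\<lambda>y. \<Sum>b\<in>Basis. (Y y \<bullet> b) *\<^sub>R fd f y b)"
    by (intro smooth_on_sum W finite_Basis smooth_on_scaleR smooth_on_fd f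
        smooth_on_bounded_linear[OF bounded_linear_inner_left] Y)
qed

text \<open>The product rule behind both the Gauss formula (\<open>G\<close> the identity,
  \<open>Y\<close> a vector field) and the second derivative of a reparametrised map
  (\<open>G\<close> the change of parameter); once more by expansion in a basis.\<close>

lemma has_derivative_fd_apply:
  fixes f :: "'a::euclidean_space \<Rightarrow> 'b::real_normed_vector" and G :: "'c::real_normed_vector \<Rightarrow> 'a"
  assumes W: "open W" and f: "smooth_on W f"
    and W': "open W'" "x \<in> W'" "\<And>y. y \<in> W' \<Longrightarrow> G y \<in> W"
    and G: "(G has_derivative G') (at x)" and Y: "(Y has_derivative Y') (at x)"
  shows "((\<lambda>y. fd f (G y) (Y y)) has_derivative (\<lambda>v. D2 f (G x) (G' v) (Y x) + fd f (G x) (Y' v))) (at x)"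
proof -
  have Gx: "G x \<in> W" using W' by blast
  have d: "((\<lambda>y. fd f (G y) b) has_derivative (\<lambda>v. D2 f (G x) (G' v) b)) (at x)" for b
    by (rule has_derivative_compose[OF G fd_has_derivative_D2[OF f Gx]])
  have 1: "((\<lambda>y. \<Sum>b\<in>Basis. (Y y \<bullet> b) *\<^sub>R fd f (G y) b) has_derivative
      (\<lambda>v. \<Sum>b\<in>Basis. (Y x \<bullet> b) *\<^sub>R D2 f (G x) (G' v) b + (Y' v \<bullet> b) *\<^sub>R fd f (G x) b)) (at x)"
    by (intro has_derivative_sum has_derivative_scaleR has_derivative_inner_left Y d)
  have 2: "(\<Sum>b\<in>Basis. (Y x \<bullet> b) *\<^sub>R D2 f (G x) (G' v) b + (Y' v \<bullet> b) *\<^sub>R fd f (G x) b)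
      = D2 f (G x) (G' v) (Y x) + fd f (G x) (Y' v)" for v
    using linear_eq_sum_Basis[OF linear_D2_right[OF W f Gx], of "G' v" "Y x"]
      linear_eq_sum_Basis[OF smooth_on_linear_fd[OF f Gx], of "Y' v"]
    by (simp add: sum.distrib)
  have 3: "(\<Sum>b\<in>Basis. (Y y \<bullet> b) *\<^sub>R fd f (G y) b) = fd f (G y) (Y y)" if "y \<in> W'" for y
    using linear_eq_sum_Basis[OF smooth_on_linear_fd[OF f W'(3)[OF that]], of "Y y"] by simp
  show ?thesis
    by (rule has_derivative_transform_within_open[OF has_derivative_eq_rhs[OF 1 ext[OF 2]] W'(1,2) 3])
qed

lemma det_row_linear:
  fixes R :: "'k::finite \<Rightarrow> real^'k"
  shows "det (\<chi> k. if k = m then a *\<^sub>R u + b *\<^sub>R w else R k) =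
    a * det (\<chi> k. if k = m then u else R k) + b * det (\<chi> k. if k = m then w else R k)"
proof -
  have *: "c *s x = c *\<^sub>R x" for c and x :: "real^'k"
    by (simp add: vec_eq_iff)
  show ?thesis
    using det_row_add[of m "\<lambda>_. a *s u" "\<lambda>_. b *s w" R]
      det_row_mul[of m a "\<lambda>_. u" R] det_row_mul[of m b "\<lambda>_. w" R]
    unfolding * by simp
qed

lemma det_zeroI:
  fixes A :: "real^'k^'k"
  assumes "A *v y = 0" "y \<noteq> 0"
  shows "det A = 0"
  using assms matrix_left_invertible_ker[of A] invertible_left_inverse[of A] invertible_det_nz[of A] by blast

lemma transpose_rows_mult: "transpose (\<chi> k. R k) *v y = (\<Sum>k\<in>UNIV. y $ k *\<^sub>R R k)"
  for R :: "'k::finite \<Rightarrow> real^'m"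
  by (simp add: vec_eq_iff matrix_vector_mult_def transpose_def sum_component mult.commute)

lemma rows_mult: "(\<chi> k. R k) *v y = (\<chi> k. R k \<bullet> y)"
  for R :: "'k::finite \<Rightarrow> real^'m"
  by (simp add: vec_eq_iff matrix_vector_mult_def inner_vec_def)

lemma matrix_mult_rows: "A ** (\<chi> l. R l) = (\<chi> k. \<Sum>l\<in>UNIV. A $ k $ l *\<^sub>R R l)"
  for R :: "'k::finite \<Rightarrow> real^'m" and A :: "real^'k^'n"
  by (simp add: vec_eq_iff matrix_matrix_mult_def sum_component)

abbreviation gram_det :: "('v \<Rightarrow> 'v \<Rightarrow> real) \<Rightarrow> ('k::finite \<Rightarrow> 'v) \<Rightarrow> real" where
  "gram_det h X \<equiv> det ((\<chi> i j. h (X i) (X j)) :: real^'k^'k)"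

text \<open>An affine hypersphere without its connection: \<open>nabla\<close> survives only as the
  tangential remainder of \<open>D2 f\<close>, \<tau> = 0 is built into the Weingarten clause, and
  squaring the volume identity removes \<open>sgn\<close> and the square root.\<close>

definition sphere_data ::
  "'e::euclidean_space set \<Rightarrow> ('e \<Rightarrow> (real, 'i::finite option) vec) \<Rightarrow> ('e \<Rightarrow> (real, 'i option) vec) \<Rightarrow>
   real \<Rightarrow> ('e \<Rightarrow> 'e \<Rightarrow> 'e \<Rightarrow> real) \<Rightarrow> bool" where
  "sphere_data W f C lam h \<longleftrightarrow>
     immersion_on W f \<and> transversal_on W f C \<and>
     (\<forall>x\<in>W. \<forall>v. fd C x v = - lam *\<^sub>R fd f x v) \<and>
     (\<forall>x\<in>W. \<forall>v w. D2 f x v w - h x v w *\<^sub>R C x \<in> tangent_image f x) \<and>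
     nondegenerate_on W h \<and>
     (\<forall>x\<in>W. \<forall>X. \<bar>gram_det (h x) X\<bar> = (induced_volume f C x X)\<^sup>2)"

section \<open>Frames, conormal fields, and the equivalence of \<open>hypersphere_on\<close> with
  \<open>sphere_data\<close>\<close>

context
  fixes e :: "'i::finite \<Rightarrow> 'e::euclidean_space"
  assumes e: "bij_betw e UNIV Basis"
begin

lemma bij_Basis_inner: "e i \<bullet> e j = (if i = j then 1 else 0)"
proof -
  have "e i \<in> Basis" "e j \<in> Basis" "e i = e j \<longleftrightarrow> i = j"
    using e by (auto simp: bij_betw_def inj_eq)
  then show ?thesis by (simp add: inner_Basis)
qed

lemma bij_Basis_sum: "(\<Sum>i\<in>UNIV. (v \<bullet> e i) *\<^sub>R e i) = v"
  using sum.reindex_bij_betw[OF e, of "\<lambda>b. (v \<bullet> b) *\<^sub>R b"] euclidean_representation[of v] by simp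

lemma bij_Basis_linear: "linear L \<Longrightarrow> (\<Sum>i\<in>UNIV. (v \<bullet> e i) *\<^sub>R L (e i)) = L v"
  using arg_cong[OF bij_Basis_sum[of v], of L] by (simp add: linear_sum linear_cmul)

lemma bij_Basis_indep:
  assumes "(\<Sum>i\<in>UNIV. c i *\<^sub>R e i) = 0"
  shows "c j = 0"
proof -
  have "0 = (\<Sum>i\<in>UNIV. c i *\<^sub>R e i) \<bullet> e j" using assms by simp
  also have "\<dots> = (\<Sum>i\<in>UNIV. if i = j then c j else 0)"
    unfolding inner_sum_left by (intro sum.cong) (auto simp: bij_Basis_inner)
  finally show ?thesis by simp
qed

lemma frame_matrix_nonsingular:
  fixes L :: "'e \<Rightarrow> (real, 'i option) vec"
  assumes "linear L" "inj L" "c \<notin> range L"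
  shows "det (\<chi> k. case k of None \<Rightarrow> c | Some i \<Rightarrow> L (e i)) \<noteq> 0"
proof -
  let ?M = "\<chi> k. case k of None \<Rightarrow> c | Some i \<Rightarrow> L (e i)"
  have "det (transpose ?M) \<noteq> 0"
  proof (rule det_nonzeroI)
    fix y assume "transpose ?M *v y = 0"
    then have "y $ None *\<^sub>R c + L (\<Sum>i\<in>UNIV. y $ Some i *\<^sub>R e i) = 0"
      unfolding transpose_rows_mult sum_UNIV_option
      by (simp add: linear_sum[OF assms(1)] linear_cmul[OF assms(1)])
    then have *: "y $ None *\<^sub>R c = L (- (\<Sum>i\<in>UNIV. y $ Some i *\<^sub>R e i))"
      by (simp add: linear_neg[OF assms(1)] eq_neg_iff_add_eq_0)
    have 0: "y $ None = 0"
    proof (rule ccontr)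
      assume "y $ None \<noteq> 0"
      then have "c = L ((1 / y $ None) *\<^sub>R - (\<Sum>i\<in>UNIV. y $ Some i *\<^sub>R e i))"
        by (metis * linear_cmul[OF assms(1)] scaleR_scaleR nonzero_divide_eq_eq scaleR_one)
      then show False using assms(3) by blast
    qed
    then have "(\<Sum>i\<in>UNIV. y $ Some i *\<^sub>R e i) = 0"
      using * assms(1,2) by (metis (no_types) linear_injective_0 neg_equal_0_iff_equal scaleR_zero_left)
    then have "y $ Some i = 0" for i
      using bij_Basis_indep[of "\<lambda>i. y $ Some i"] by blast
    with 0 show "y = 0"
      by (simp add: vec_eq_iff) (metis option.exhaust)
  qed
  then show ?thesis by simp
qed

lemma frame_decompose:
  fixes L :: "'e \<Rightarrow> (real, 'i option) vec"
  assumes "linear L" "inj L" "c \<notin> range L"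
  obtains a u where "w = a *\<^sub>R c + L u"
proof -
  let ?M = "\<chi> k. case k of None \<Rightarrow> c | Some i \<Rightarrow> L (e i)"
  have "det (transpose ?M) \<noteq> 0" using frame_matrix_nonsingular[OF assms] by simp
  then obtain y where "transpose ?M *v y = w"
    using cramer by blast
  then have "w = y $ None *\<^sub>R c + L (\<Sum>i\<in>UNIV. y $ Some i *\<^sub>R e i)"
    unfolding transpose_rows_mult sum_UNIV_option
    by (simp add: linear_sum[OF assms(1)] linear_cmul[OF assms(1)])
  then show thesis by (rule that)
qed

lemma det_bilinear_change:
  fixes h :: "'e \<Rightarrow> 'e \<Rightarrow> real"
  assumes l: "\<And>w. linear (\<lambda>v. h v w)" and r: "\<And>v. linear (h v)"
  shows "gram_det h X =
    (det ((\<chi> i j. X i \<bullet> e j) :: real^'i^'i))\<^sup>2 * gram_det h e"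
proof -
  let ?A = "(\<chi> i j. X i \<bullet> e j) :: real^'i^'i" and ?H = "(\<chi> i j. h (e i) (e j)) :: real^'i^'i"
  have "(?A ** ?H ** transpose ?A) $ i $ j = h (X i) (X j)" for i j
  proof -
    have "(?A ** ?H) $ i $ k = h (X i) (e k)" for k
      using bij_Basis_linear[OF l, of "X i" "e k"] by (simp add: matrix_matrix_mult_def)
    then show ?thesis
      using bij_Basis_linear[OF r, of "X j" "X i"]
      by (subst matrix_matrix_mult_def) (simp add: transpose_def mult.commute)
  qed
  then have "(\<chi> i j. h (X i) (X j)) = ?A ** ?H ** transpose ?A"
    by (simp add: vec_eq_iff)
  then show ?thesis by (simp add: det_mul power2_eq_square)
qed

text \<open>The rows change by \<open>blk 1 ?A\<close>, the transversal row being fixed. With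
  \<open>det_bilinear_change\<close>, both sides of the volume condition scale by the same squared
  determinant, so a single frame decides it.\<close>

lemma induced_volume_change:
  fixes f C :: "'e \<Rightarrow> (real, 'i option) vec"
  assumes L: "linear (fd f x)"
  shows "induced_volume f C x X = det ((\<chi> i j. X i \<bullet> e j) :: real^'i^'i) * induced_volume f C x e"
proof -
  let ?A = "(\<chi> i j. X i \<bullet> e j) :: real^'i^'i"
  let ?M = "\<chi> k. case k of None \<Rightarrow> C x | Some i \<Rightarrow> fd f x (e i)"
  have "(\<chi> k. case k of None \<Rightarrow> C x | Some i \<Rightarrow> fd f x (X i)) $ k = (blk 1 ?A ** ?M) $ k" for k
    unfolding matrix_mult_rows sum_UNIV_option
    by (cases k) (simp_all add: blk_def bij_Basis_linear[OF L])
  then have "(\<chi> k. case k of None \<Rightarrow> C x | Some i \<Rightarrow> fd f x (X i)) = blk 1 ?A ** ?M"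
    by (rule iffD2[OF vec_eq_iff, rule_format])
  then show ?thesis by (simp add: induced_volume_def det_mul det_blk)
qed

text \<open>The conormal solves a linear system whose rows are the frame together with
  \<open>C\<close>, hence is smooth. It turns tangency into the linear equation
  \<open>\<nu> x \<bullet> w = 0\<close>, which can be differentiated.\<close>

lemma conormal_exists:
  fixes f C :: "'e \<Rightarrow> (real, 'i option) vec"
  assumes W: "open W" and f: "immersion_on W f" and C: "transversal_on W f C"
  obtains \<nu> where "smooth_on W \<nu>" "\<And>x. x \<in> W \<Longrightarrow> \<nu> x \<bullet> C x = 1"
    "\<And>x v. x \<in> W \<Longrightarrow> \<nu> x \<bullet> fd f x v = 0"
    "\<And>x w. x \<in> W \<Longrightarrow> w \<in> tangent_image f x \<longleftrightarrow> \<nu> x \<bullet> w = 0"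
proof -
  have sf: "smooth_on W f" and sC: "smooth_on W C" using f C by (auto simp: immersion_on_def transversal_on_def)
  let ?A = "\<lambda>x. \<chi> k. case k of None \<Rightarrow> C x | Some i \<Rightarrow> fd f x (e i)"
  have sA: "smooth_on W (\<lambda>x. ?A x $ k $ j)" for k j
    by (cases k) (simp_all add: smooth_on_vec_nth W sC smooth_on_fd sf)
  have lin: "linear (fd f x)" if "x \<in> W" for x by (rule smooth_on_linear_fd[OF sf that])
  have det: "det (?A x) \<noteq> 0" if "x \<in> W" for x
    using f C that by (intro frame_matrix_nonsingular lin) (auto simp: immersion_on_def transversal_on_def)
  obtain \<nu> where \<nu>: "smooth_on W \<nu>" "\<And>x. x \<in> W \<Longrightarrow> ?A x *v \<nu> x = axis None 1"
    using smooth_on_linear_solve[OF W sA smooth_on_const[of W "axis None 1"] det] by metis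
  have row: "\<nu> x \<bullet> (?A x $ k) = (if k = None then 1 else 0)" if "x \<in> W" for x k
    using arg_cong[OF \<nu>(2)[OF that], of "\<lambda>y. y $ k"]
    by (simp add: rows_mult axis_def inner_commute)
  have 1: "\<nu> x \<bullet> C x = 1" if "x \<in> W" for x using row[OF that, of None] by simp
  have 2: "\<nu> x \<bullet> fd f x v = 0" if "x \<in> W" for x v
  proof -
    have "\<nu> x \<bullet> fd f x (e i) = 0" for i using row[OF that, of "Some i"] by simp
    then show ?thesis
      by (simp flip: bij_Basis_linear[OF lin[OF that], of v] add: inner_sum_right)
  qed
  have 3: "w \<in> tangent_image f x \<longleftrightarrow> \<nu> x \<bullet> w = 0" if x: "x \<in> W" for x w
  proof
    show "w \<in> tangent_image f x \<Longrightarrow> \<nu> x \<bullet> w = 0" using 2[OF x] by auto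
    assume w: "\<nu> x \<bullet> w = 0"
    obtain a u where au: "w = a *\<^sub>R C x + fd f x u"
      using frame_decompose[OF lin[OF x]] f C x unfolding immersion_on_def transversal_on_def by metis
    then have "a = 0" using w 1[OF x] 2[OF x] by (simp add: inner_add_right)
    then show "w \<in> tangent_image f x" using au by simp
  qed
  show thesis by (rule that[OF \<nu>(1) 1 2 3])
qed

text \<open>The formula \<nabla>\<Theta> = \<tau> \<Theta> for the induced volume form. In the
  row-wise derivative, the multiple of \<open>C\<close> in a tangent row repeats row
  \<open>None\<close>, and the tangential part of row \<open>None\<close> makes all rows tangent;
  only the connection terms and \<open>t\<close> remain.\<close>

lemma volume_derivative:
  fixes f C :: "'e \<Rightarrow> (real, 'i option) vec"
  assumes W: "open W" "x \<in> W" and f: "immersion_on W f" and C: "transversal_on W f C"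
    and X: "\<And>i. smooth_on W (X i)"
    and dX: "\<And>i. fd (\<lambda>y. fd f y (X i y)) x z = fd f x (N i) + c i *\<^sub>R C x"
    and dC: "fd C x z = fd f x u + t *\<^sub>R C x"
  shows "fd (\<lambda>y. induced_volume f C y (\<lambda>i. X i y)) x z =
    (\<Sum>i\<in>UNIV. induced_volume f C x ((\<lambda>j. X j x)(i := N i))) + t * induced_volume f C x (\<lambda>j. X j x)"
proof -
  have sf: "smooth_on W f" and sC: "smooth_on W C" using f C by (auto simp: immersion_on_def transversal_on_def)
  obtain \<nu> where \<nu>: "\<nu> \<bullet> C x = 1" "\<And>v. \<nu> \<bullet> fd f x v = 0"
    using conormal_exists[OF W(1) f C] W(2) by metis
  then have \<nu>0: "\<nu> \<noteq> 0" by auto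
  define R where "R k y = (case k of None \<Rightarrow> C y | Some i \<Rightarrow> fd f y (X i y))" for k y
  define R' where "R' k v = (case k of None \<Rightarrow> fd C x v | Some i \<Rightarrow> fd (\<lambda>y. fd f y (X i y)) x v)" for k v
  have "(R k has_derivative R' k) (at x)" for k
    unfolding R_def[abs_def] R'_def[abs_def]
    by (cases k) (simp_all add: smooth_on_has_derivative[OF sC W(2)]
        smooth_on_has_derivative[OF smooth_on_fd_apply[OF W(1) sf X] W(2)])
  from fd_eqI[OF has_derivative_det[of R, OF this]]
  have "fd (\<lambda>y. induced_volume f C y (\<lambda>i. X i y)) x z
     = (\<Sum>k\<in>UNIV. det (\<chi> j. if j = k then R' k z else R j x))"
    by (simp add: induced_volume_def R_def fun_eq_iff)
  also have "\<dots> = det (\<chi> j. if j = None then R' None z else R j x)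
     + (\<Sum>i\<in>UNIV. det (\<chi> j. if j = Some i then R' (Some i) z else R j x))"
    by (rule sum_UNIV_option)
  also have "det (\<chi> j. if j = None then R' None z else R j x) = t * induced_volume f C x (\<lambda>j. X j x)"
  proof -
    \<comment> \<open>All rows are tangent, so the conormal is a nonzero kernel vector.\<close>
    have "det (\<chi> j. if j = None then fd f x u else R j x) = 0"
      by (rule det_zeroI[OF _ \<nu>0])
         (auto simp: rows_mult vec_eq_iff R_def inner_commute \<nu> split: option.split)
    moreover have "(\<chi> j. if j = None then C x else R j x)
        = (\<chi> k. case k of None \<Rightarrow> C x | Some i \<Rightarrow> fd f x (X i x))"
      by (auto simp: vec_eq_iff R_def split: option.split)
    moreover have "R' None z = 1 *\<^sub>R fd f x u + t *\<^sub>R C x"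
      by (simp add: R'_def dC)
    ultimately show ?thesis
      by (simp only: det_row_linear induced_volume_def mult_zero_right add_0)
  qed
  finally have total: "fd (\<lambda>y. induced_volume f C y (\<lambda>i. X i y)) x z =
     t * induced_volume f C x (\<lambda>j. X j x)
     + (\<Sum>i\<in>UNIV. det (\<chi> j. if j = Some i then R' (Some i) z else R j x))" .
  have "det (\<chi> j. if j = Some i then R' (Some i) z else R j x)
     = induced_volume f C x ((\<lambda>j. X j x)(i := N i))" for i
  proof -
    have "det (\<chi> j. if j = Some i then C x else R j x) = 0"
      by (rule det_identical_rows[of "Some i" None]) (auto simp: row_def vec_eq_iff R_def)
    moreover have "(\<chi> j. if j = Some i then fd f x (N i) else R j x)
        = (\<chi> k. case k of None \<Rightarrow> C x | Some j \<Rightarrow> fd f x (((\<lambda>j. X j x)(i := N i)) j))"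
      by (auto simp: vec_eq_iff R_def split: option.split)
    moreover have "R' (Some i) z = 1 *\<^sub>R fd f x (N i) + c i *\<^sub>R C x"
      by (simp add: R'_def dX)
    ultimately show ?thesis
      by (simp only: det_row_linear induced_volume_def mult_zero_right add_0_right mult_1)
  qed
  then show ?thesis using total by simp
qed

text \<open>Constant vector fields carry all the information: on them the Gauss formula is a
  statement about \<open>D2 f\<close>. Since the parallel metric volume equals the induced one,
  comparison with \<open>volume_derivative\<close> forces \<tau> = 0.\<close>

lemma hypersphere_on_imp_sphere_data:
  fixes f C :: "'e \<Rightarrow> (real, 'i option) vec"
  assumes W: "open W" and hs: "hypersphere_on W f C lam"
  obtains h where "sphere_data W f C lam h"
proof -
  from hs obtain nabla h S \<tau> where f: "immersion_on W f" and C: "transversal_on W f C"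
    and ind: "induced_objects W f C nabla h S \<tau>" and nd: "nondegenerate_on W h"
    and par: "parallel_form W nabla (metric_volume f C h)"
    and vol: "\<And>x X. x \<in> W \<Longrightarrow> metric_volume f C h x X = induced_volume f C x X"
    and S: "\<And>x v. x \<in> W \<Longrightarrow> S x v = lam *\<^sub>R v"
    unfolding hypersphere_on_def by blast
  have sf: "smooth_on W f" using f by (simp add: immersion_on_def)
  have lin: "linear (fd f x)" if "x \<in> W" for x by (rule smooth_on_linear_fd[OF sf that])
  have gauss: "D2 f x v w = fd f x (nabla (\<lambda>_. v) (\<lambda>_. w) x) + h x v w *\<^sub>R C x" if "x \<in> W" for x v w
    using ind that smooth_on_const unfolding induced_objects_def flat_D_def[abs_def] D2_def by blast
  have wein: "fd C x v = - fd f x (S x v) + \<tau> x v *\<^sub>R C x" if "x \<in> W" for x v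
  proof -
    have "smooth_on W (\<lambda>_. v)" by (rule smooth_on_const)
    then have "flat_D (\<lambda>_. v) C x = - pushf f (\<lambda>y. S y v) x + \<tau> x v *\<^sub>R C x"
      using ind that unfolding induced_objects_def by blast
    then show ?thesis by (simp add: flat_D_def)
  qed
  have ve: "induced_volume f C x e \<noteq> 0" if "x \<in> W" for x
    unfolding induced_volume_def using f C that
    by (intro frame_matrix_nonsingular lin) (auto simp: immersion_on_def transversal_on_def)
  have \<tau>: "\<tau> x v = 0" if x: "x \<in> W" for x v
  proof -
    have "fd (\<lambda>y. induced_volume f C y e) x v = fd (\<lambda>y. metric_volume f C h y e) x v"
      using fd_cong[OF W x, of "\<lambda>y. induced_volume f C y e" "\<lambda>y. metric_volume f C h y e"] vol by auto
    also have "\<dots> = (\<Sum>i\<in>UNIV. metric_volume f C h x (e(i := nabla (\<lambda>_. v) (\<lambda>_. e i) x)))"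
    proof -
      have "smooth_on W (\<lambda>_. v) \<and> (\<forall>i. smooth_on W (\<lambda>_. e i))" by (simp add: smooth_on_const)
      then have "flat_D (\<lambda>_. v) (\<lambda>y. metric_volume f C h y (\<lambda>i. e i)) x
        = (\<Sum>i\<in>UNIV. metric_volume f C h x ((\<lambda>j. e j)(i := nabla (\<lambda>_. v) (\<lambda>_. e i) x)))"
        using par x unfolding parallel_form_def by (elim allE[of _ "\<lambda>_. v"] allE[of _ "\<lambda>i _. e i"]) auto
      then show ?thesis by (simp add: flat_D_def)
    qed
    also have "\<dots> = (\<Sum>i\<in>UNIV. induced_volume f C x (e(i := nabla (\<lambda>_. v) (\<lambda>_. e i) x)))"
      using vol x by simp
    finally have 1: "fd (\<lambda>y. induced_volume f C y e) x v
      = (\<Sum>i\<in>UNIV. induced_volume f C x (e(i := nabla (\<lambda>_. v) (\<lambda>_. e i) x)))" .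
    have "fd C x v = fd f x (- S x v) + \<tau> x v *\<^sub>R C x"
      using wein[OF x] linear_neg[OF lin[OF x]] by simp
    then have "fd (\<lambda>y. induced_volume f C y (\<lambda>i. e i)) x v =
        (\<Sum>i\<in>UNIV. induced_volume f C x ((\<lambda>j. e j)(i := nabla (\<lambda>_. v) (\<lambda>_. e i) x)))
        + \<tau> x v * induced_volume f C x (\<lambda>j. e j)"
      using gauss[OF x, of v] unfolding D2_def
      by (intro volume_derivative[OF W x f C smooth_on_const])
    then have "\<tau> x v * induced_volume f C x e = 0"
      using 1 by simp
    then show ?thesis using ve[OF x] by simp
  qed
  obtain \<nu> where \<nu>: "\<And>x. x \<in> W \<Longrightarrow> \<nu> x \<bullet> C x = 1" "\<And>x v. x \<in> W \<Longrightarrow> \<nu> x \<bullet> fd f x v = 0"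
    using conormal_exists[OF W f C] by metis
  \<comment> \<open>\<open>induced_objects\<close> does not postulate bilinearity of
    \<open>h\<close>; it is inherited from the second derivative through this formula.\<close>
  have h: "h x v w = \<nu> x \<bullet> D2 f x v w" if "x \<in> W" for x v w
    using gauss[OF that] \<nu>[OF that] by (simp add: inner_add_right)
  have hl: "linear (\<lambda>v. h x v w)" and hr: "linear (h x v)" if "x \<in> W" for x v w
    using linear_D2_left[OF sf that, of w] linear_D2_right[OF W sf that, of v] h[OF that]
    by (simp_all add: linear_iff inner_add_right)
  have vol2: "\<bar>gram_det (h x) X\<bar> = (induced_volume f C x X)\<^sup>2" if x: "x \<in> W" for x X
  proof -
    \<comment> \<open>Squaring this identity leaves the absolute Gram determinant, because the
      volume of the frame \<open>e\<close> is nonzero and so its sign squares to 1.\<close>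
    have "sgn (induced_volume f C x e) * sqrt \<bar>gram_det (h x) e\<bar> = induced_volume f C x e"
      using vol[OF x, of e] by (simp add: metric_volume_def)
    then have "(sgn (induced_volume f C x e))\<^sup>2 * (sqrt \<bar>gram_det (h x) e\<bar>)\<^sup>2 = (induced_volume f C x e)\<^sup>2"
      by (metis power_mult_distrib)
    then have "\<bar>gram_det (h x) e\<bar> = (induced_volume f C x e)\<^sup>2"
      using ve[OF x] by (simp add: sgn_if split: if_splits)
    then show ?thesis
      unfolding det_bilinear_change[OF hl[OF x] hr[OF x], of X] induced_volume_change[OF lin[OF x], of C X]
      by (simp add: abs_mult power_mult_distrib)
  qed
  have "sphere_data W f C lam h"
    unfolding sphere_data_def
  proof (intro conjI f C nd ballI allI vol2)
    fix x v w assume x: "x \<in> W"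
    show "fd C x v = - lam *\<^sub>R fd f x v"
      using wein[OF x] S[OF x] \<tau>[OF x] linear_cmul[OF lin[OF x]] by simp
    show "D2 f x v w - h x v w *\<^sub>R C x \<in> tangent_image f x"
      using gauss[OF x] by simp
  qed
  then show thesis by (rule that)
qed

text \<open>A connection is obtained by choosing, point by point, the tangential part of the
  derivative of a pushforward. With \<tau> = 0 the induced volume form is parallel by
  \<open>volume_derivative\<close>, and the metric volume equals it.\<close>

lemma sphere_data_imp_hypersphere_on:
  fixes f C :: "'e \<Rightarrow> (real, 'i option) vec"
  assumes W: "open W" and sd: "sphere_data W f C lam h"
  shows "hypersphere_on W f C lam"
proof -
  from sd have f: "immersion_on W f" and C: "transversal_on W f C"
    and dC: "\<And>x v. x \<in> W \<Longrightarrow> fd C x v = - lam *\<^sub>R fd f x v"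
    and D2: "\<And>x v w. x \<in> W \<Longrightarrow> D2 f x v w - h x v w *\<^sub>R C x \<in> tangent_image f x"
    and nd: "nondegenerate_on W h"
    and vol: "\<And>x X. x \<in> W \<Longrightarrow> \<bar>gram_det (h x) X\<bar> = (induced_volume f C x X)\<^sup>2"
    unfolding sphere_data_def by blast+
  have sf: "smooth_on W f" using f by (simp add: immersion_on_def)
  have lin: "linear (fd f x)" if "x \<in> W" for x by (rule smooth_on_linear_fd[OF sf that])
  have "\<exists>u. fd (\<lambda>y. fd f y (Y y)) x (X x) = fd f x u + h x (X x) (Y x) *\<^sub>R C x"
    if Y: "smooth_on W Y" and x: "x \<in> W" for X Y x
  proof -
    obtain u where u: "D2 f x (X x) (Y x) - h x (X x) (Y x) *\<^sub>R C x = fd f x u"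
      using D2[OF x] by blast
    have "fd (\<lambda>y. fd f y (Y y)) x (X x) = D2 f x (X x) (Y x) + fd f x (fd Y x (X x))"
      by (subst fd_eqI[OF has_derivative_fd_apply[OF W sf W x _ has_derivative_ident smooth_on_has_derivative[OF Y x]]]) auto
    also have "\<dots> = fd f x (u + fd Y x (X x)) + h x (X x) (Y x) *\<^sub>R C x"
      using u linear_add[OF lin[OF x]] by (simp add: algebra_simps)
    finally show ?thesis by blast
  qed
  note ex = this
  define nabla where "nabla X Y x =
    (SOME u. fd (\<lambda>y. fd f y (Y y)) x (X x) = fd f x u + h x (X x) (Y x) *\<^sub>R C x)" for X Y :: "'e \<Rightarrow> 'e" and x
  have nabla: "fd (\<lambda>y. fd f y (Y y)) x (X x) = fd f x (nabla X Y x) + h x (X x) (Y x) *\<^sub>R C x"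
    if "smooth_on W Y" "x \<in> W" for X Y x
    unfolding nabla_def by (rule someI_ex[OF ex[OF that]])
  have mv: "metric_volume f C h x X = induced_volume f C x X" if "x \<in> W" for x X
    unfolding metric_volume_def vol[OF that] by (simp add: sgn_mult_abs)
  show ?thesis
    unfolding hypersphere_on_def
  proof (intro conjI f C exI)
    show "induced_objects W f C nabla h (\<lambda>x v. lam *\<^sub>R v) (\<lambda>_ _. 0)"
      unfolding induced_objects_def flat_D_def[abs_def]
      using nabla dC by (auto simp: linear_cmul[OF lin])
    show "parallel_form W nabla (metric_volume f C h)"
      unfolding parallel_form_def flat_D_def
    proof (intro allI impI ballI)
      fix Z :: "'e \<Rightarrow> 'e" and X :: "'i \<Rightarrow> 'e \<Rightarrow> 'e" and x
      assume sm: "smooth_on W Z \<and> (\<forall>i. smooth_on W (X i))" and x: "x \<in> W"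
      have "fd (\<lambda>y. metric_volume f C h y (\<lambda>i. X i y)) x (Z x) = fd (\<lambda>y. induced_volume f C y (\<lambda>i. X i y)) x (Z x)"
        using fd_cong[OF W x, of "\<lambda>y. induced_volume f C y (\<lambda>i. X i y)" "\<lambda>y. metric_volume f C h y (\<lambda>i. X i y)"] mv by auto
      also have "\<dots> = (\<Sum>i\<in>UNIV. induced_volume f C x ((\<lambda>j. X j x)(i := nabla Z (X i) x)))
          + 0 * induced_volume f C x (\<lambda>j. X j x)"
      proof (rule volume_derivative[OF W x f C])
        show "fd C x (Z x) = fd f x (- lam *\<^sub>R Z x) + 0 *\<^sub>R C x"
          using dC[OF x] linear_cmul[OF lin[OF x], of "- lam"] by simp
      qed (use sm nabla[OF _ x] in auto)
      finally show "fd (\<lambda>y. metric_volume f C h y (\<lambda>i. X i y)) x (Z x)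
          = (\<Sum>i\<in>UNIV. metric_volume f C h x ((\<lambda>j. X j x)(i := nabla Z (X i) x)))"
        using mv[OF x] by simp
    qed
  qed (use nd mv in auto)
qed

text \<open>The last two facts come from differentiating the constants
  \<open>\<nu> y \<bullet> C y = 1\<close> and \<open>\<nu> y \<bullet> fd f y w = 0\<close>, using
  that the derivative of \<open>C\<close> is tangential. They express \<open>h\<close> through first
  derivatives of \<nu>.\<close>

lemma sphere_data_conormal:
  fixes f C :: "'e \<Rightarrow> (real, 'i option) vec"
  assumes W: "open W" and sd: "sphere_data W f C lam h"
  obtains \<nu> where "smooth_on W \<nu>" "\<And>x. x \<in> W \<Longrightarrow> \<nu> x \<bullet> C x = 1"
    "\<And>x v. x \<in> W \<Longrightarrow> \<nu> x \<bullet> fd f x v = 0"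
    "\<And>x w. x \<in> W \<Longrightarrow> w \<in> tangent_image f x \<longleftrightarrow> \<nu> x \<bullet> w = 0"
    "\<And>x v w. x \<in> W \<Longrightarrow> h x v w = \<nu> x \<bullet> D2 f x v w"
    "\<And>x v. x \<in> W \<Longrightarrow> fd \<nu> x v \<bullet> C x = 0"
    "\<And>x v w. x \<in> W \<Longrightarrow> fd \<nu> x v \<bullet> fd f x w = - h x v w"
proof -
  from sd have f: "immersion_on W f" and C: "transversal_on W f C"
    and dC: "\<And>x v. x \<in> W \<Longrightarrow> fd C x v = - lam *\<^sub>R fd f x v"
    and D2: "\<And>x v w. x \<in> W \<Longrightarrow> D2 f x v w - h x v w *\<^sub>R C x \<in> tangent_image f x"
    unfolding sphere_data_def by blast+
  have sf: "smooth_on W f" and sC: "smooth_on W C" using f C by (auto simp: immersion_on_def transversal_on_def)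
  obtain \<nu> where \<nu>: "smooth_on W \<nu>" "\<And>x. x \<in> W \<Longrightarrow> \<nu> x \<bullet> C x = 1"
    "\<And>x v. x \<in> W \<Longrightarrow> \<nu> x \<bullet> fd f x v = 0"
    "\<And>x w. x \<in> W \<Longrightarrow> w \<in> tangent_image f x \<longleftrightarrow> \<nu> x \<bullet> w = 0"
    using conormal_exists[OF W f C] by metis
  have h: "h x v w = \<nu> x \<bullet> D2 f x v w" if "x \<in> W" for x v w
    using D2[OF that, of v w] \<nu>(4)[OF that] \<nu>(2)[OF that] by (simp add: inner_diff_right)
  have prod: "fd \<nu> x v \<bullet> F x + \<nu> x \<bullet> F' v = 0"
    if "x \<in> W" "(F has_derivative F') (at x)" "\<And>y. y \<in> W \<Longrightarrow> \<nu> y \<bullet> F y = c" for x v F F' c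
  proof -
    have "((\<lambda>y. \<nu> y \<bullet> F y) has_derivative (\<lambda>v. \<nu> x \<bullet> F' v + fd \<nu> x v \<bullet> F x)) (at x)"
      by (rule has_derivative_inner[OF smooth_on_has_derivative[OF \<nu>(1) that(1)] that(2)])
    then have "((\<lambda>y. c) has_derivative (\<lambda>v. \<nu> x \<bullet> F' v + fd \<nu> x v \<bullet> F x)) (at x)"
      by (rule has_derivative_transform_within_open[OF _ W that(1)]) (use that(3) in auto)
    then have "(\<lambda>v. \<nu> x \<bullet> F' v + fd \<nu> x v \<bullet> F x) = (\<lambda>v. 0)"
      using has_derivative_unique has_derivative_const by blast
    then show ?thesis by (metis add.commute)
  qed
  have 6: "fd \<nu> x v \<bullet> C x = 0" if "x \<in> W" for x v
    using prod[OF that smooth_on_has_derivative[OF sC that], of 1 v] \<nu>(2) dC[OF that] \<nu>(3)[OF that] by simp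
  have 7: "fd \<nu> x v \<bullet> fd f x w = - h x v w" if "x \<in> W" for x v w
    using prod[OF that fd_has_derivative_D2[OF sf that, of w], of 0 v] \<nu>(3) h[OF that] by simp
  show thesis by (rule that[OF \<nu> h 6 7])
qed

end

section \<open>Uniqueness of the Blaschke field and centres\<close>

text \<open>Write \<open>C'\<close> as \<phi> C plus a tangent part \<open>Z\<close>. The volume
  conditions force \<bar>\<phi>\<bar> = 1, so \<phi> has zero derivative; this derivative is - h(.,
  \<open>Z\<close>), and nondegeneracy gives \<open>Z x = 0\<close>.\<close>

lemma sphere_data_unique:
  fixes f C C' :: "'e::euclidean_space \<Rightarrow> (real, 'i::finite option) vec" and e :: "'i \<Rightarrow> 'e"
  assumes e: "bij_betw e UNIV Basis" and W: "open W" and sd: "sphere_data W f C lam h"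
    and sd': "sphere_data W f C' lam' h'" and x: "x \<in> W"
  shows "C' x = C x \<or> C' x = - C x"
proof -
  from sd have f: "immersion_on W f" and C: "transversal_on W f C" and nd: "nondegenerate_on W h"
    and vol: "\<And>x X. x \<in> W \<Longrightarrow> \<bar>gram_det (h x) X\<bar> = (induced_volume f C x X)\<^sup>2"
    unfolding sphere_data_def by blast+
  from sd' have C': "transversal_on W f C'" and dC': "\<And>x v. x \<in> W \<Longrightarrow> fd C' x v = - lam' *\<^sub>R fd f x v"
    and D2': "\<And>x v w. x \<in> W \<Longrightarrow> D2 f x v w - h' x v w *\<^sub>R C' x \<in> tangent_image f x"
    and vol': "\<And>x X. x \<in> W \<Longrightarrow> \<bar>gram_det (h' x) X\<bar> = (induced_volume f C' x X)\<^sup>2"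
    unfolding sphere_data_def by blast+
  have sf: "smooth_on W f" and sC': "smooth_on W C'" using f C' by (auto simp: immersion_on_def transversal_on_def)
  have lin: "linear (fd f y)" if "y \<in> W" for y by (rule smooth_on_linear_fd[OF sf that])
  obtain \<nu> where \<nu>: "smooth_on W \<nu>" "\<And>x. x \<in> W \<Longrightarrow> \<nu> x \<bullet> C x = 1"
    "\<And>x v. x \<in> W \<Longrightarrow> \<nu> x \<bullet> fd f x v = 0"
    "\<And>x w. x \<in> W \<Longrightarrow> w \<in> tangent_image f x \<longleftrightarrow> \<nu> x \<bullet> w = 0"
    "\<And>x v w. x \<in> W \<Longrightarrow> h x v w = \<nu> x \<bullet> D2 f x v w"
    "\<And>x v. x \<in> W \<Longrightarrow> fd \<nu> x v \<bullet> C x = 0"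
    "\<And>x v w. x \<in> W \<Longrightarrow> fd \<nu> x v \<bullet> fd f x w = - h x v w"
    by (rule sphere_data_conormal[OF e W sd]) (rule that)
  define \<phi> where "\<phi> y = \<nu> y \<bullet> C' y" for y
  have "\<exists>z. C' y = \<phi> y *\<^sub>R C y + fd f y z" if y: "y \<in> W" for y
  proof -
    have "\<nu> y \<bullet> (C' y - \<phi> y *\<^sub>R C y) = 0"
      by (simp add: inner_diff_right \<nu>(2)[OF y] \<phi>_def)
    then obtain z where "C' y - \<phi> y *\<^sub>R C y = fd f y z" using \<nu>(4)[OF y] by blast
    then have "C' y = \<phi> y *\<^sub>R C y + fd f y z" by (simp add: algebra_simps)
    then show ?thesis by blast
  qed
  then obtain Z where Z: "\<And>y. y \<in> W \<Longrightarrow> C' y = \<phi> y *\<^sub>R C y + fd f y (Z y)" by metis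
  have \<phi>1: "\<bar>\<phi> y\<bar> = 1" if y: "y \<in> W" for y
  proof -
    have hh: "h y v w = \<phi> y * h' y v w" for v w
      using D2'[OF y, of v w] \<nu>(4,5)[OF y] by (simp add: inner_diff_right \<phi>_def)
    have ve: "induced_volume f C y e \<noteq> 0"
      unfolding induced_volume_def using f C y
      by (intro frame_matrix_nonsingular[OF e] lin) (auto simp: immersion_on_def transversal_on_def)
    have ve': "induced_volume f C' y e = \<phi> y * induced_volume f C y e"
    proof -
      have \<nu>0: "\<nu> y \<noteq> 0" using \<nu>(2)[OF y] by auto
      define R where "R k = (case k of None \<Rightarrow> C y | Some i \<Rightarrow> fd f y (e i))" for k
      have "det (\<chi> k. if k = None then fd f y (Z y) else R k) = 0"
        by (rule det_zeroI[OF _ \<nu>0])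
           (auto simp: rows_mult vec_eq_iff R_def inner_commute \<nu>(3)[OF y] split: option.split)
      moreover have "(\<chi> k. if k = None then c else R k) = (\<chi> k. case k of None \<Rightarrow> c | Some i \<Rightarrow> fd f y (e i))" for c
        by (auto simp: vec_eq_iff R_def split: option.split)
      ultimately show ?thesis
        using det_row_linear[of None "\<phi> y" "C y" 1 "fd f y (Z y)" R] Z[OF y]
        by (simp add: induced_volume_def cong: option.case_cong)
    qed
    have "gram_det (h y) e = \<phi> y ^ CARD('i) * gram_det (h' y) e"
    proof -
      have "((\<chi> i j. h y (e i) (e j)) :: real^'i^'i) = (\<chi> i. \<phi> y *s (\<chi> j. h' y (e i) (e j)))"
        by (simp add: vec_eq_iff hh)
      then show ?thesis by (simp add: det_rows_mul)
    qed
    \<comment> \<open>Passing to \<open>C'\<close> costs the Gram determinant one factor \<phi> per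
      dimension, and the squared volume two more: the exponent is N + 2.\<close>
    then have "(induced_volume f C y e)\<^sup>2 = \<bar>\<phi> y\<bar> ^ CARD('i) * (\<phi> y * induced_volume f C y e)\<^sup>2"
      using vol[OF y, of e] vol'[OF y, of e] ve' by (simp add: abs_mult power_abs)
    then have "\<bar>\<phi> y\<bar> ^ CARD('i) * (\<phi> y)\<^sup>2 = 1"
      using ve by (simp add: power_mult_distrib)
    then have "\<bar>\<phi> y\<bar> ^ (CARD('i) + 2) = 1 ^ (CARD('i) + 2)" by (simp only: power_add power2_abs power_one)
    then show ?thesis by (rule power_eq_imp_eq_base) auto
  qed
  \<comment> \<open>The derivative of \<phi> reduces to this pairing, since the derivative of
    \<open>C'\<close> is tangential. It vanishes because the square of \<phi> is constant and \<phi>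
    is nonzero.\<close>
  have d\<phi>: "fd \<nu> x v \<bullet> C' x = 0" for v
  proof -
    have "(\<phi> has_derivative (\<lambda>v. \<nu> x \<bullet> fd C' x v + fd \<nu> x v \<bullet> C' x)) (at x)"
      unfolding \<phi>_def[abs_def]
      by (rule has_derivative_inner[OF smooth_on_has_derivative[OF \<nu>(1) x] smooth_on_has_derivative[OF sC' x]])
    then have 1: "(\<phi> has_derivative (\<lambda>v. fd \<nu> x v \<bullet> C' x)) (at x)"
      using dC'[OF x] \<nu>(3)[OF x] by simp
    have "((\<lambda>y. (\<phi> y)\<^sup>2) has_derivative (\<lambda>v. 2 * \<phi> x * (fd \<nu> x v \<bullet> C' x))) (at x)"
      by (rule has_derivative_eq_rhs[OF has_derivative_power[OF 1]]) (simp add: fun_eq_iff)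
    then have "((\<lambda>y. 1) has_derivative (\<lambda>v. 2 * \<phi> x * (fd \<nu> x v \<bullet> C' x))) (at x)"
    proof (rule has_derivative_transform_within_open[OF _ W x])
      show "(\<phi> y)\<^sup>2 = 1" if "y \<in> W" for y using \<phi>1[OF that] by (simp add: power2_eq_1_iff abs_if split: if_splits)
    qed
    then have "(\<lambda>v. 2 * \<phi> x * (fd \<nu> x v \<bullet> C' x)) = (\<lambda>v. 0)"
      using has_derivative_unique has_derivative_const by blast
    then have "2 * \<phi> x * (fd \<nu> x v \<bullet> C' x) = 0" by metis
    then show ?thesis using \<phi>1[OF x] by auto
  qed
  have "h x v (Z x) = 0" for v
    using d\<phi>[of v] Z[OF x] \<nu>(6,7)[OF x] by (simp add: inner_add_right)
  then have "h x (Z x) v = 0" for v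
    using D2_sym[OF W x sf] \<nu>(5)[OF x] by metis
  then have "Z x = 0" using nd x unfolding nondegenerate_on_def by blast
  then have "C' x = \<phi> x *\<^sub>R C x" using Z[OF x] linear_0[OF lin[OF x]] by simp
  then show ?thesis using \<phi>1[OF x] by (auto simp: abs_if split: if_splits)
qed

text \<open>A change of parameter adds to the second derivative only the tangential term
  \<open>fd f (\<Psi> y) (D2 \<Psi> y v w)\<close>, so \<open>h\<close> is pulled back as a tensor;
  bijectivity of \<open>fd \<Psi> y\<close> keeps the tangent spaces.\<close>

lemma sphere_data_compose:
  fixes f C :: "'e::euclidean_space \<Rightarrow> (real, 'i::finite option) vec" and \<Psi> :: "'e \<Rightarrow> 'e"
  assumes W: "open W" and W': "open W'" and \<Psi>: "smooth_on W' \<Psi>" "\<And>y. y \<in> W' \<Longrightarrow> \<Psi> y \<in> W"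
    and bij: "\<And>y. y \<in> W' \<Longrightarrow> bij (fd \<Psi> y)" and sd: "sphere_data W f C lam h"
  shows "sphere_data W' (\<lambda>y. f (\<Psi> y)) (\<lambda>y. C (\<Psi> y)) lam (\<lambda>y v w. h (\<Psi> y) (fd \<Psi> y v) (fd \<Psi> y w))"
    and "\<And>y v. y \<in> W' \<Longrightarrow> fd (\<lambda>y. f (\<Psi> y)) y v = fd f (\<Psi> y) (fd \<Psi> y v)"
    and "\<And>y. y \<in> W' \<Longrightarrow> tangent_image (\<lambda>y. f (\<Psi> y)) y = tangent_image f (\<Psi> y)"
proof -
  from sd have f: "immersion_on W f" and C: "transversal_on W f C"
    and dC: "\<And>x v. x \<in> W \<Longrightarrow> fd C x v = - lam *\<^sub>R fd f x v"
    and D2f: "\<And>x v w. x \<in> W \<Longrightarrow> D2 f x v w - h x v w *\<^sub>R C x \<in> tangent_image f x"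
    and nd: "nondegenerate_on W h"
    and vol: "\<And>x X. x \<in> W \<Longrightarrow> \<bar>gram_det (h x) X\<bar> = (induced_volume f C x X)\<^sup>2"
    unfolding sphere_data_def by blast+
  have sf: "smooth_on W f" and sC: "smooth_on W C" using f C by (auto simp: immersion_on_def transversal_on_def)
  have chain: "fd (\<lambda>y. F (\<Psi> y)) y v = fd F (\<Psi> y) (fd \<Psi> y v)" if "smooth_on W F" "y \<in> W'"
    for F :: "'e \<Rightarrow> (real, 'i option) vec" and y v
    by (subst fd_eqI[OF has_derivative_compose[OF smooth_on_has_derivative[OF \<Psi>(1) that(2)]
          smooth_on_has_derivative[OF that(1) \<Psi>(2)[OF that(2)]]]]) simp
  show fdf: "fd (\<lambda>y. f (\<Psi> y)) y v = fd f (\<Psi> y) (fd \<Psi> y v)" if "y \<in> W'" for y v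
    by (rule chain[OF sf that])
  have lin: "linear (fd f y)" if "y \<in> W" for y by (rule smooth_on_linear_fd[OF sf that])
  have surj: "surj (fd \<Psi> y)" and inj: "inj (fd \<Psi> y)" if "y \<in> W'" for y
    using bij[OF that] by (auto simp: bij_def)
  show tan: "tangent_image (\<lambda>y. f (\<Psi> y)) y = tangent_image f (\<Psi> y)" if y: "y \<in> W'" for y
  proof -
    have "tangent_image (\<lambda>y. f (\<Psi> y)) y = fd f (\<Psi> y) ` range (fd \<Psi> y)"
      by (auto simp: fdf[OF y] image_image)
    then show ?thesis using surj[OF y] by simp
  qed
  show "sphere_data W' (\<lambda>y. f (\<Psi> y)) (\<lambda>y. C (\<Psi> y)) lam (\<lambda>y v w. h (\<Psi> y) (fd \<Psi> y v) (fd \<Psi> y w))"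
    unfolding sphere_data_def
  proof (intro conjI ballI allI)
    have "inj (fd (\<lambda>y. f (\<Psi> y)) y)" if "y \<in> W'" for y
    proof -
      have "fd (\<lambda>y. f (\<Psi> y)) y = fd f (\<Psi> y) \<circ> fd \<Psi> y" by (simp add: fun_eq_iff fdf[OF that])
      then show ?thesis
        using f \<Psi>(2)[OF that] inj[OF that] by (simp add: immersion_on_def inj_compose)
    qed
    then show "immersion_on W' (\<lambda>y. f (\<Psi> y))"
      unfolding immersion_on_def using smooth_on_compose[OF W' W \<Psi>(2) sf \<Psi>(1)] by blast
    show "transversal_on W' (\<lambda>y. f (\<Psi> y)) (\<lambda>y. C (\<Psi> y))"
      unfolding transversal_on_def
      using smooth_on_compose[OF W' W \<Psi>(2) sC \<Psi>(1)] C \<Psi>(2) tan unfolding transversal_on_def by simp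
    show "nondegenerate_on W' (\<lambda>y v w. h (\<Psi> y) (fd \<Psi> y v) (fd \<Psi> y w))"
      unfolding nondegenerate_on_def
    proof (intro ballI allI impI)
      fix y v assume y: "y \<in> W'" and 0: "\<forall>w. h (\<Psi> y) (fd \<Psi> y v) (fd \<Psi> y w) = 0"
      have "h (\<Psi> y) (fd \<Psi> y v) w = 0" for w
      proof -
        obtain w' where "w = fd \<Psi> y w'" using surj[OF y] by (metis surjD)
        then show ?thesis using 0 by simp
      qed
      then have "fd \<Psi> y v = 0" using nd \<Psi>(2)[OF y] unfolding nondegenerate_on_def by blast
      then show "v = 0"
        using inj[OF y] linear_injective_0[OF smooth_on_linear_fd[OF \<Psi>(1) y]] by blast
    qed
    fix y assume y: "y \<in> W'"
    show "fd (\<lambda>y. C (\<Psi> y)) y v = - lam *\<^sub>R fd (\<lambda>y. f (\<Psi> y)) y v" for v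
      using chain[OF sC y] fdf[OF y] dC[OF \<Psi>(2)[OF y]] by simp
    show "D2 (\<lambda>y. f (\<Psi> y)) y v w - h (\<Psi> y) (fd \<Psi> y v) (fd \<Psi> y w) *\<^sub>R C (\<Psi> y) \<in> tangent_image (\<lambda>y. f (\<Psi> y)) y" for v w
    proof -
      have "D2 (\<lambda>y. f (\<Psi> y)) y v w = fd (\<lambda>y. fd f (\<Psi> y) (fd \<Psi> y w)) y v"
        unfolding D2_def
        using fd_cong[OF W' y, of "\<lambda>y. fd (\<lambda>y. f (\<Psi> y)) y w" "\<lambda>y. fd f (\<Psi> y) (fd \<Psi> y w)"] fdf by auto
      also have "\<dots> = D2 f (\<Psi> y) (fd \<Psi> y v) (fd \<Psi> y w) + fd f (\<Psi> y) (D2 \<Psi> y v w)"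
        by (subst fd_eqI[OF has_derivative_fd_apply[OF W sf W' y \<Psi>(2)
                smooth_on_has_derivative[OF \<Psi>(1) y] fd_has_derivative_D2[OF \<Psi>(1) y]]]) auto
      finally have D: "D2 (\<lambda>y. f (\<Psi> y)) y v w = D2 f (\<Psi> y) (fd \<Psi> y v) (fd \<Psi> y w) + fd f (\<Psi> y) (D2 \<Psi> y v w)" .
      obtain u where "D2 f (\<Psi> y) (fd \<Psi> y v) (fd \<Psi> y w) - h (\<Psi> y) (fd \<Psi> y v) (fd \<Psi> y w) *\<^sub>R C (\<Psi> y) = fd f (\<Psi> y) u"
        using D2f[OF \<Psi>(2)[OF y]] by blast
      then have "D2 (\<lambda>y. f (\<Psi> y)) y v w - h (\<Psi> y) (fd \<Psi> y v) (fd \<Psi> y w) *\<^sub>R C (\<Psi> y) = fd f (\<Psi> y) (u + D2 \<Psi> y v w)"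
        unfolding D linear_add[OF lin[OF \<Psi>(2)[OF y]]] by (simp add: algebra_simps)
      then show ?thesis unfolding tan[OF y] by simp
    qed
    show "\<bar>det ((\<chi> i j. h (\<Psi> y) (fd \<Psi> y (X i)) (fd \<Psi> y (X j))) :: real^'i^'i)\<bar>
        = (induced_volume (\<lambda>y. f (\<Psi> y)) (\<lambda>y. C (\<Psi> y)) y X)\<^sup>2" for X
      using vol[OF \<Psi>(2)[OF y], of "\<lambda>i. fd \<Psi> y (X i)"] by (simp add: induced_volume_def fdf[OF y] cong: option.case_cong)
  qed
qed

text \<open>Only the derivatives of \<open>f\<close> and the values of \<open>C\<close> enter. This
  covers translating \<open>f\<close> to its centre and replacing a map by another one that agrees
  with it on \<open>W\<close>.\<close>

lemma sphere_data_cong: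
  fixes f f' C C' :: "'e::euclidean_space \<Rightarrow> (real, 'i::finite option) vec"
  assumes W: "open W" and f': "\<And>x. x \<in> W \<Longrightarrow> f' differentiable (at x)"
    and ff': "\<And>x. x \<in> W \<Longrightarrow> fd f' x = fd f x" and CC': "\<And>x. x \<in> W \<Longrightarrow> C' x = C x"
    and sd: "sphere_data W f C lam h"
  shows "sphere_data W f' C' lam h"
proof -
  have sf: "smooth_on W f" and sC: "smooth_on W C"
    using sd by (auto simp: sphere_data_def immersion_on_def transversal_on_def)
  have "smooth_on W (\<lambda>x. fd f' x v)" for v
    using smooth_on_cong[OF W _ smooth_on_fd[OF sf]] ff' by metis
  then have sf': "smooth_on W f'" using f' smooth_on_iff by blast
  have sC': "smooth_on W C'" using smooth_on_cong[OF W _ sC] CC' by metis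
  have fdC: "fd C' x = fd C x" if "x \<in> W" for x using fd_cong[OF W that] CC' by blast
  have D2': "D2 f' x v w = D2 f x v w" if "x \<in> W" for x v w
    unfolding D2_def using fd_cong[OF W that, of "\<lambda>y. fd f' y w" "\<lambda>y. fd f y w"] ff' by auto
  have vol: "induced_volume f' C' x X = induced_volume f C x X" if "x \<in> W" for x X
    unfolding induced_volume_def using ff'[OF that] CC'[OF that] by simp
  show ?thesis
    using sd sf' sC'
    unfolding sphere_data_def immersion_on_def transversal_on_def
    by (simp add: ff' CC' fdC D2' vol)
qed

section \<open>The structure J, frames of the model spaces, and properness of J-tangent
  hyperspheres\<close>

lemma swap_xy_swap_xy: "swap_xy (swap_xy k) = k"
  by (cases k rule: swap_xy.cases) simp_all

lemma Jt_Jt [simp]: "Jt (Jt v) = v"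
  by (simp add: Jt_def swap_xy_swap_xy)

lemma linear_Jt: "linear Jt"
  by (rule linearI) (simp_all add: Jt_def vec_eq_iff)

lemma bounded_linear_Jt: "bounded_linear Jt"
  using linear_Jt linear_conv_bounded_linear by blast

lemma Jt_linear_simps [simp]:
  "Jt (u + v) = Jt u + Jt v" "Jt (u - v) = Jt u - Jt v" "Jt (- v) = - Jt v" "Jt (c *\<^sub>R v) = c *\<^sub>R Jt v" "Jt 0 = 0"
  by (simp_all add: Jt_def vec_eq_iff)

text \<open>The \<open>z\<close>-direction sits at index \<open>None\<close>, so that the Gram
  matrix of a hyperbolic form has the shape \<open>blk\<close>.\<close>

definition model_frame :: "('n::finite + 'n) option \<Rightarrow> 'n model" where
  "model_frame k = (case k of None \<Rightarrow> (0, 1) | Some j \<Rightarrow> (axis j 1, 0))"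

lemma bij_betw_base_frame: "bij_betw (\<lambda>j. axis j (1::real)) UNIV (Basis :: (real^'k::finite) set)"
  unfolding bij_betw_def
  by (auto simp: Basis_vec_def inj_on_def axis_eq_axis)

lemma bij_betw_model_frame: "bij_betw model_frame UNIV Basis"
  unfolding bij_betw_def
proof
  show "inj model_frame"
    by (auto simp: inj_on_def model_frame_def axis_eq_axis split: option.splits)
  have "range model_frame = insert (0, 1) (range (\<lambda>j. (axis j (1::real), 0 :: real)))"
    unfolding UNIV_option image_insert image_image by (simp add: model_frame_def)
  then show "range (model_frame :: ('a + 'a) option \<Rightarrow> 'a model) = Basis"
    by (auto simp: Basis_prod_def Basis_vec_def)
qed

lemma Jt_tangent_imp_proper:
  fixes f C :: "'n::finite model \<Rightarrow> 'n ambient"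
  assumes W: "open W" and x: "x \<in> W" and sd: "sphere_data W f C lam h"
    and J: "\<And>y. y \<in> W \<Longrightarrow> Jt (C y) \<in> tangent_image f y"
  shows "lam \<noteq> 0"
proof
  assume lam: "lam = 0"
  have C: "transversal_on W f C" and sf: "smooth_on W f" and sC: "smooth_on W C" and nd: "nondegenerate_on W h"
    and dC: "\<And>v. fd C x v = 0"
    using sd lam x by (auto simp: sphere_data_def immersion_on_def transversal_on_def)
  obtain \<nu> where \<nu>: "smooth_on W \<nu>" "\<And>x w. x \<in> W \<Longrightarrow> w \<in> tangent_image f x \<longleftrightarrow> \<nu> x \<bullet> w = 0"
    "\<And>x v w. x \<in> W \<Longrightarrow> h x v w = \<nu> x \<bullet> D2 f x v w"
    "\<And>x v w. x \<in> W \<Longrightarrow> fd \<nu> x v \<bullet> fd f x w = - h x v w"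
    using sphere_data_conormal[OF bij_betw_model_frame W sd] by metis
  obtain z where z: "Jt (C x) = fd f x z" using J[OF x] by blast
  have "((\<lambda>y. \<nu> y \<bullet> Jt (C y)) has_derivative (\<lambda>v. \<nu> x \<bullet> Jt (fd C x v) + fd \<nu> x v \<bullet> Jt (C x))) (at x)"
    by (intro has_derivative_inner smooth_on_has_derivative[OF \<nu>(1) x]
        bounded_linear.has_derivative[OF bounded_linear_Jt] smooth_on_has_derivative[OF sC x])
  then have "((\<lambda>y. 0) has_derivative (\<lambda>v. \<nu> x \<bullet> Jt (fd C x v) + fd \<nu> x v \<bullet> Jt (C x))) (at x)"
    by (rule has_derivative_transform_within_open[OF _ W x]) (use J \<nu>(2) in auto)
  then have "(\<lambda>v. \<nu> x \<bullet> Jt (fd C x v) + fd \<nu> x v \<bullet> Jt (C x)) = (\<lambda>v. 0)"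
    using has_derivative_unique has_derivative_const by blast
  then have "\<nu> x \<bullet> Jt (fd C x v) + fd \<nu> x v \<bullet> Jt (C x) = 0" for v by metis
  then have "h x v z = 0" for v using z \<nu>(4)[OF x] dC by simp
  then have "h x z v = 0" for v using D2_sym[OF W x sf] \<nu>(3)[OF x] by metis
  then have "z = 0" using nd x unfolding nondegenerate_on_def by blast
  then have "Jt (C x) = 0" using z linear_0[OF smooth_on_linear_fd[OF sf x]] by simp
  then have "C x = 0" using Jt_Jt[of "C x"] by simp
  then have "C x = fd f x 0" using linear_0[OF smooth_on_linear_fd[OF sf x]] by simp
  then show False using C x unfolding transversal_on_def by blast
qed

section \<open>Charts, and the centre of a hypersphere on a connected manifold\<close>

lemma is_chartD:
  assumes "is_chart M (U, \<phi>)"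
  shows "openin M U" "U \<subseteq> topspace M" "open (\<phi> ` U)" "inj_on \<phi> U"
    "homeomorphic_map (subtopology M U) (top_of_set (\<phi> ` U)) \<phi>"
    "\<And>p. p \<in> U \<Longrightarrow> inv_into U \<phi> (\<phi> p) = p"
proof -
  show 1: "openin M U" and "open (\<phi> ` U)" and 5: "homeomorphic_map (subtopology M U) (top_of_set (\<phi> ` U)) \<phi>"
    using assms by (auto simp: is_chart_def)
  show 2: "U \<subseteq> topspace M" using 1 openin_subset by blast
  show "inj_on \<phi> U" using homeomorphic_imp_injective_map[OF 5] 2 by (simp add: Int_absorb1)
  then show "\<And>p. p \<in> U \<Longrightarrow> inv_into U \<phi> (\<phi> p) = p" by simp
qed

lemma is_chart_preimage:
  assumes c: "is_chart M (U, \<phi>)" and T: "open T"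
  shows "openin M {p \<in> U. \<phi> p \<in> T}"
proof -
  have "openin (subtopology M U) {p \<in> topspace (subtopology M U). \<phi> p \<in> \<phi> ` U \<inter> T}"
    by (rule openin_continuous_map_preimage[OF homeomorphic_imp_continuous_map[OF is_chartD(5)[OF c]]])
       (use T in \<open>auto intro: openin_open_Int\<close>)
  moreover have "{p \<in> topspace (subtopology M U). \<phi> p \<in> \<phi> ` U \<inter> T} = {p \<in> U. \<phi> p \<in> T}"
    using is_chartD(2)[OF c] by (auto simp: topspace_subtopology_subset)
  ultimately show ?thesis using openin_open_subtopology[OF is_chartD(1)[OF c]] by metis
qed

lemma is_chart_image:
  assumes c: "is_chart M (U, \<phi>)" and T: "openin M T" "T \<subseteq> U"
  shows "open (\<phi> ` T)"
proof -
  have "openin (subtopology M U) T" using T openin_open_subtopology[OF is_chartD(1)[OF c]] by metis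
  then have "openin (top_of_set (\<phi> ` U)) (\<phi> ` T)"
    using homeomorphic_map_openness_eq[OF is_chartD(5)[OF c]] by blast
  then show ?thesis using is_chartD(3)[OF c] openin_open_eq by blast
qed

lemma smooth_manifoldD:
  assumes "smooth_manifold M A"
  shows "\<And>c. c \<in> A \<Longrightarrow> is_chart M c"
    "\<And>p. p \<in> topspace M \<Longrightarrow> \<exists>U \<phi>. (U, \<phi>) \<in> A \<and> p \<in> U"
    "\<And>U \<phi> V \<psi>. (U, \<phi>) \<in> A \<Longrightarrow> (V, \<psi>) \<in> A \<Longrightarrow> smooth_on (\<phi> ` (U \<inter> V)) (\<psi> \<circ> inv_into U \<phi>)"
proof -
  have ch: "\<forall>c\<in>A. is_chart M c"
    using assms unfolding smooth_manifold_def by (elim conjE)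
  have tr: "\<forall>(U, \<phi>)\<in>A. \<forall>(V, \<psi>)\<in>A. smooth_on (\<phi> ` (U \<inter> V)) (\<psi> \<circ> inv_into U \<phi>)"
    using assms unfolding smooth_manifold_def by (elim conjE)
  show "\<And>c. c \<in> A \<Longrightarrow> is_chart M c" using ch by blast
  show "smooth_on (\<phi> ` (U \<inter> V)) (\<psi> \<circ> inv_into U \<phi>)" if "(U, \<phi>) \<in> A" "(V, \<psi>) \<in> A" for U \<phi> V \<psi>
    using bspec[OF tr that(1)] that(2) by auto
  fix p assume "p \<in> topspace M"
  then have "p \<in> \<Union>(fst ` A)" using assms unfolding smooth_manifold_def by metis
  then obtain c where "c \<in> A" "p \<in> fst c" by blast
  then show "\<exists>U \<phi>. (U, \<phi>) \<in> A \<and> p \<in> U" by (cases c) auto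
qed

lemma affine_hypersphereD:
  assumes "affine_hypersphere M A f C lam"
  shows "smooth_manifold M A" "connected_space M"
    "\<And>U \<phi>. (U, \<phi>) \<in> A \<Longrightarrow> hypersphere_on (\<phi> ` U) (f \<circ> inv_into U \<phi>) (C \<circ> inv_into U \<phi>) lam"
  using assms unfolding affine_hypersphere_def by blast+

text \<open>In every chart C + \<open>lam\<close> f has zero derivative, hence is locally constant;
  its level set through \<open>p0\<close> is open and closed, so it is the whole of the connected
  space.\<close>

lemma affine_hypersphere_constant:
  fixes C :: "'p \<Rightarrow> (real, 'i::finite option) vec" and e :: "'i \<Rightarrow> 'e::euclidean_space"
    and A :: "('p, 'e) chart set"
  assumes e: "bij_betw e UNIV Basis" and ah: "affine_hypersphere M A f C lam"
  obtains k where "\<And>p. p \<in> topspace M \<Longrightarrow> C p + lam *\<^sub>R f p = k"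
proof (cases "topspace M = {}")
  case True
  then show thesis using that by blast
next
  case False
  then obtain p0 where p0: "p0 \<in> topspace M" by blast
  define k where "k p = C p + lam *\<^sub>R f p" for p
  note sm = smooth_manifoldD[OF affine_hypersphereD(1)[OF ah]]
  note ch = sm(1) and hs = affine_hypersphereD(3)[OF ah]
  have loc: "\<exists>N. openin M N \<and> p \<in> N \<and> (\<forall>q\<in>N. k q = k p)" if p: "p \<in> topspace M" for p
  proof -
    obtain U \<phi> where U: "(U, \<phi>) \<in> A" "p \<in> U" using sm(2)[OF p] by blast
    note c = ch[OF U(1)]
    let ?W = "\<phi> ` U"
    have W: "open ?W" by (rule is_chartD(3)[OF c])
    obtain h where sd: "sphere_data ?W (f \<circ> inv_into U \<phi>) (C \<circ> inv_into U \<phi>) lam h"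
      by (rule hypersphere_on_imp_sphere_data[OF e W hs[OF U(1)]])
    have "\<phi> p \<in> ?W" using U by blast
    then obtain r where r: "r > 0" "ball (\<phi> p) r \<subseteq> ?W"
      using W open_contains_ball by blast
    have "(k \<circ> inv_into U \<phi> has_derivative (\<lambda>v. 0)) (at y)" if y: "y \<in> ball (\<phi> p) r" for y
    proof -
      have yW: "y \<in> ?W" using y r by blast
      have "smooth_on ?W (f \<circ> inv_into U \<phi>)" "smooth_on ?W (C \<circ> inv_into U \<phi>)"
        using sd by (auto simp: sphere_data_def immersion_on_def transversal_on_def)
      note smooth_on_has_derivative[OF this(1) yW] smooth_on_has_derivative[OF this(2) yW]
      then have d: "((\<lambda>x. (C \<circ> inv_into U \<phi>) x + lam *\<^sub>R (f \<circ> inv_into U \<phi>) x) has_derivative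
          (\<lambda>v. fd (C \<circ> inv_into U \<phi>) y v + lam *\<^sub>R fd (f \<circ> inv_into U \<phi>) y v)) (at y)"
        by (intro has_derivative_add has_derivative_scaleR_right)
      have z: "fd (C \<circ> inv_into U \<phi>) y v = - lam *\<^sub>R fd (f \<circ> inv_into U \<phi>) y v" for v
        using sd yW unfolding sphere_data_def by blast
      have "((\<lambda>x. (C \<circ> inv_into U \<phi>) x + lam *\<^sub>R (f \<circ> inv_into U \<phi>) x) has_derivative (\<lambda>v. 0)) (at y)"
        by (rule has_derivative_eq_rhs[OF d]) (simp add: z fun_eq_iff)
      then show ?thesis by (simp only: k_def[abs_def] o_def)
    qed
    note der = this
    have const: "(k \<circ> inv_into U \<phi>) y = (k \<circ> inv_into U \<phi>) (\<phi> p)" if y: "y \<in> ball (\<phi> p) r" for y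
    proof (rule has_derivative_zero_unique_connected[OF open_ball _ der y])
      show "\<phi> p \<in> ball (\<phi> p) r" using r by simp
    qed (auto intro: convex_connected)
    let ?N = "{q \<in> U. \<phi> q \<in> ball (\<phi> p) r}"
    have "openin M ?N" by (rule is_chart_preimage[OF c open_ball])
    moreover have "k q = k p" if "q \<in> ?N" for q
    proof -
      have "q \<in> U" "\<phi> q \<in> ball (\<phi> p) r" using that by blast+
      from const[OF this(2)] show ?thesis
        by (simp only: o_apply is_chartD(6)[OF c \<open>q \<in> U\<close>] is_chartD(6)[OF c U(2)])
    qed
    moreover have "p \<in> ?N" using U(2) r by simp
    ultimately show ?thesis by blast
  qed
  let ?S = "{p \<in> topspace M. k p = k p0}"
  have "openin M ?S"
  proof (subst openin_subopen, intro ballI)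
    fix p assume p: "p \<in> ?S"
    then obtain N where N: "openin M N" "p \<in> N" "\<forall>q\<in>N. k q = k p" using loc by blast
    then have "N \<subseteq> ?S" using p openin_subset by fastforce
    then show "\<exists>T. openin M T \<and> p \<in> T \<and> T \<subseteq> ?S" using N by blast
  qed
  moreover have "openin M (topspace M - ?S)"
  proof (subst openin_subopen, intro ballI)
    fix p assume p: "p \<in> topspace M - ?S"
    then obtain N where N: "openin M N" "p \<in> N" "\<forall>q\<in>N. k q = k p" using loc by blast
    then have "N \<subseteq> topspace M - ?S" using p openin_subset by fastforce
    then show "\<exists>T. openin M T \<and> p \<in> T \<and> T \<subseteq> topspace M - ?S" using N by blast
  qed
  ultimately have "openin M ?S \<and> closedin M ?S" by (simp add: closedin_def)
  then have "?S = {} \<or> ?S = topspace M"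
    using affine_hypersphereD(2)[OF ah] unfolding connected_space_clopen_in by blast
  then have "?S = topspace M" using p0 by blast
  then show thesis using that[of "k p0"] unfolding k_def by blast
qed

lemma affine_hypersphere_centre:
  fixes C :: "'p \<Rightarrow> (real, 'i::finite option) vec" and e :: "'i \<Rightarrow> 'e::euclidean_space"
    and A :: "('p, 'e) chart set"
  assumes e: "bij_betw e UNIV Basis" and ah: "affine_hypersphere M A f C lam" and lam: "lam \<noteq> 0"
  shows "\<exists>c. hypersphere_centre M A f c"
proof -
  obtain k where k: "\<And>p. p \<in> topspace M \<Longrightarrow> C p + lam *\<^sub>R f p = k"
    by (rule affine_hypersphere_constant[OF e ah]) (rule that)
  have "C p = - lam *\<^sub>R (f p - (1 / lam) *\<^sub>R k)" if "p \<in> topspace M" for p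
    using k[OF that] lam by (simp add: algebra_simps eq_diff_eq)
  then show ?thesis unfolding hypersphere_centre_def using ah lam by blast
qed

lemma Jt_tangent_hypersphere_charts:
  fixes A :: "('p, 'n::finite model) chart set"
  assumes "Jt_tangent_hypersphere M A f"
  obtains C lam where "affine_hypersphere M A f C lam"
    "\<And>U \<phi>. (U, \<phi>) \<in> A \<Longrightarrow> is_chart M (U, \<phi>)"
    "\<And>U \<phi>. (U, \<phi>) \<in> A \<Longrightarrow> \<exists>h. sphere_data (\<phi> ` U) (f \<circ> inv_into U \<phi>) (C \<circ> inv_into U \<phi>) lam h"
    "\<And>U \<phi> y. (U, \<phi>) \<in> A \<Longrightarrow> y \<in> \<phi> ` U \<Longrightarrow> Jt ((C \<circ> inv_into U \<phi>) y) \<in> tangent_image (f \<circ> inv_into U \<phi>) y"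
proof -
  obtain C lam where ah: "affine_hypersphere M A f C lam"
    and J: "\<And>U \<phi> p. (U, \<phi>) \<in> A \<Longrightarrow> p \<in> U \<Longrightarrow> Jt (C p) \<in> tangent_image (f \<circ> inv_into U \<phi>) (\<phi> p)"
    using assms unfolding Jt_tangent_hypersphere_def by blast
  have ch: "is_chart M (U, \<phi>)" if "(U, \<phi>) \<in> A" for U \<phi>
    by (rule smooth_manifoldD(1)[OF affine_hypersphereD(1)[OF ah] that])
  have "\<exists>h. sphere_data (\<phi> ` U) (f \<circ> inv_into U \<phi>) (C \<circ> inv_into U \<phi>) lam h" if "(U, \<phi>) \<in> A" for U \<phi>
    by (rule hypersphere_on_imp_sphere_data[OF bij_betw_model_frame is_chartD(3)[OF ch[OF that]]
          affine_hypersphereD(3)[OF ah that]]) blast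
  moreover have "Jt ((C \<circ> inv_into U \<phi>) y) \<in> tangent_image (f \<circ> inv_into U \<phi>) y"
    if U: "(U, \<phi>) \<in> A" and y: "y \<in> \<phi> ` U" for U \<phi> y
  proof -
    obtain p where "p \<in> U" "y = \<phi> p" using y by blast
    then show ?thesis using J[OF U] is_chartD(6)[OF ch[OF U]] by auto
  qed
  ultimately show thesis using that[OF ah ch] by blast
qed

lemma Jt_tangent_hypersphere_has_centre:
  fixes A :: "('p, 'n::finite model) chart set"
  assumes "Jt_tangent_hypersphere M A f"
  shows "\<exists>c. hypersphere_centre M A f c"
proof -
  from assms obtain C lam where ah: "affine_hypersphere M A f C lam"
    and ch: "\<And>U \<phi>. (U, \<phi>) \<in> A \<Longrightarrow> is_chart M (U, \<phi>)"
    and sd: "\<And>U \<phi>. (U, \<phi>) \<in> A \<Longrightarrow> \<exists>h. sphere_data (\<phi> ` U) (f \<circ> inv_into U \<phi>) (C \<circ> inv_into U \<phi>) lam h"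
    and J: "\<And>U \<phi> y. (U, \<phi>) \<in> A \<Longrightarrow> y \<in> \<phi> ` U \<Longrightarrow> Jt ((C \<circ> inv_into U \<phi>) y) \<in> tangent_image (f \<circ> inv_into U \<phi>) y"
    by (rule Jt_tangent_hypersphere_charts) blast
  show ?thesis
  proof (cases "topspace M = {}")
    case True
    then have "U = {}" if "(U, \<phi>) \<in> A" for U \<phi>
      using is_chartD(2)[OF ch[OF that]] True by blast
    \<comment> \<open>On an empty manifold nothing excludes that the given \<open>lam\<close> is 0.
      All conditions on empty chart images hold, so the nonzero value 1 replaces it.\<close>
    moreover have "hypersphere_on {} F G 1" for F G :: "'n model \<Rightarrow> 'n ambient"
      by (intro sphere_data_imp_hypersphere_on[OF bij_betw_model_frame, where h = "\<lambda>_ _ _. 0"])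
         (auto simp: sphere_data_def immersion_on_def transversal_on_def nondegenerate_on_def smooth_on_empty)
    ultimately have "hypersphere_on (\<phi> ` U) (f \<circ> inv_into U \<phi>) (C \<circ> inv_into U \<phi>) 1"
      if "(U, \<phi>) \<in> A" for U \<phi>
      using that by (metis image_empty)
    then have "affine_hypersphere M A f C 1"
      using ah unfolding affine_hypersphere_def by blast
    then show ?thesis by (rule affine_hypersphere_centre[OF bij_betw_model_frame]) simp
  next
    case False
    then obtain p where "p \<in> topspace M" by blast
    then obtain U \<phi> where U: "(U, \<phi>) \<in> A" "p \<in> U"
      using smooth_manifoldD(2)[OF affine_hypersphereD(1)[OF ah]] by blast
    obtain h where "sphere_data (\<phi> ` U) (f \<circ> inv_into U \<phi>) (C \<circ> inv_into U \<phi>) lam h"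
      using sd[OF U(1)] by blast
    then have "lam \<noteq> 0"
      using Jt_tangent_imp_proper[OF is_chartD(3)[OF ch[OF U(1)]], of "\<phi> p"] J[OF U(1)] U(2) by blast
    then show ?thesis by (rule affine_hypersphere_centre[OF bij_betw_model_frame ah])
  qed
qed

section \<open>The hyperbolic form and para-complex data\<close>

text \<open>This is exp(- z J), because J squares to the identity: a one-parameter group commuting
  with J.\<close>

definition boost :: "real \<Rightarrow> 'n::finite ambient \<Rightarrow> 'n ambient" where
  "boost z w = cosh z *\<^sub>R w - sinh z *\<^sub>R Jt w"

lemma hyperbolic_form_boost: "hyperbolic_form g (x, z) = boost z (Jt (g x))"
  by (simp add: hyperbolic_form_def boost_def)

lemma linear_boost: "linear (boost z)"
  by (rule linearI) (simp_all add: boost_def algebra_simps)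

lemma boost_linear_simps [simp]:
  "boost z (u + v) = boost z u + boost z v" "boost z (u - v) = boost z u - boost z v"
  "boost z (- v) = - boost z v" "boost z (c *\<^sub>R v) = c *\<^sub>R boost z v" "boost z 0 = 0"
  using linear_add[OF linear_boost] linear_diff[OF linear_boost] linear_neg[OF linear_boost]
    linear_cmul[OF linear_boost] linear_0[OF linear_boost] by auto

lemma Jt_boost: "Jt (boost z w) = boost z (Jt w)"
  by (simp add: boost_def)

lemma boost_boost: "boost z (boost z' w) = boost (z + z') w"
  by (simp add: boost_def cosh_add sinh_add algebra_simps)

lemma boost_0 [simp]: "boost 0 w = w"
  by (simp add: boost_def)

lemma boost_eq_iff [simp]: "boost z v = boost z w \<longleftrightarrow> v = w"
proof
  assume "boost z v = boost z w"
  then have "boost (- z) (boost z v) = boost (- z) (boost z w)" by simp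
  then show "v = w" by (simp add: boost_boost)
qed simp

lemma has_derivative_boost:
  assumes "(w has_derivative w') (at p)" "(z has_derivative z') (at p)"
  shows "((\<lambda>p. boost (z p) (w p)) has_derivative (\<lambda>v. boost (z p) (w' v) - z' v *\<^sub>R Jt (boost (z p) (w p)))) (at p)"
proof -
  have hc: "(cosh has_derivative (\<lambda>v. v * sinh y)) (at y)"
    and hs: "(sinh has_derivative (\<lambda>v. v * cosh y)) (at y)" for y :: real
    by (auto intro!: derivative_eq_intros simp: field_simps)
  note c = has_derivative_compose[OF assms(2) hc] and s = has_derivative_compose[OF assms(2) hs]
  have "((\<lambda>p. cosh (z p) *\<^sub>R w p - sinh (z p) *\<^sub>R Jt (w p)) has_derivative
     (\<lambda>v. (cosh (z p) *\<^sub>R w' v + (z' v * sinh (z p)) *\<^sub>R w p)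
        - (sinh (z p) *\<^sub>R Jt (w' v) + (z' v * cosh (z p)) *\<^sub>R Jt (w p)))) (at p)"
    by (intro has_derivative_diff has_derivative_scaleR c s assms
        bounded_linear.has_derivative[OF bounded_linear_Jt])
  then show ?thesis
    unfolding boost_def by (rule has_derivative_eq_rhs) (simp add: fun_eq_iff algebra_simps)
qed

lemma smooth_on_boost:
  assumes "open W" "smooth_on W z" "smooth_on W w"
  shows "smooth_on W (\<lambda>p. boost (z p) (w p))"
  unfolding boost_def
  by (intro smooth_on_diff smooth_on_scaleR smooth_on_cosh smooth_on_sinh
      smooth_on_bounded_linear[OF bounded_linear_Jt] assms)

section \<open>First and second derivatives of the hyperbolic form\<close>

context
  fixes g :: "'n::finite base \<Rightarrow> 'n ambient" and V :: "'n base set" and K :: "real set"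
  assumes V: "open V" and K: "open K" and g: "smooth_on V g"
begin

lemma smooth_on_hyperbolic_form: "smooth_on (V \<times> K) (hyperbolic_form g)"
proof -
  have op: "open (V \<times> K)" by (rule open_Times[OF V K])
  have "smooth_on (V \<times> K) (\<lambda>p. g (fst p))"
    by (rule smooth_on_compose[OF op V _ g smooth_on_bounded_linear[OF bounded_linear_fst op smooth_on_ident]]) auto
  then have "smooth_on (V \<times> K) (\<lambda>p. boost (snd p) (Jt (g (fst p))))"
    by (intro smooth_on_boost op smooth_on_bounded_linear[OF bounded_linear_Jt]
        smooth_on_bounded_linear[OF bounded_linear_snd op smooth_on_ident])
  moreover have "(\<lambda>p. boost (snd p) (Jt (g (fst p)))) = hyperbolic_form g"
    by (simp add: fun_eq_iff hyperbolic_form_boost)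
  ultimately show ?thesis by simp
qed

lemma fd_hyperbolic_form:
  assumes "x \<in> V" "z \<in> K"
  shows "fd (hyperbolic_form g) (x, z) (u, s) = boost z (Jt (fd g x u)) - s *\<^sub>R boost z (g x)"
proof -
  have "((\<lambda>p. Jt (g (fst p))) has_derivative (\<lambda>v. Jt (fd g x (fst v)))) (at (x, z))"
    by (intro bounded_linear.has_derivative[OF bounded_linear_Jt]
        has_derivative_compose[OF bounded_linear_imp_has_derivative[OF bounded_linear_fst], where g = g])
       (simp add: smooth_on_has_derivative[OF g assms(1)])
  from has_derivative_boost[OF this bounded_linear_imp_has_derivative[OF bounded_linear_snd]]
  have "(hyperbolic_form g has_derivative
      (\<lambda>v. boost z (Jt (fd g x (fst v))) - snd v *\<^sub>R Jt (boost z (Jt (g x))))) (at (x, z))"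
    by (simp add: hyperbolic_form_boost[symmetric])
  from fd_eqI[OF this] show ?thesis by (simp add: Jt_boost)
qed

text \<open>The last summand is \<open>s * s'\<close> times the hyperbolic form itself: two
  \<open>z\<close>-derivatives apply - J twice. It is the source of the summand - dz^2 of the
  metric.\<close>

lemma D2_hyperbolic_form:
  assumes "x \<in> V" "z \<in> K"
  shows "D2 (hyperbolic_form g) (x, z) (u, s) (u', s') =
    boost z (Jt (D2 g x u u')) - s *\<^sub>R boost z (fd g x u') - s' *\<^sub>R boost z (fd g x u)
    + (s * s') *\<^sub>R boost z (Jt (g x))"
proof -
  have op: "open (V \<times> K)" by (rule open_Times[OF V K])
  have p: "(x, z) \<in> V \<times> K" using assms by simp
  have 1: "((\<lambda>p. Jt (fd g (fst p) u')) has_derivative (\<lambda>v. Jt (D2 g x (fst v) u'))) (at (x, z))"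
    by (intro bounded_linear.has_derivative[OF bounded_linear_Jt]
        has_derivative_compose[OF bounded_linear_imp_has_derivative[OF bounded_linear_fst], where g = "\<lambda>x. fd g x u'"])
       (simp add: fd_has_derivative_D2[OF g assms(1)])
  have 2: "((\<lambda>p. g (fst p)) has_derivative (\<lambda>v. fd g x (fst v))) (at (x, z))"
    by (intro has_derivative_compose[OF bounded_linear_imp_has_derivative[OF bounded_linear_fst], where g = g])
       (simp add: smooth_on_has_derivative[OF g assms(1)])
  have "((\<lambda>p. boost (snd p) (Jt (fd g (fst p) u')) - s' *\<^sub>R boost (snd p) (g (fst p))) has_derivative
     (\<lambda>v. (boost z (Jt (D2 g x (fst v) u')) - snd v *\<^sub>R Jt (boost z (Jt (fd g x u')))) -
        s' *\<^sub>R (boost z (fd g x (fst v)) - snd v *\<^sub>R Jt (boost z (g x))))) (at (x, z))"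
    using has_derivative_diff[OF has_derivative_boost[OF 1 bounded_linear_imp_has_derivative[OF bounded_linear_snd]]
        has_derivative_scaleR_right[OF has_derivative_boost[OF 2 bounded_linear_imp_has_derivative[OF bounded_linear_snd]]]]
    by simp
  moreover have "D2 (hyperbolic_form g) (x, z) (u, s) (u', s')
      = fd (\<lambda>p. boost (snd p) (Jt (fd g (fst p) u')) - s' *\<^sub>R boost (snd p) (g (fst p))) (x, z) (u, s)"
    unfolding D2_def
    by (rule fun_cong[OF fd_cong[OF op p]]) (auto simp: fd_hyperbolic_form)
  ultimately show ?thesis
    by (simp add: fd_eqI Jt_boost algebra_simps)
qed

end

section \<open>Determinant of the boost and eigenspaces of J\<close>

fun xy_sign :: "('n + 'n) option option \<Rightarrow> real" where
  "xy_sign (Some (Some (Inl i))) = 1"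
| "xy_sign (Some (Some (Inr i))) = - 1"
| "xy_sign (Some None) = 1"
| "xy_sign None = - 1"

lemma xy_sign_swap: "xy_sign (swap_xy k) = - xy_sign k"
  by (cases k rule: swap_xy.cases) simp_all

lemma xy_sign_square: "xy_sign k * xy_sign k = 1"
  by (cases k rule: swap_xy.cases) simp_all

text \<open>A linear involution that anticommutes with J and therefore interchanges the two
  eigenspaces of J.\<close>

definition reflect_y :: "'n::finite ambient \<Rightarrow> 'n ambient" where
  "reflect_y v = (\<chi> k. xy_sign k * v $ k)"

lemma linear_reflect_y: "linear reflect_y"
  by (rule linearI) (simp_all add: reflect_y_def vec_eq_iff algebra_simps)

lemma reflect_y_reflect_y [simp]: "reflect_y (reflect_y v) = v"
  by (simp add: reflect_y_def vec_eq_iff mult.assoc[symmetric] xy_sign_square)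

lemma reflect_y_Jt: "reflect_y (Jt v) = - Jt (reflect_y v)"
  by (simp add: reflect_y_def Jt_def vec_eq_iff xy_sign_swap)

lemma det_matrix_compose:
  fixes f g :: "real^'k \<Rightarrow> real^'k"
  shows "linear f \<Longrightarrow> linear g \<Longrightarrow> det (matrix (\<lambda>v. f (g v))) = det (matrix f) * det (matrix g)"
  using matrix_compose[of g f] by (simp add: o_def det_mul)

lemma det_matrix_ident: "det (matrix (\<lambda>v::real^'k. v)) = 1"
  unfolding id_def[symmetric] by (rule matrix_id)

text \<open>Reflecting the \<open>y\<close>-coordinates conjugates \<open>boost z\<close> into \<open>boost (- z)\<close>, its inverse.\<close>

lemma det_boost_Jt: "(det (matrix (\<lambda>w :: 'n::finite ambient. boost z (Jt w))))\<^sup>2 = 1"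
proof -
  have J: "det (matrix (Jt :: 'n ambient \<Rightarrow> 'n ambient)) * det (matrix (Jt :: 'n ambient \<Rightarrow> 'n ambient)) = 1"
    using det_matrix_compose[OF linear_Jt linear_Jt] by (simp add: det_matrix_ident)
  have P: "det (matrix (reflect_y :: 'n ambient \<Rightarrow> 'n ambient)) * det (matrix (reflect_y :: 'n ambient \<Rightarrow> 'n ambient)) = 1"
    using det_matrix_compose[OF linear_reflect_y linear_reflect_y] by (simp add: det_matrix_ident)
  have lin: "linear (\<lambda>w. boost z (reflect_y w))" for z
    using linear_compose[OF linear_reflect_y linear_boost] by (simp add: o_def)
  have "reflect_y (boost z (reflect_y w)) = boost (- z) w" for w :: "'n ambient"
    unfolding boost_def linear_diff[OF linear_reflect_y] linear_cmul[OF linear_reflect_y] reflect_y_Jt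
    by simp
  then have 1: "(\<lambda>w :: 'n ambient. reflect_y (boost z (reflect_y w))) = boost (- z)" by (rule ext)
  have "det (matrix (\<lambda>w :: 'n ambient. reflect_y (boost z (reflect_y w))))
      = det (matrix (reflect_y :: 'n ambient \<Rightarrow> 'n ambient)) *
       (det (matrix (boost z :: 'n ambient \<Rightarrow> 'n ambient)) * det (matrix (reflect_y :: 'n ambient \<Rightarrow> 'n ambient)))"
    by (simp only: det_matrix_compose[OF linear_reflect_y lin] det_matrix_compose[OF linear_boost linear_reflect_y])
  then have "det (matrix (boost (- z) :: 'n ambient \<Rightarrow> 'n ambient)) = det (matrix (boost z :: 'n ambient \<Rightarrow> 'n ambient))"
    unfolding 1 using P by (metis mult.assoc mult.commute mult_1)
  moreover have "det (matrix (boost (- z) :: 'n ambient \<Rightarrow> 'n ambient)) * det (matrix (boost z :: 'n ambient \<Rightarrow> 'n ambient)) = 1"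
    by (subst det_matrix_compose[OF linear_boost linear_boost, symmetric]) (simp add: boost_boost det_matrix_ident)
  moreover have "det (matrix (\<lambda>w :: 'n ambient. boost z (Jt w)))
      = det (matrix (boost z :: 'n ambient \<Rightarrow> 'n ambient)) * det (matrix (Jt :: 'n ambient \<Rightarrow> 'n ambient))"
    by (rule det_matrix_compose[OF linear_boost linear_Jt])
  ultimately show ?thesis
    using J by (simp add: power_mult_distrib flip: power2_eq_square)
qed

text \<open>The ambient eigenspaces have dimension n + 1 each, being interchanged by
  \<open>reflect_y\<close>. The vectors \<open>w + Jt w\<close> and \<open>w - Jt w\<close> lie one
  in each of them and outside \<open>T\<close>, so \<open>T\<close> meets each in dimension at most
  n; the two dimensions add up to 2n.\<close>

lemma dim_Jt_eigenspaces:
  fixes T :: "'n::finite ambient set"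
  assumes T: "subspace T" "dim T = 2 * CARD('n)" and J: "Jt ` T \<subseteq> T"
    and w: "w + Jt w \<notin> T" "w - Jt w \<notin> T"
  shows "dim {v \<in> T. Jt v = v} = CARD('n)" "dim {v \<in> T. Jt v = - v} = CARD('n)"
proof -
  have split: "dim {v \<in> S. Jt v = v} + dim {v \<in> S. Jt v = - v} = dim S"
    if S: "subspace S" "Jt ` S \<subseteq> S" for S :: "'n ambient set"
  proof -
    let ?P = "{v \<in> S. Jt v = v}" and ?M = "{v \<in> S. Jt v = - v}"
    have sP: "subspace ?P" and sM: "subspace ?M"
      using S(1) by (auto simp: subspace_def)
    have "?P \<inter> ?M \<subseteq> {0}"
    proof
      fix v assume "v \<in> ?P \<inter> ?M"
      then have "v = - v" by auto
      then show "v \<in> {0}" by (simp add: vec_eq_iff)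
    qed
    then have 0: "dim (?P \<inter> ?M) = 0"
      using dim_le_card[of "?P \<inter> ?M" "{}"] by simp
    have "{x + y |x y. x \<in> ?P \<and> y \<in> ?M} = S"
    proof
      show "{x + y |x y. x \<in> ?P \<and> y \<in> ?M} \<subseteq> S" using S(1) by (auto intro: subspace_add)
      show "S \<subseteq> {x + y |x y. x \<in> ?P \<and> y \<in> ?M}"
      proof
        fix v assume v: "v \<in> S"
        have "Jt v \<in> S" using S(2) v by blast
        then have "(1/2) *\<^sub>R (v + Jt v) \<in> ?P" "(1/2) *\<^sub>R (v - Jt v) \<in> ?M"
          using v S(1) by (auto intro!: subspace_scale subspace_add subspace_diff simp: algebra_simps)
        moreover have "v = (1/2) *\<^sub>R (v + Jt v) + (1/2) *\<^sub>R (v - Jt v)"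
          by (simp add: vec_eq_iff field_simps)
        ultimately show "v \<in> {x + y |x y. x \<in> ?P \<and> y \<in> ?M}" by blast
      qed
    qed
    then show ?thesis using dim_sums_Int[OF sP sM] unfolding 0 by simp
  qed
  let ?P = "{v :: 'n ambient. Jt v = v}" and ?M = "{v :: 'n ambient. Jt v = - v}"
  have inj: "inj (reflect_y :: 'n ambient \<Rightarrow> 'n ambient)"
    by (metis injI reflect_y_reflect_y)
  have R: "Jt (reflect_y v) = - reflect_y (Jt v)" for v :: "'n ambient" by (simp add: reflect_y_Jt)
  have sub: "reflect_y ` ?P \<subseteq> ?M" "reflect_y ` ?M \<subseteq> ?P"
    by (auto simp: R linear_neg[OF linear_reflect_y])
  have "dim (reflect_y ` S) = dim S" for S :: "'n ambient set"
    by (rule dim_image_eq[OF linear_reflect_y inj_on_subset[OF inj subset_UNIV]])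
  then have "dim ?P \<le> dim ?M" "dim ?M \<le> dim ?P"
    using dim_subset[OF sub(1)] dim_subset[OF sub(2)] by simp_all
  moreover have "dim ?P + dim ?M = 2 * CARD('n) + 2"
    using split[of UNIV] by (simp add: dim_UNIV)
  ultimately have PM: "dim ?P = CARD('n) + 1" "dim ?M = CARD('n) + 1" by auto
  have sP: "subspace ?P" and sM: "subspace ?M" by (auto simp: subspace_def)
  have lt: "dim {v \<in> T. v \<in> S} < dim S" if S: "subspace S" and v: "v \<in> S" "v \<notin> T" for S v
  proof (rule dim_psubset)
    have "subspace {v \<in> T. v \<in> S}" using T(1) S by (auto simp: subspace_def)
    then show "span {v \<in> T. v \<in> S} \<subset> span S"
      using S v by (auto simp: span_eq_iff[THEN iffD2])
  qed
  have "dim {v \<in> T. Jt v = v} < CARD('n) + 1"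
    using lt[OF sP _ w(1)] PM(1) by (simp add: add.commute)
  moreover have "dim {v \<in> T. Jt v = - v} < CARD('n) + 1"
    using lt[OF sM _ w(2)] PM(2) by simp
  moreover have "dim {v \<in> T. Jt v = v} + dim {v \<in> T. Jt v = - v} = 2 * CARD('n)"
    using split[OF T(1) J] T(2) by simp
  ultimately show "dim {v \<in> T. Jt v = v} = CARD('n)" "dim {v \<in> T. Jt v = - v} = CARD('n)" by auto
qed

text \<open>The affine normal \<open>- \<alpha> *\<^sub>R g\<close> is built in, so the centre is
  the origin. The independence clause says at once that \<open>g\<close> is an immersion, that
  \<open>g\<close> and \<open>Jt g\<close> are independent, and that their span is transversal. The
  last clause is \<bar>H\<bar> = 1 rescaled from unimodular frames to the coordinate frame.\<close>

definition pc_data ::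
  "'n::finite base set \<Rightarrow> ('n base \<Rightarrow> 'n ambient) \<Rightarrow> real \<Rightarrow>
   ('n base \<Rightarrow> 'n base \<Rightarrow> 'n base \<Rightarrow> real) \<Rightarrow> ('n base \<Rightarrow> 'n base \<Rightarrow> 'n base \<Rightarrow> real) \<Rightarrow> bool" where
  "pc_data V g \<alpha> h1 h2 \<longleftrightarrow>
     open V \<and> smooth_on V g \<and> \<alpha> \<noteq> 0 \<and>
     (\<forall>x\<in>V. \<forall>u. Jt (fd g x u) \<in> tangent_image g x) \<and>
     (\<forall>x\<in>V. \<forall>u a b. fd g x u = a *\<^sub>R g x + b *\<^sub>R Jt (g x) \<longrightarrow> u = 0 \<and> a = 0 \<and> b = 0) \<and>
     (\<forall>x\<in>V. \<forall>u w. D2 g x u w + (\<alpha> * h1 x u w) *\<^sub>R g x + (\<alpha> * h2 x u w) *\<^sub>R Jt (g x) \<in> tangent_image g x) \<and>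
     nondegenerate_on V h1 \<and>
     (\<forall>x\<in>V. \<bar>gram_det (h1 x) (\<lambda>i. axis i 1)\<bar> =
        (pc_volume g (\<lambda>x. - \<alpha> *\<^sub>R g x) x (\<lambda>i. axis i 1))\<^sup>2)"

section \<open>Frames along a para-complex hypersurface, and \<open>pc_data\<close> versus
  \<open>pc_hypersphere_with\<close>\<close>

lemma axis_sum: "(\<Sum>i\<in>UNIV. (v $ i) *\<^sub>R axis i (1::real)) = v" for v :: "real^'k::finite"
  using bij_Basis_sum[OF bij_betw_base_frame, of v] by (simp add: inner_axis)

lemma pc_frame_nonsingular:
  fixes L :: "'n::finite base \<Rightarrow> 'n ambient"
  assumes L: "linear L" and ind: "\<And>u a b. L u = a *\<^sub>R v + b *\<^sub>R w \<Longrightarrow> u = 0 \<and> a = 0 \<and> b = 0"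
  shows "det (\<chi> k. case k of None \<Rightarrow> w | Some None \<Rightarrow> v | Some (Some i) \<Rightarrow> L (axis i 1)) \<noteq> 0"
proof -
  let ?M = "\<chi> k. case k of None \<Rightarrow> w | Some None \<Rightarrow> v | Some (Some i) \<Rightarrow> L (axis i 1)"
  have "det (transpose ?M) \<noteq> 0"
  proof (rule det_nonzeroI)
    fix y assume "transpose ?M *v y = 0"
    then have "y $ None *\<^sub>R w + (y $ Some None *\<^sub>R v + L (\<chi> i. y $ Some (Some i))) = 0"
      unfolding transpose_rows_mult sum_UNIV_option
      using axis_sum[of "\<chi> i. y $ Some (Some i)"]
      by (simp add: linear_sum[OF L, symmetric] linear_cmul[OF L, symmetric])
    moreover have "c = a + (b + c) - b - a" for a b c :: "'n ambient" by simp
    ultimately have "L (\<chi> i. y $ Some (Some i)) = 0 - y $ Some None *\<^sub>R v - y $ None *\<^sub>R w"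
      by metis
    then have "L (\<chi> i. y $ Some (Some i)) = (- y $ Some None) *\<^sub>R v + (- y $ None) *\<^sub>R w"
      by simp
    from ind[OF this] have 0: "y $ Some None = 0" "y $ None = 0" "\<And>i. y $ Some (Some i) = 0"
      by (auto simp: vec_eq_iff)
    show "y = 0"
    proof (rule iffD2[OF vec_eq_iff], rule allI)
      show "y $ k = 0 $ k" for k
        by (cases k; cases "the k") (auto simp: 0)
    qed
  qed
  then show ?thesis by simp
qed

lemma pc_frame_decompose:
  fixes L :: "'n::finite base \<Rightarrow> 'n ambient"
  assumes L: "linear L" and ind: "\<And>u a b. L u = a *\<^sub>R v + b *\<^sub>R w \<Longrightarrow> u = 0 \<and> a = 0 \<and> b = 0"
  obtains u a b where "y = L u + a *\<^sub>R v + b *\<^sub>R w"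
proof -
  let ?M = "\<chi> k. case k of None \<Rightarrow> w | Some None \<Rightarrow> v | Some (Some i) \<Rightarrow> L (axis i 1)"
  have "det (transpose ?M) \<noteq> 0"
    unfolding det_transpose by (rule pc_frame_nonsingular[OF L]) (rule ind)
  then obtain c where "transpose ?M *v c = y" using cramer by blast
  then have "y = L (\<chi> i. c $ Some (Some i)) + (c $ Some None) *\<^sub>R v + (c $ None) *\<^sub>R w"
    unfolding transpose_rows_mult sum_UNIV_option
    using axis_sum[of "\<chi> i. c $ Some (Some i)"]
    by (simp add: linear_sum[OF L, symmetric] linear_cmul[OF L, symmetric] algebra_simps)
  then show thesis by (rule that)
qed

text \<open>The codimension-two counterpart of the conormal: a covector that sees only the component
  along \<open>v\<close>.\<close>

lemma pc_frame_covector: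
  fixes L :: "'n::finite base \<Rightarrow> 'n ambient"
  assumes L: "linear L" and ind: "\<And>u a b. L u = a *\<^sub>R v + b *\<^sub>R w \<Longrightarrow> u = 0 \<and> a = 0 \<and> b = 0"
  obtains \<mu> where "\<mu> \<bullet> v = 1" "\<mu> \<bullet> w = 0" "\<And>u. \<mu> \<bullet> L u = 0"
proof -
  define R where "R k = (case k of None \<Rightarrow> w | Some None \<Rightarrow> v | Some (Some i) \<Rightarrow> L (axis i 1))" for k
  have "det (\<chi> k. R k) \<noteq> 0"
    unfolding R_def by (rule pc_frame_nonsingular[OF L]) (rule ind)
  then obtain \<mu> where "(\<chi> k. R k) *v \<mu> = axis (Some None) 1" using cramer by blast
  then have \<mu>: "R k \<bullet> \<mu> = (if k = Some None then 1 else 0)" for k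
    unfolding rows_mult by (simp add: vec_eq_iff axis_def)
  have "\<mu> \<bullet> L u = 0" for u
  proof -
    have "\<mu> \<bullet> L u = (\<Sum>i\<in>UNIV. u $ i * (\<mu> \<bullet> L (axis i 1)))"
      using arg_cong[OF axis_sum[of u], of L]
      by (simp add: linear_sum[OF L] linear_cmul[OF L] inner_sum_right[symmetric] flip: inner_scaleR_right)
    also have "\<dots> = 0" using \<mu>[of "Some (Some _)"] by (simp add: R_def inner_commute)
    finally show ?thesis .
  qed
  moreover have "\<mu> \<bullet> v = 1" "\<mu> \<bullet> w = 0"
    using \<mu>[of None] \<mu>[of "Some None"] by (simp_all add: R_def inner_commute)
  ultimately show thesis by (rule that[rotated 2])
qed

lemma pc_volume_change:
  fixes g \<zeta> :: "'n::finite base \<Rightarrow> 'n ambient"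
  assumes L: "linear (fd g x)"
  shows "pc_volume g \<zeta> x X = det ((\<chi> i j. X i $ j) :: real^('n + 'n)^('n + 'n)) * pc_volume g \<zeta> x (\<lambda>i. axis i 1)"
proof -
  let ?A = "(\<chi> i j. X i $ j) :: real^('n + 'n)^('n + 'n)"
  let ?M = "\<chi> k. case k of None \<Rightarrow> Jt (\<zeta> x) | Some None \<Rightarrow> \<zeta> x | Some (Some i) \<Rightarrow> fd g x (axis i 1)"
  let ?N = "\<chi> k. case k of None \<Rightarrow> Jt (\<zeta> x) | Some None \<Rightarrow> \<zeta> x | Some (Some i) \<Rightarrow> fd g x (X i)"
  have *: "(\<Sum>j\<in>UNIV. (X i $ j) *\<^sub>R fd g x (axis j 1)) = fd g x (X i)" for i
    using bij_Basis_linear[OF bij_betw_base_frame L, of "X i"] by (simp add: inner_axis)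
  have "?N $ k = (blk 1 (blk 1 ?A) ** ?M) $ k" for k
    unfolding matrix_mult_rows sum_UNIV_option
    by (cases k; cases "the k") (auto simp: blk_def *)
  then have "?N = blk 1 (blk 1 ?A) ** ?M"
    by (rule iffD2[OF vec_eq_iff, rule_format])
  then show ?thesis by (simp add: pc_volume_def det_mul det_blk)
qed

text \<open>\<open>h1\<close> is given only through membership in the tangent space. Pairing with a
  covector that kills the tangent space and \<open>Jt (g x)\<close> shows that it is a multiple of
  the paired second derivative.\<close>

lemma pc_h1_bilinear:
  fixes g :: "'n::finite base \<Rightarrow> 'n ambient"
  assumes V: "open V" and g: "smooth_on V g" and x: "x \<in> V" and \<alpha>: "\<alpha> \<noteq> 0"
    and ind: "\<And>u a b. fd g x u = a *\<^sub>R g x + b *\<^sub>R Jt (g x) \<Longrightarrow> u = 0 \<and> a = 0 \<and> b = 0"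
    and D2g: "\<And>u w. D2 g x u w + (\<alpha> * h1 x u w) *\<^sub>R g x + (\<alpha> * h2 x u w) *\<^sub>R Jt (g x) \<in> tangent_image g x"
  shows "linear (\<lambda>u. h1 x u w)" "linear (h1 x u)"
proof -
  obtain \<mu> where \<mu>: "\<mu> \<bullet> g x = 1" "\<mu> \<bullet> Jt (g x) = 0" "\<And>u. \<mu> \<bullet> fd g x u = 0"
    by (rule pc_frame_covector[OF smooth_on_linear_fd[OF g x] ind]) (auto intro: that)
  have h1: "h1 x u w = - (\<mu> \<bullet> D2 g x u w) / \<alpha>" for u w
  proof -
    obtain n where "D2 g x u w + (\<alpha> * h1 x u w) *\<^sub>R g x + (\<alpha> * h2 x u w) *\<^sub>R Jt (g x) = fd g x n"
      using D2g by blast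
    from arg_cong[OF this, of "\<lambda>v. \<mu> \<bullet> v"] have "\<mu> \<bullet> D2 g x u w + \<alpha> * h1 x u w = 0"
      by (simp add: inner_add_right \<mu>)
    then show ?thesis using \<alpha> by (simp add: field_simps)
  qed
  note l = linear_D2_left[OF g x, of w] linear_D2_right[OF V g x, of u]
  show "linear (\<lambda>u. h1 x u w)" "linear (h1 x u)"
    by (rule linearI; simp add: h1 linear_add[OF l(1)] linear_cmul[OF l(1)] linear_add[OF l(2)]
        linear_cmul[OF l(2)] inner_add_right diff_divide_distrib)+
qed

lemma pc_data_imp_pc_hypersphere_with:
  fixes g :: "'n::finite base \<Rightarrow> 'n ambient"
  assumes pc: "pc_data V g \<alpha> h1 h2"
  shows "pc_hypersphere_with V g (\<lambda>x. - \<alpha> *\<^sub>R g x) \<alpha>"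
proof -
  have V: "open V" and g: "smooth_on V g" and \<alpha>: "\<alpha> \<noteq> 0"
    and JT: "\<And>x u. x \<in> V \<Longrightarrow> Jt (fd g x u) \<in> tangent_image g x"
    and ind: "\<And>x u a b. x \<in> V \<Longrightarrow> fd g x u = a *\<^sub>R g x + b *\<^sub>R Jt (g x) \<Longrightarrow> u = 0 \<and> a = 0 \<and> b = 0"
    and D2g: "\<And>x u w. x \<in> V \<Longrightarrow> D2 g x u w + (\<alpha> * h1 x u w) *\<^sub>R g x + (\<alpha> * h2 x u w) *\<^sub>R Jt (g x) \<in> tangent_image g x"
    and nd: "nondegenerate_on V h1"
    and vol: "\<And>x. x \<in> V \<Longrightarrow> \<bar>gram_det (h1 x) (\<lambda>i. axis i 1)\<bar> =
        (pc_volume g (\<lambda>x. - \<alpha> *\<^sub>R g x) x (\<lambda>i. axis i 1))\<^sup>2"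
    using pc unfolding pc_data_def by blast+
  have lin: "linear (fd g x)" if "x \<in> V" for x by (rule smooth_on_linear_fd[OF g that])
  have inj: "inj (fd g x)" if "x \<in> V" for x
    using ind[OF that, of _ 0 0] by (simp add: linear_injective_0[OF lin[OF that]])
  have spanE: "v \<in> span {- \<alpha> *\<^sub>R g x, Jt (- \<alpha> *\<^sub>R g x)} \<longleftrightarrow> (\<exists>a b. v = a *\<^sub>R g x + b *\<^sub>R Jt (g x))" for v x
  proof
    assume "v \<in> span {- \<alpha> *\<^sub>R g x, Jt (- \<alpha> *\<^sub>R g x)}"
    then obtain k l where "v - k *\<^sub>R (- \<alpha> *\<^sub>R g x) - l *\<^sub>R Jt (- \<alpha> *\<^sub>R g x) \<in> span {}"
      unfolding span_insert by blast
    then have "v - k *\<^sub>R (- \<alpha> *\<^sub>R g x) = l *\<^sub>R Jt (- \<alpha> *\<^sub>R g x)"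
      unfolding span_empty by (simp only: singleton_iff right_minus_eq)
    then have "v = l *\<^sub>R Jt (- \<alpha> *\<^sub>R g x) + k *\<^sub>R (- \<alpha> *\<^sub>R g x)" by (simp only: diff_eq_eq)
    then have "v = (- k * \<alpha>) *\<^sub>R g x + (- l * \<alpha>) *\<^sub>R Jt (g x)" by (simp add: algebra_simps)
    then show "\<exists>a b. v = a *\<^sub>R g x + b *\<^sub>R Jt (g x)" by blast
  next
    assume "\<exists>a b. v = a *\<^sub>R g x + b *\<^sub>R Jt (g x)"
    then obtain a b where "v = (- a / \<alpha>) *\<^sub>R (- \<alpha> *\<^sub>R g x) + (- b / \<alpha>) *\<^sub>R Jt (- \<alpha> *\<^sub>R g x)"
      using \<alpha> by auto
    then show "v \<in> span {- \<alpha> *\<^sub>R g x, Jt (- \<alpha> *\<^sub>R g x)}"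
      by (rule ssubst[where P = "\<lambda>v. v \<in> _"])
         (rule span_add[OF span_scale[OF span_base] span_scale[OF span_base]]; blast)
  qed
  have ph: "para_holomorphic_hypersurface V g"
    unfolding para_holomorphic_hypersurface_def immersion_on_def
  proof (intro conjI ballI V g inj)
    fix x assume x: "x \<in> V"
    let ?T = "tangent_image g x"
    have T: "subspace ?T" using linear_subspace_image[OF lin[OF x] subspace_UNIV] .
    have dT: "dim ?T = 2 * CARD('n)"
      using dim_image_eq[OF lin[OF x], of UNIV] inj[OF x] by (simp add: dim_UNIV)
    show J: "Jt ` ?T \<subseteq> ?T" using JT[OF x] by blast
    \<comment> \<open>The values c = 1 and c = - 1 provide the two non-tangent eigenvectors of J
      that \<open>dim_Jt_eigenspaces\<close> asks for, with \<open>w = g x\<close>.\<close>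
    have "c = 0" if c: "g x + c *\<^sub>R Jt (g x) \<in> ?T" for c
    proof -
      obtain u where "fd g x u = 1 *\<^sub>R g x + c *\<^sub>R Jt (g x)" using c by auto
      then show ?thesis using ind[OF x] by blast
    qed
    from this[of 1] this[of "- 1"] have "g x + Jt (g x) \<notin> ?T" "g x - Jt (g x) \<notin> ?T" by auto
    from dim_Jt_eigenspaces[OF T dT J this]
    show "dim {v \<in> ?T. Jt v = v} = CARD('n)" "dim {v \<in> ?T. Jt v = - v} = CARD('n)" by auto
  qed
  have pt: "pc_transversal_on V g (\<lambda>x. - \<alpha> *\<^sub>R g x)"
    unfolding pc_transversal_on_def
  proof (intro conjI ballI)
    show "smooth_on V (\<lambda>x. - \<alpha> *\<^sub>R g x)" by (intro smooth_on_scaleR V smooth_on_const g)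
    fix x assume x: "x \<in> V"
    show "tangent_image g x \<inter> span {- \<alpha> *\<^sub>R g x, Jt (- \<alpha> *\<^sub>R g x)} = {0}"
    proof
      show "tangent_image g x \<inter> span {- \<alpha> *\<^sub>R g x, Jt (- \<alpha> *\<^sub>R g x)} \<subseteq> {0}"
      proof
        fix v assume "v \<in> tangent_image g x \<inter> span {- \<alpha> *\<^sub>R g x, Jt (- \<alpha> *\<^sub>R g x)}"
        then obtain u a b where "v = fd g x u" "v = a *\<^sub>R g x + b *\<^sub>R Jt (g x)" using spanE by blast
        then show "v \<in> {0}" using ind[OF x, of u a b] by simp
      qed
      show "{0} \<subseteq> tangent_image g x \<inter> span {- \<alpha> *\<^sub>R g x, Jt (- \<alpha> *\<^sub>R g x)}"
        using linear_0[OF lin[OF x]] span_zero by (metis IntI empty_subsetI insert_subset rangeI)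
    qed
    show "{v + w |v w. v \<in> tangent_image g x \<and> w \<in> span {- \<alpha> *\<^sub>R g x, Jt (- \<alpha> *\<^sub>R g x)}} = UNIV"
    proof (intro set_eqI iffI UNIV_I)
      fix y
      obtain u a b where "y = fd g x u + a *\<^sub>R g x + b *\<^sub>R Jt (g x)"
        by (rule pc_frame_decompose[OF lin[OF x] ind[OF x]])
      then have "y = fd g x u + (a *\<^sub>R g x + b *\<^sub>R Jt (g x))" by (simp add: add.assoc)
      then show "y \<in> {v + w |v w. v \<in> tangent_image g x \<and> w \<in> span {- \<alpha> *\<^sub>R g x, Jt (- \<alpha> *\<^sub>R g x)}}"
        using spanE by blast
    qed
  qed
  have ex: "\<exists>u. fd (\<lambda>y. fd g y (Y y)) x (X x) = fd g x u + h1 x (X x) (Y x) *\<^sub>R (- \<alpha> *\<^sub>R g x)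
      + h2 x (X x) (Y x) *\<^sub>R Jt (- \<alpha> *\<^sub>R g x)"
    if Y: "smooth_on V Y" and x: "x \<in> V" for X Y x
  proof -
    obtain n where n: "D2 g x (X x) (Y x) + (\<alpha> * h1 x (X x) (Y x)) *\<^sub>R g x + (\<alpha> * h2 x (X x) (Y x)) *\<^sub>R Jt (g x) = fd g x n"
      using D2g[OF x] by blast
    have "fd (\<lambda>y. fd g y (Y y)) x (X x) = D2 g x (X x) (Y x) + fd g x (fd Y x (X x))"
      by (subst fd_eqI[OF has_derivative_fd_apply[OF V g V x _ has_derivative_ident smooth_on_has_derivative[OF Y x]]]) auto
    also have "\<dots> = fd g x (n + fd Y x (X x)) + h1 x (X x) (Y x) *\<^sub>R (- \<alpha> *\<^sub>R g x)
      + h2 x (X x) (Y x) *\<^sub>R Jt (- \<alpha> *\<^sub>R g x)"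
      unfolding linear_add[OF lin[OF x]] n[symmetric] by (simp add: algebra_simps)
    finally show ?thesis by blast
  qed
  define nabla where "nabla X Y x = (SOME u. fd (\<lambda>y. fd g y (Y y)) x (X x) = fd g x u
      + h1 x (X x) (Y x) *\<^sub>R (- \<alpha> *\<^sub>R g x) + h2 x (X x) (Y x) *\<^sub>R Jt (- \<alpha> *\<^sub>R g x))"
    for X Y :: "'n base \<Rightarrow> 'n base" and x
  have nabla: "fd (\<lambda>y. fd g y (Y y)) x (X x) = fd g x (nabla X Y x)
      + h1 x (X x) (Y x) *\<^sub>R (- \<alpha> *\<^sub>R g x) + h2 x (X x) (Y x) *\<^sub>R Jt (- \<alpha> *\<^sub>R g x)"
    if "smooth_on V Y" "x \<in> V" for X Y x
    unfolding nabla_def by (rule someI_ex[OF ex[OF that]])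
  have d\<zeta>: "fd (\<lambda>x. - \<alpha> *\<^sub>R g x) x v = - fd g x (\<alpha> *\<^sub>R v)" if "x \<in> V" for x v
    by (subst fd_eqI[OF has_derivative_scaleR_right[OF smooth_on_has_derivative[OF g that]]])
       (simp add: linear_cmul[OF lin[OF that]])
  show ?thesis
    unfolding pc_hypersphere_with_def
  proof (intro conjI ph pt \<alpha> exI)
    show "pc_induced_objects V g (\<lambda>x. - \<alpha> *\<^sub>R g x) nabla h1 h2 (\<lambda>x v. \<alpha> *\<^sub>R v) (\<lambda>_ _. 0) (\<lambda>_ _. 0)"
      unfolding pc_induced_objects_def flat_D_def[abs_def]
    proof (intro conjI allI impI ballI)
      show "fd (\<lambda>x. - \<alpha> *\<^sub>R g x) x (X x) = - fd g x (\<alpha> *\<^sub>R X x) + 0 *\<^sub>R (- \<alpha> *\<^sub>R g x) + 0 *\<^sub>R Jt (- \<alpha> *\<^sub>R g x)"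
        if "x \<in> V" for X x using d\<zeta>[OF that] by simp
    qed (use nabla in blast)
    show "\<forall>x\<in>V. \<forall>X. pc_volume g (\<lambda>x. - \<alpha> *\<^sub>R g x) x X = 1 \<longrightarrow>
       \<bar>gram_det (h1 x) X\<bar> = 1"
    proof (intro ballI allI impI)
      fix x and X :: "'n + 'n \<Rightarrow> 'n base"
      assume x: "x \<in> V" and 1: "pc_volume g (\<lambda>x. - \<alpha> *\<^sub>R g x) x X = 1"
      let ?A = "(\<chi> i j. X i $ j) :: real^('n + 'n)^('n + 'n)"
      \<comment> \<open>The Gram determinant and the squared volume acquire the same factor, so a
        frame of volume 1 has Gram determinant of absolute value 1.\<close>
      have "gram_det (h1 x) X
        = (det ?A)\<^sup>2 * gram_det (h1 x) (\<lambda>i. axis i 1)"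
        using det_bilinear_change[OF bij_betw_base_frame pc_h1_bilinear[where ?h1.0 = h1 and ?h2.0 = h2, OF V g x \<alpha> ind[OF x] D2g[OF x]], of X]
        by (simp add: inner_axis)
      then have "\<bar>gram_det (h1 x) X\<bar>
         = (det ?A * pc_volume g (\<lambda>x. - \<alpha> *\<^sub>R g x) x (\<lambda>i. axis i 1))\<^sup>2"
        using vol[OF x] by (simp add: abs_mult power_mult_distrib)
      then show "\<bar>gram_det (h1 x) X\<bar> = 1"
        using 1 pc_volume_change[OF lin[OF x], of "\<lambda>x. - \<alpha> *\<^sub>R g x" X] by simp
    qed
  qed (use nd in auto)
qed

lemma sphere_dataI_frame:
  fixes f C :: "'e::euclidean_space \<Rightarrow> (real, 'i::finite option) vec" and e :: "'i \<Rightarrow> 'e"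
  assumes e: "bij_betw e UNIV Basis" and W: "open W"
    and f: "immersion_on W f" and C: "transversal_on W f C"
    and dC: "\<And>x v. x \<in> W \<Longrightarrow> fd C x v = - lam *\<^sub>R fd f x v"
    and D2: "\<And>x v w. x \<in> W \<Longrightarrow> D2 f x v w - h x v w *\<^sub>R C x \<in> tangent_image f x"
    and nd: "nondegenerate_on W h"
    and vol: "\<And>x. x \<in> W \<Longrightarrow> \<bar>gram_det (h x) e\<bar> = (induced_volume f C x e)\<^sup>2"
  shows "sphere_data W f C lam h"
  unfolding sphere_data_def
proof (intro conjI ballI allI f C nd dC D2)
  fix x and X :: "'i \<Rightarrow> 'e" assume x: "x \<in> W"
  have sf: "smooth_on W f" using f by (simp add: immersion_on_def)
  obtain \<nu> where \<nu>: "\<nu> \<bullet> C x = 1" "\<And>v. \<nu> \<bullet> fd f x v = 0"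
    using conormal_exists[OF e W f C] x by metis
  have h: "h x v w = \<nu> \<bullet> D2 f x v w" for v w
  proof -
    obtain u where "D2 f x v w - h x v w *\<^sub>R C x = fd f x u" using D2[OF x] by blast
    from arg_cong[OF this, of "\<lambda>y. \<nu> \<bullet> y"] show ?thesis by (simp add: inner_diff_right \<nu>)
  qed
  note l = linear_D2_left[OF sf x] linear_D2_right[OF W sf x]
  have hl: "linear (\<lambda>v. h x v w)" and hr: "linear (h x v)" for v w
    by (rule linearI; simp add: h linear_add[OF l(1)] linear_cmul[OF l(1)] linear_add[OF l(2)]
        linear_cmul[OF l(2)] inner_add_right)+
  show "\<bar>gram_det (h x) X\<bar> = (induced_volume f C x X)\<^sup>2"
    unfolding det_bilinear_change[OF e hl hr, of X] induced_volume_change[OF e smooth_on_linear_fd[OF sf x], of C X]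
    using vol[OF x] by (simp add: abs_mult power_mult_distrib)
qed

text \<open>\<open>pc_transversal_on\<close> speaks of the span only. A complement of
  \<open>T\<close> has dimension 2 in the ambient space of dimension 2n + 2, and a dependent pair
  would span less.\<close>

lemma independent_pair_if_complement:
  fixes T :: "'n::finite ambient set"
  assumes T: "subspace T" "dim T = 2 * CARD('n)" and int: "T \<inter> span {v, w} = {0}"
    and sum: "{a + b |a b. a \<in> T \<and> b \<in> span {v, w}} = UNIV"
    and 0: "a *\<^sub>R v + b *\<^sub>R w = 0"
  shows "a = 0 \<and> b = 0"
proof -
  have "2 * CARD('n) + 2 = 2 * CARD('n) + dim (span {v, w})"
    using dim_sums_Int[OF T(1) subspace_span, of "{v, w}"] unfolding sum int by (simp add: T(2) dim_UNIV)
  then have d: "dim {v, w} = 2" by simp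
  have no: "\<not> {v, w} \<subseteq> span {y}" for y
    using dim_le_card[of "{v, w}" "{y}"] d by auto
  have "a = 0"
  proof (rule ccontr)
    assume a: "a \<noteq> 0"
    have "a *\<^sub>R v = - b *\<^sub>R w" using 0 by (simp add: eq_neg_iff_add_eq_0)
    then have "v = (- b / a) *\<^sub>R w" using a by (metis divide_inverse_commute scaleR_scaleR left_inverse scaleR_one)
    then have "{v, w} \<subseteq> span {w}" using span_scale[OF span_base[of w "{w}"], of "- b / a"] span_base[of w "{w}"] by simp
    then show False using no by blast
  qed
  moreover have "b = 0"
  proof (rule ccontr)
    assume b: "b \<noteq> 0"
    then have "w = 0" using 0 \<open>a = 0\<close> by simp
    then have "{v, w} \<subseteq> span {v}" using span_base[of v "{v}"] span_zero by simp
    then show False using no by blast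
  qed
  ultimately show ?thesis by simp
qed

text \<open>Apart from \<zeta>, only derivatives of \<open>g0\<close> enter the conditions.
  Translating the centre to the origin leaves these unchanged and turns \<zeta> into - \<alpha>
  g.\<close>

lemma pc_hypersphere_with_imp_pc_data:
  fixes g0 \<zeta> :: "'n::finite base \<Rightarrow> 'n ambient"
  assumes pc: "pc_hypersphere_with V g0 \<zeta> \<alpha>" and c: "\<And>x. x \<in> V \<Longrightarrow> \<zeta> x = - \<alpha> *\<^sub>R (g0 x - c)"
  obtains h1 h2 where "pc_data V (\<lambda>x. g0 x - c) \<alpha> h1 h2"
proof -
  define g where "g x = g0 x - c" for x
  from pc obtain nabla h1 h2 S \<tau>1 \<tau>2 where ph: "para_holomorphic_hypersurface V g0"
    and pt: "pc_transversal_on V g0 \<zeta>" and \<alpha>: "\<alpha> \<noteq> 0"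
    and ind0: "pc_induced_objects V g0 \<zeta> nabla h1 h2 S \<tau>1 \<tau>2" and nd: "nondegenerate_on V h1"
    and vol: "\<forall>x\<in>V. \<forall>X. pc_volume g0 \<zeta> x X = 1 \<longrightarrow>
        \<bar>gram_det (h1 x) X\<bar> = 1"
    unfolding pc_hypersphere_with_def by (elim conjE exE) (rule that; assumption)
  have V: "open V" and g0: "smooth_on V g0" and inj: "\<And>x. x \<in> V \<Longrightarrow> inj (fd g0 x)"
    and J0: "\<And>x. x \<in> V \<Longrightarrow> Jt ` tangent_image g0 x \<subseteq> tangent_image g0 x"
    using ph unfolding para_holomorphic_hypersurface_def immersion_on_def by blast+
  have g: "smooth_on V g"
    unfolding g_def[abs_def] by (intro smooth_on_diff V g0 smooth_on_const)
  have fdg: "fd g x = fd g0 x" if "x \<in> V" for x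
    unfolding g_def[abs_def]
    by (rule fd_eqI) (rule has_derivative_eq_rhs[OF has_derivative_diff[OF
          smooth_on_has_derivative[OF g0 that] has_derivative_const]], simp)
  have \<zeta>: "\<zeta> x = - \<alpha> *\<^sub>R g x" if "x \<in> V" for x using c[OF that] by (simp add: g_def)
  have lin: "linear (fd g x)" if "x \<in> V" for x by (rule smooth_on_linear_fd[OF g that])
  have D2g0: "D2 g x u w = D2 g0 x u w" if "x \<in> V" for x u w
    unfolding D2_def using fd_cong[OF V that, of "\<lambda>y. fd g y w" "\<lambda>y. fd g0 y w"] fdg by auto
  have D2g: "D2 g x u w + (\<alpha> * h1 x u w) *\<^sub>R g x + (\<alpha> * h2 x u w) *\<^sub>R Jt (g x) \<in> tangent_image g x"
    if x: "x \<in> V" for x u w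
  proof -
    have "smooth_on V (\<lambda>_. u) \<and> smooth_on V (\<lambda>_. w)" by (simp add: smooth_on_const)
    then have "flat_D (\<lambda>_. u) (pushf g0 (\<lambda>_. w)) x
       = pushf g0 (nabla (\<lambda>_. u) (\<lambda>_. w)) x + h1 x u w *\<^sub>R \<zeta> x + h2 x u w *\<^sub>R Jt (\<zeta> x)"
      using ind0 x unfolding pc_induced_objects_def by blast
    then have "D2 g0 x u w = fd g0 x (nabla (\<lambda>_. u) (\<lambda>_. w) x) + h1 x u w *\<^sub>R \<zeta> x + h2 x u w *\<^sub>R Jt (\<zeta> x)"
      by (simp add: flat_D_def[abs_def] D2_def)
    then have "D2 g x u w + (\<alpha> * h1 x u w) *\<^sub>R g x + (\<alpha> * h2 x u w) *\<^sub>R Jt (g x) = fd g x (nabla (\<lambda>_. u) (\<lambda>_. w) x)"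
      by (simp add: D2g0[OF x] \<zeta>[OF x] fdg[OF x] mult.commute)
    then show ?thesis by simp
  qed
  have ind: "u = 0 \<and> a = 0 \<and> b = 0" if x: "x \<in> V" and e: "fd g x u = a *\<^sub>R g x + b *\<^sub>R Jt (g x)" for x u a b
  proof -
    let ?T = "tangent_image g x"
    have pt': "?T \<inter> span {\<zeta> x, Jt (\<zeta> x)} = {0}" "{v + w |v w. v \<in> ?T \<and> w \<in> span {\<zeta> x, Jt (\<zeta> x)}} = UNIV"
      using pt x unfolding pc_transversal_on_def fdg[OF x] by blast+
    have eq: "a *\<^sub>R g x + b *\<^sub>R Jt (g x) = (- a / \<alpha>) *\<^sub>R \<zeta> x + (- b / \<alpha>) *\<^sub>R Jt (\<zeta> x)"
      using \<alpha> by (simp add: \<zeta>[OF x])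
    have "(- a / \<alpha>) *\<^sub>R \<zeta> x + (- b / \<alpha>) *\<^sub>R Jt (\<zeta> x) \<in> span {\<zeta> x, Jt (\<zeta> x)}"
      by (rule span_add[OF span_scale[OF span_base] span_scale[OF span_base]]; blast)
    then have "fd g x u \<in> ?T \<inter> span {\<zeta> x, Jt (\<zeta> x)}" unfolding e eq using e eq by (metis IntI rangeI)
    then have 0: "fd g x u = 0" using pt'(1) by blast
    then have "u = 0" using inj[OF x] linear_injective_0[OF lin[OF x]] fdg[OF x] by metis
    moreover have "- a / \<alpha> = 0 \<and> - b / \<alpha> = 0"
    proof (rule independent_pair_if_complement[OF _ _ pt'])
      show "subspace ?T" using linear_subspace_image[OF lin[OF x] subspace_UNIV] .
      show "dim ?T = 2 * CARD('n)"
        using dim_image_eq[OF lin[OF x], of UNIV] inj[OF x] fdg[OF x] by (simp add: dim_UNIV)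
      show "(- a / \<alpha>) *\<^sub>R \<zeta> x + (- b / \<alpha>) *\<^sub>R Jt (\<zeta> x) = 0" using 0 e eq by simp
    qed
    ultimately show ?thesis using \<alpha> by simp
  qed
  have vol': "\<bar>gram_det (h1 x) (\<lambda>i. axis i 1)\<bar> =
        (pc_volume g (\<lambda>x. - \<alpha> *\<^sub>R g x) x (\<lambda>i. axis i 1))\<^sup>2" if x: "x \<in> V" for x
  proof -
    have pcv: "pc_volume g (\<lambda>x. - \<alpha> *\<^sub>R g x) x X = pc_volume g0 \<zeta> x X" for X
      unfolding pc_volume_def by (simp add: \<zeta>[OF x] fdg[OF x] cong: option.case_cong)
    define v where "v = pc_volume g (\<lambda>x. - \<alpha> *\<^sub>R g x) x (\<lambda>i. axis i 1)"
    have v0: "v \<noteq> 0"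
      unfolding v_def pc_volume_def
    proof (rule pc_frame_nonsingular[OF lin[OF x]])
      fix u a b assume "fd g x u = a *\<^sub>R - \<alpha> *\<^sub>R g x + b *\<^sub>R Jt (- \<alpha> *\<^sub>R g x)"
      then have "fd g x u = (- a * \<alpha>) *\<^sub>R g x + (- b * \<alpha>) *\<^sub>R Jt (g x)" by simp
      from ind[OF x this] show "u = 0 \<and> a = 0 \<and> b = 0" using \<alpha> by simp
    qed
    \<comment> \<open>The definition constrains \<open>h1\<close> on unimodular frames only.
      Dividing one arbitrarily chosen coordinate vector by the volume \<open>v\<close> produces such
      a frame; scaling back gives the Gram determinant of the coordinate frame.\<close>
    obtain i0 :: "'n + 'n" where True by blast
    define d where "d i = (if i = i0 then 1 / v else 1)" for i
    define X where "X i = d i *\<^sub>R axis i (1::real)" for i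
    let ?A = "(\<chi> i j. X i $ j) :: real^('n + 'n)^('n + 'n)"
    have "det ?A = (\<Prod>i\<in>UNIV. d i)"
      by (subst det_diagonal) (auto simp: X_def axis_def)
    also have "\<dots> = 1 / v" by (simp add: d_def)
    finally have dA: "det ?A = 1 / v" .
    have X1: "pc_volume g0 \<zeta> x X = 1"
      using pc_volume_change[of g x "\<lambda>x. - \<alpha> *\<^sub>R g x" X] lin[OF x] dA v0 pcv by (simp add: v_def)
    have "gram_det (h1 x) X
        = (det ?A)\<^sup>2 * gram_det (h1 x) (\<lambda>i. axis i 1)"
      using det_bilinear_change[OF bij_betw_base_frame
          pc_h1_bilinear[where ?h1.0 = h1 and ?h2.0 = h2, OF V g x \<alpha> ind[OF x] D2g[OF x]], of X]
      by (simp add: inner_axis)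
    then have hX: "gram_det (h1 x) X
        = (1 / v)\<^sup>2 * gram_det (h1 x) (\<lambda>i. axis i 1)"
      unfolding dA .
    have "\<bar>gram_det (h1 x) X\<bar> = 1"
      using vol x X1 by blast
    then have "(1 / v)\<^sup>2 * \<bar>gram_det (h1 x) (\<lambda>i. axis i 1)\<bar> = 1"
      unfolding hX abs_mult abs_power2 .
    then have "\<bar>gram_det (h1 x) (\<lambda>i. axis i 1)\<bar> = v\<^sup>2"
      using v0 by (simp add: power_divide divide_eq_eq)
    then show ?thesis unfolding v_def .
  qed
  have "pc_data V g \<alpha> h1 h2"
    unfolding pc_data_def
  proof (intro conjI V g \<alpha> nd)
    show "\<forall>x\<in>V. \<forall>u. Jt (fd g x u) \<in> tangent_image g x"
    proof (intro ballI allI)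
      fix x u assume x: "x \<in> V"
      have "fd g0 x u \<in> tangent_image g0 x" by simp
      then show "Jt (fd g x u) \<in> tangent_image g x" using J0[OF x] unfolding fdg[OF x] by blast
    qed
    show "\<forall>x\<in>V. \<forall>u a b. fd g x u = a *\<^sub>R g x + b *\<^sub>R Jt (g x) \<longrightarrow> u = 0 \<and> a = 0 \<and> b = 0"
      by (intro ballI allI impI) (rule ind)
  qed (intro ballI allI D2g vol', assumption)+
  then show thesis unfolding g_def[abs_def] by (rule that)
qed

text \<open>With both forms \<tau> zero, \<zeta> + \<alpha> \<open>g0\<close> has zero derivative.
  Connectedness provides one constant, hence one centre, where separate components could have
  different ones.\<close>

lemma proper_pc_hypersphere_has_centre:
  fixes W :: "'n::finite base set"
  assumes pc: "proper_pc_hypersphere W g0" and W: "connected W"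
  shows "\<exists>c. pc_hypersphere_centre W g0 c"
proof -
  from pc obtain \<zeta> \<alpha> where pcw: "pc_hypersphere_with W g0 \<zeta> \<alpha>" unfolding proper_pc_hypersphere_def by blast
  then obtain nabla h1 h2 S \<tau>1 \<tau>2 where ph: "para_holomorphic_hypersurface W g0"
    and pt: "pc_transversal_on W g0 \<zeta>" and \<alpha>: "\<alpha> \<noteq> 0"
    and ind0: "pc_induced_objects W g0 \<zeta> nabla h1 h2 S \<tau>1 \<tau>2"
    and \<tau>S: "\<forall>x\<in>W. \<forall>v. \<tau>1 x v = 0" "\<forall>x\<in>W. \<forall>v. S x v = \<alpha> *\<^sub>R v" "\<forall>x\<in>W. \<forall>v. \<tau>2 x v = 0"
    unfolding pc_hypersphere_with_def by (elim conjE exE) (rule that; assumption)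
  have op: "open W" and g0: "smooth_on W g0" and s\<zeta>: "smooth_on W \<zeta>"
    using ph pt unfolding para_holomorphic_hypersurface_def immersion_on_def pc_transversal_on_def by blast+
  have "((\<lambda>x. \<zeta> x + \<alpha> *\<^sub>R g0 x) has_derivative (\<lambda>v. 0)) (at x)" if x: "x \<in> W" for x
  proof -
    have "fd \<zeta> x v = - (\<alpha> *\<^sub>R fd g0 x v)" for v
    proof -
      have "smooth_on W (\<lambda>_. v)" by (rule smooth_on_const)
      then have "flat_D (\<lambda>_. v) \<zeta> x = - pushf g0 (\<lambda>y. S y v) x + \<tau>1 x v *\<^sub>R \<zeta> x + \<tau>2 x v *\<^sub>R Jt (\<zeta> x)"
        using ind0 x unfolding pc_induced_objects_def by blast
      then show ?thesis
        by (simp add: flat_D_def \<tau>S x linear_cmul[OF smooth_on_linear_fd[OF g0 x]])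
    qed
    then show ?thesis
      by (intro has_derivative_eq_rhs[OF has_derivative_add[OF smooth_on_has_derivative[OF s\<zeta> x]
            has_derivative_scaleR_right[OF smooth_on_has_derivative[OF g0 x]]]]) (simp add: fun_eq_iff)
  qed
  then have const: "\<zeta> x + \<alpha> *\<^sub>R g0 x = \<zeta> y + \<alpha> *\<^sub>R g0 y" if "x \<in> W" "y \<in> W" for x y
    by (rule has_derivative_zero_unique_connected[OF op W _ that])
  have "\<exists>k. \<forall>x\<in>W. \<zeta> x + \<alpha> *\<^sub>R g0 x = k"
    using const by (cases "W = {}") blast+
  then obtain k where k: "\<And>x. x \<in> W \<Longrightarrow> \<zeta> x + \<alpha> *\<^sub>R g0 x = k" by blast
  have "\<zeta> x = - \<alpha> *\<^sub>R (g0 x - (1 / \<alpha>) *\<^sub>R k)" if "x \<in> W" for x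
    using k[OF that] \<alpha> by (simp add: algebra_simps eq_diff_eq)
  then show ?thesis unfolding pc_hypersphere_centre_def using pcw by blast
qed

text \<open>Up to scalars and an exchange of the two transversal rows, the frame of the hyperbolic
  form is the image of the frame of \<open>g\<close> under exp(- z J) J, whose determinant squares
  to 1. Squaring removes the sign of the exchange.\<close>

lemma hyperbolic_volume:
  fixes g :: "'n::finite base \<Rightarrow> 'n ambient"
  assumes V: "open V" and K: "open K" and g: "smooth_on V g" and x: "x \<in> V" and z: "z \<in> K" and \<alpha>: "\<alpha> \<noteq> 0"
  shows "(induced_volume (hyperbolic_form g) (\<lambda>p. - lam *\<^sub>R hyperbolic_form g p) (x, z) model_frame)\<^sup>2 =
    (lam / \<alpha>\<^sup>2)\<^sup>2 * (pc_volume g (\<lambda>x. - \<alpha> *\<^sub>R g x) x (\<lambda>i. axis i 1))\<^sup>2"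
proof -
  define Q where "Q k = (case k of None \<Rightarrow> Jt (- \<alpha> *\<^sub>R g x) | Some None \<Rightarrow> - \<alpha> *\<^sub>R g x
    | Some (Some i) \<Rightarrow> fd g x (axis i 1))" for k
  define B where "B w = boost z (Jt w)" for w :: "'n ambient"
  \<comment> \<open>Row \<open>None\<close> is - \<open>lam\<close> F, which is
    \<open>lam / \<alpha>\<close> times the image of - \<alpha> g; row \<open>Some None\<close> is
    the \<open>z\<close>-derivative, \<open>1 / \<alpha>\<close> times the image of - \<alpha> J g.
    The product is \<open>lam / \<alpha>\<^sup>2\<close>.\<close>
  define c where "c k = (case k of None \<Rightarrow> lam / \<alpha> | Some None \<Rightarrow> 1 / \<alpha> | Some (Some i) \<Rightarrow> 1)"
    for k :: "('n + 'n) option option"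
  define \<tau> where "\<tau> = Transposition.transpose None (Some (None :: ('n + 'n) option))"
  have \<tau>: "\<tau> permutes UNIV" unfolding \<tau>_def by (simp add: permutes_swap_id)
  have linB: "linear B" unfolding B_def[abs_def] using linear_compose[OF linear_Jt linear_boost] by (simp add: o_def)
  have row: "(case k of None \<Rightarrow> - lam *\<^sub>R hyperbolic_form g (x, z)
      | Some i \<Rightarrow> fd (hyperbolic_form g) (x, z) (model_frame i)) = c k *s B (Q (\<tau> k))" for k
  proof -
    have lin: "linear (fd g x)" by (rule smooth_on_linear_fd[OF g x])
    have sc: "r *s w = r *\<^sub>R w" for r and w :: "'n ambient" by (simp add: vec_eq_iff)
    show ?thesis
      unfolding sc using \<alpha> linear_0[OF lin]
      by (cases k; cases "the k")
         (auto simp: c_def B_def Q_def \<tau>_def Transposition.transpose_def hyperbolic_form_boost model_frame_def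
            fd_hyperbolic_form[OF V K g x z])
  qed
  have pcQ: "pc_volume g (\<lambda>x. - \<alpha> *\<^sub>R g x) x (\<lambda>i. axis i 1) = det (\<chi> k. Q k)"
    by (simp only: pc_volume_def Q_def)
  have "((\<chi> k. Q k) ** transpose (matrix B)) $ k = matrix B *v Q k" for k
    by (simp add: vec_eq_iff matrix_matrix_mult_def matrix_vector_mult_def transpose_def mult.commute)
  moreover have "matrix B *v w = B w" for w
    using matrix_vector_mul(2)[OF linB] by metis
  ultimately have BQ: "(\<chi> k. B (Q k)) = (\<chi> k. Q k) ** transpose (matrix B)"
    by (intro iffD2[OF vec_eq_iff] allI) simp
  have "induced_volume (hyperbolic_form g) (\<lambda>p. - lam *\<^sub>R hyperbolic_form g p) (x, z) model_frame
      = prod c UNIV * det (\<chi> k. B (Q (\<tau> k)))"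
    unfolding induced_volume_def row by (rule det_rows_mul)
  also have "det (\<chi> k. B (Q (\<tau> k))) = of_int (sign \<tau>) * det (\<chi> k. B (Q k))"
    using det_permute_rows[OF \<tau>, of "\<chi> k. B (Q k)"] by simp
  also have "det (\<chi> k. B (Q k)) = pc_volume g (\<lambda>x. - \<alpha> *\<^sub>R g x) x (\<lambda>i. axis i 1) * det (matrix B)"
    unfolding BQ det_mul pcQ det_transpose ..
  also have "prod c UNIV = lam / \<alpha>\<^sup>2"
    by (simp add: prod_UNIV_option c_def power2_eq_square)
  finally show ?thesis
    using det_boost_Jt[of z, where 'n = 'n]
    by (simp add: power_mult_distrib power_divide B_def[abs_def] sign_def)
qed

text \<open>There are no cross terms between the \<open>z\<close>-direction and the others, so the
  Gram matrix splits; each of the 2n base rows contributes a factor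
  \<open>\<alpha> / lam\<close>.\<close>

lemma hyperbolic_metric_det:
  fixes h1 :: "'n::finite base \<Rightarrow> 'n base \<Rightarrow> real"
  assumes l: "\<And>w. linear (\<lambda>u. h1 u w)" and r: "\<And>u. linear (h1 u)"
    and h: "\<And>u s u' s'. h (u, s) (u', s') = (\<alpha> * h1 u u' - s * s') / lam"
  shows "gram_det h model_frame =
    (- 1 / lam) * (\<alpha> / lam) ^ (2 * CARD('n)) * gram_det h1 (\<lambda>i. axis i 1)"
proof -
  let ?H = "(\<chi> i. (\<alpha> / lam) *s (\<chi> j. h1 (axis i 1) (axis j 1))) :: real^('n + 'n)^('n + 'n)"
  have "(\<chi> i j. h (model_frame i) (model_frame j)) $ k $ m = blk (- 1 / lam) ?H $ k $ m" for k m
    using linear_0[OF l] linear_0[OF r]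
    by (cases k; cases m) (auto simp: blk_def model_frame_def h)
  then have "(\<chi> i j. h (model_frame i) (model_frame j)) = blk (- 1 / lam) ?H"
    by (simp add: vec_eq_iff)
  moreover have "det ?H = (\<alpha> / lam) ^ (2 * CARD('n)) * gram_det h1 (\<lambda>i. axis i 1)"
    by (simp add: det_rows_mul mult_2)
  ultimately show ?thesis by (simp add: det_blk)
qed

text \<open>The hypothesis on the powers is the equation
  \<open>(1 / l) * (a / l) ^ (2 * n) = (l / a\<^sup>2)\<^sup>2\<close> with denominators cleared: on
  the left the factor between the metric determinants, on the right the one between the squared
  volumes.\<close>

lemma blaschke_scaling:
  fixes a l H v :: real
  assumes "a > 0" "l > 0" "a ^ (2 * n + 4) = l ^ (2 * n + 3)"
  shows "(1 / l) * (a / l) ^ (2 * n) * H = (l / a\<^sup>2)\<^sup>2 * v \<longleftrightarrow> H = v"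
proof -
  have "(1 / l) * (a / l) ^ (2 * n) = (l / a\<^sup>2)\<^sup>2"
    using assms by (simp add: power_divide field_simps power_add power_mult eval_nat_numeral)
  moreover have "(l / a\<^sup>2)\<^sup>2 \<noteq> 0" using assms by simp
  ultimately show ?thesis by simp
qed

section \<open>Tangent spaces and normal parts of the hyperbolic form at a point\<close>

context
  fixes g :: "'n::finite base \<Rightarrow> 'n ambient" and V :: "'n base set" and K :: "real set" and x z
  assumes V: "open V" and K: "open K" and g: "smooth_on V g" and x: "x \<in> V" and z: "z \<in> K"
begin

lemma hyperbolic_tangent_subspace: "subspace (tangent_image (hyperbolic_form g) (x, z))"
  by (rule linear_subspace_image[OF smooth_on_linear_fd[OF smooth_on_hyperbolic_form[OF V K g]] subspace_UNIV])
     (use x z in simp)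

lemma hyperbolic_tangent_z: "boost z (g x) \<in> tangent_image (hyperbolic_form g) (x, z)"
proof -
  have "boost z (g x) = fd (hyperbolic_form g) (x, z) (0, - 1)"
    using linear_0[OF smooth_on_linear_fd[OF g x]] by (simp add: fd_hyperbolic_form[OF V K g x z])
  then show ?thesis by simp
qed

context
  assumes J: "\<And>u. Jt (fd g x u) \<in> tangent_image g x"
begin

lemma hyperbolic_tangent_x:
  assumes "w \<in> tangent_image g x"
  shows "boost z w \<in> tangent_image (hyperbolic_form g) (x, z)"
proof -
  obtain u where u: "w = fd g x u" using assms by blast
  obtain u' where "Jt (fd g x u) = fd g x u'" using J by blast
  then have "w = Jt (fd g x u')" using u by (metis Jt_Jt)
  then have "boost z w = fd (hyperbolic_form g) (x, z) (u', 0)"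
    by (simp add: fd_hyperbolic_form[OF V K g x z])
  then show ?thesis by simp
qed

text \<open>J carries the \<open>Jt (g x)\<close> component of \<open>D2 g\<close> to the direction
  of \<open>g x\<close>, which after the boost is the tangent \<open>z\<close>-direction; so
  \<open>b\<close> does not reach the normal part. The mixed derivatives are tangential, because the
  tangent space of \<open>g\<close> is invariant under J.\<close>

lemma hyperbolic_D2_normal_part:
  assumes "D2 g x u u' + a *\<^sub>R g x + b *\<^sub>R Jt (g x) \<in> tangent_image g x"
  shows "D2 (hyperbolic_form g) (x, z) (u, s) (u', s') - (s * s' - a) *\<^sub>R hyperbolic_form g (x, z)
    \<in> tangent_image (hyperbolic_form g) (x, z)"
proof -
  let ?T = "tangent_image (hyperbolic_form g) (x, z)"
  note sub = hyperbolic_tangent_subspace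
  have "Jt (D2 g x u u' + a *\<^sub>R g x + b *\<^sub>R Jt (g x)) \<in> tangent_image g x"
  proof -
    obtain n where n: "D2 g x u u' + a *\<^sub>R g x + b *\<^sub>R Jt (g x) = fd g x n" using assms by blast
    show ?thesis unfolding n by (rule J)
  qed
  from hyperbolic_tangent_x[OF this]
  have 1: "boost z (Jt (D2 g x u u')) + a *\<^sub>R boost z (Jt (g x)) + b *\<^sub>R boost z (g x) \<in> ?T" by simp
  have 2: "s *\<^sub>R boost z (fd g x u') \<in> ?T" "s' *\<^sub>R boost z (fd g x u) \<in> ?T"
    by (intro subspace_scale[OF sub] hyperbolic_tangent_x rangeI)+
  have 3: "b *\<^sub>R boost z (g x) \<in> ?T" by (intro subspace_scale[OF sub] hyperbolic_tangent_z)
  have "D2 (hyperbolic_form g) (x, z) (u, s) (u', s') - (s * s' - a) *\<^sub>R hyperbolic_form g (x, z)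
    = (boost z (Jt (D2 g x u u')) + a *\<^sub>R boost z (Jt (g x)) + b *\<^sub>R boost z (g x))
      - b *\<^sub>R boost z (g x) - s *\<^sub>R boost z (fd g x u') - s' *\<^sub>R boost z (fd g x u)"
    unfolding D2_hyperbolic_form[OF V K g x z] hyperbolic_form_boost by (simp add: algebra_simps)
  also have "\<dots> \<in> ?T" by (intro subspace_diff[OF sub] 1 2 3)
  finally show ?thesis .
qed

text \<open>Undoing the boost and J turns \<open>fd F (u, s) = a *\<^sub>R F\<close> into
  \<open>fd g x u = a *\<^sub>R g x + s *\<^sub>R Jt (g x)\<close>, to which independence applies.
  The third claim says that the invariant distribution is the kernel of dz: J maps the pushforward
  of \<open>(u, s)\<close> to a tangent vector minus s F.\<close>

lemma hyperbolic_transversal_immersion: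
  assumes ind: "\<And>u a b. fd g x u = a *\<^sub>R g x + b *\<^sub>R Jt (g x) \<Longrightarrow> u = 0 \<and> a = 0 \<and> b = 0"
  shows "hyperbolic_form g (x, z) \<notin> tangent_image (hyperbolic_form g) (x, z)"
    and "inj (fd (hyperbolic_form g) (x, z))"
    and "Jt (fd (hyperbolic_form g) (x, z) (u, s)) \<in> tangent_image (hyperbolic_form g) (x, z) \<longleftrightarrow> s = 0"
proof -
  let ?F = "hyperbolic_form g"
  have lin: "linear (fd ?F (x, z))"
    by (rule smooth_on_linear_fd[OF smooth_on_hyperbolic_form[OF V K g]]) (use x z in simp)
  have main: "a = 0 \<and> s = 0 \<and> u = 0" if e: "fd ?F (x, z) (u, s) = a *\<^sub>R ?F (x, z)" for u s a
  proof -
    have "boost z (Jt (fd g x u) - s *\<^sub>R g x) = boost z (a *\<^sub>R Jt (g x))"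
      using e by (simp add: fd_hyperbolic_form[OF V K g x z] hyperbolic_form_boost)
    then have "Jt (fd g x u) - s *\<^sub>R g x = a *\<^sub>R Jt (g x)" by (simp only: boost_eq_iff)
    then have "Jt (Jt (fd g x u) - s *\<^sub>R g x) = Jt (a *\<^sub>R Jt (g x))" by simp
    then have "fd g x u = a *\<^sub>R g x + s *\<^sub>R Jt (g x)" by (simp add: diff_eq_eq)
    from ind[OF this] show ?thesis by blast
  qed
  show F: "?F (x, z) \<notin> tangent_image ?F (x, z)"
  proof
    assume "?F (x, z) \<in> tangent_image ?F (x, z)"
    then obtain p where "?F (x, z) = fd ?F (x, z) p" by blast
    then have "fd ?F (x, z) (fst p, snd p) = 1 *\<^sub>R ?F (x, z)" by simp
    from main[OF this] show False by simp
  qed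
  show "inj (fd ?F (x, z))"
    unfolding linear_injective_0[OF lin]
  proof (intro allI impI)
    fix p assume "fd ?F (x, z) p = 0"
    then have "fd ?F (x, z) (fst p, snd p) = 0 *\<^sub>R ?F (x, z)" by simp
    from main[OF this] show "p = 0" by (simp add: prod_eq_iff)
  qed
  note sub = hyperbolic_tangent_subspace
  have e: "Jt (fd ?F (x, z) (u, s)) = boost z (fd g x u) - s *\<^sub>R ?F (x, z)"
    by (simp add: fd_hyperbolic_form[OF V K g x z] hyperbolic_form_boost Jt_boost)
  have b: "boost z (fd g x u) \<in> tangent_image ?F (x, z)" by (intro hyperbolic_tangent_x rangeI)
  show "Jt (fd ?F (x, z) (u, s)) \<in> tangent_image ?F (x, z) \<longleftrightarrow> s = 0"
  proof
    assume "Jt (fd ?F (x, z) (u, s)) \<in> tangent_image ?F (x, z)"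
    then have "(1 / s) *\<^sub>R (boost z (fd g x u) - Jt (fd ?F (x, z) (u, s))) \<in> tangent_image ?F (x, z)"
      by (intro subspace_scale[OF sub] subspace_diff[OF sub] b)
    then show "s = 0" using F by (cases "s = 0") (auto simp: e)
  qed (use b e in simp)
qed

end

end

section \<open>Para-complex hyperspheres and their hyperbolic forms\<close>

lemma hyperbolic_volume_iff:
  fixes g :: "'n::finite base \<Rightarrow> 'n ambient" and h1 :: "'n base \<Rightarrow> 'n base \<Rightarrow> real"
  assumes V: "open V" and K: "open K" and g: "smooth_on V g" and x: "x \<in> V" and z: "z \<in> K"
    and nz: "\<alpha> \<noteq> 0" "lam \<noteq> 0" and scale: "\<bar>\<alpha>\<bar> ^ (2 * CARD('n) + 4) = \<bar>lam\<bar> ^ (2 * CARD('n) + 3)"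
    and l: "\<And>w. linear (\<lambda>u. h1 u w)" and r: "\<And>u. linear (h1 u)"
    and h: "\<And>u s u' s'. h (u, s) (u', s') = (\<alpha> * h1 u u' - s * s') / lam"
  shows "\<bar>gram_det h model_frame\<bar> =
      (induced_volume (hyperbolic_form g) (\<lambda>p. - lam *\<^sub>R hyperbolic_form g p) (x, z) model_frame)\<^sup>2 \<longleftrightarrow>
    \<bar>gram_det h1 (\<lambda>i. axis i 1)\<bar> =
      (pc_volume g (\<lambda>x. - \<alpha> *\<^sub>R g x) x (\<lambda>i. axis i 1))\<^sup>2"
proof -
  have "(lam / \<alpha>\<^sup>2)\<^sup>2 = (\<bar>lam\<bar> / \<bar>\<alpha>\<bar>\<^sup>2)\<^sup>2" by (simp add: power_divide)
  then show ?thesis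
    unfolding hyperbolic_metric_det[OF l r h] hyperbolic_volume[OF V K g x z nz(1)]
    using blaschke_scaling[of "\<bar>\<alpha>\<bar>" "\<bar>lam\<bar>" "CARD('n)", OF _ _ scale] nz
    by (simp add: abs_mult power_abs)
qed

lemma pc_data_imp_sphere_data:
  fixes g :: "'n::finite base \<Rightarrow> 'n ambient"
  assumes pc: "pc_data V g \<alpha> h1 h2" and K: "open K" and lam: "lam \<noteq> 0"
    and scale: "\<bar>\<alpha>\<bar> ^ (2 * CARD('n) + 4) = \<bar>lam\<bar> ^ (2 * CARD('n) + 3)"
  shows "\<exists>h. sphere_data (V \<times> K) (hyperbolic_form g) (\<lambda>p. - lam *\<^sub>R hyperbolic_form g p) lam h"
proof -
  have V: "open V" and g: "smooth_on V g" and \<alpha>: "\<alpha> \<noteq> 0"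
    and J: "\<And>x u. x \<in> V \<Longrightarrow> Jt (fd g x u) \<in> tangent_image g x"
    and ind: "\<And>x u a b. x \<in> V \<Longrightarrow> fd g x u = a *\<^sub>R g x + b *\<^sub>R Jt (g x) \<Longrightarrow> u = 0 \<and> a = 0 \<and> b = 0"
    and D2g: "\<And>x u w. x \<in> V \<Longrightarrow> D2 g x u w + (\<alpha> * h1 x u w) *\<^sub>R g x + (\<alpha> * h2 x u w) *\<^sub>R Jt (g x) \<in> tangent_image g x"
    and nd: "nondegenerate_on V h1"
    and vol: "\<And>x. x \<in> V \<Longrightarrow> \<bar>gram_det (h1 x) (\<lambda>i. axis i 1)\<bar> =
        (pc_volume g (\<lambda>x. - \<alpha> *\<^sub>R g x) x (\<lambda>i. axis i 1))\<^sup>2"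
    using pc unfolding pc_data_def by blast+
  let ?F = "hyperbolic_form g" and ?W = "V \<times> K"
  let ?C = "\<lambda>p. - lam *\<^sub>R ?F p"
  have W: "open ?W" by (rule open_Times[OF V K])
  have F: "smooth_on ?W ?F" by (rule smooth_on_hyperbolic_form[OF V K g])
  \<comment> \<open>By \<open>hyperbolic_D2_normal_part\<close> the normal part of the second
    derivative is \<open>s * s' - \<alpha> * h1 x u u'\<close> times F; dividing by -
    \<open>lam\<close> expresses it through the field \<open>?C\<close>.\<close>
  define h where "h p v w = (\<alpha> * h1 (fst p) (fst v) (fst w) - snd v * snd w) / lam" for p v w :: "'n model"
  have bl: "linear (\<lambda>u. h1 x u w)" "linear (h1 x u)" if "x \<in> V" for x u w
    by (rule pc_h1_bilinear[where ?h1.0 = h1 and ?h2.0 = h2, OF V g that \<alpha> ind[OF that] D2g[OF that]]; assumption)+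
  have sub: "subspace (tangent_image ?F p)" and tr: "?F p \<notin> tangent_image ?F p" and inj: "inj (fd ?F p)"
    if "p \<in> ?W" for p
    using that hyperbolic_tangent_subspace[OF V K g, of "fst p" "snd p"]
      hyperbolic_transversal_immersion(1,2)[OF V K g, of "fst p" "snd p"] J ind by auto
  have "sphere_data ?W ?F ?C lam h"
  proof (rule sphere_dataI_frame[OF bij_betw_model_frame W])
    show "immersion_on ?W ?F" unfolding immersion_on_def using F inj by blast
    show "transversal_on ?W ?F ?C"
      unfolding transversal_on_def
    proof (intro conjI ballI notI)
      show "smooth_on ?W ?C" by (intro smooth_on_scaleR W F smooth_on_const)
      fix p assume p: "p \<in> ?W" and *: "- lam *\<^sub>R ?F p \<in> tangent_image ?F p"
      have "(- 1 / lam) *\<^sub>R (- lam *\<^sub>R ?F p) \<in> tangent_image ?F p"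
        by (rule subspace_scale[OF sub[OF p] *])
      then show False using tr[OF p] lam by simp
    qed
    show "fd ?C p v = - lam *\<^sub>R fd ?F p v" if "p \<in> ?W" for p v
      by (subst fd_eqI[OF has_derivative_scaleR_right[OF smooth_on_has_derivative[OF F that]]]) simp
    show "D2 ?F p v w - h p v w *\<^sub>R ?C p \<in> tangent_image ?F p" if "p \<in> ?W" for p v w
    proof -
      obtain x z u s u' s' where p: "p = (x, z)" and v: "v = (u, s)" and w: "w = (u', s')"
        by (cases p; cases v; cases w)
      then have xz: "x \<in> V" "z \<in> K" using that by auto
      have "h p v w * (- lam) = s * s' - \<alpha> * h1 x u u'"
        using lam by (simp add: h_def p v w)
      then have "h p v w *\<^sub>R ?C p = (s * s' - \<alpha> * h1 x u u') *\<^sub>R ?F (x, z)"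
        by (simp only: scaleR_scaleR p)
      then show ?thesis
        using hyperbolic_D2_normal_part[OF V K g xz J[OF xz(1)] D2g[OF xz(1), of u u'], of s s']
        by (simp only: p v w)
    qed
    show "nondegenerate_on ?W h"
      unfolding nondegenerate_on_def
    proof (intro ballI allI impI)
      fix p v assume p: "p \<in> ?W" and 0: "\<forall>w. h p v w = 0"
      have x: "fst p \<in> V" using p by auto
      have "h p v (0, 1) = 0" using 0 by blast
      then have s: "snd v = 0" using lam linear_0[OF bl(2)[OF x]] by (simp add: h_def)
      have "h1 (fst p) (fst v) u' = 0" for u'
      proof -
        have "h p v (u', 0) = 0" using 0 by blast
        then show ?thesis using lam \<alpha> by (simp add: h_def)
      qed
      then have "fst v = 0" using nd x unfolding nondegenerate_on_def by blast
      then show "v = 0" using s by (simp add: prod_eq_iff)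
    qed
    show "\<bar>gram_det (h p) model_frame\<bar>
        = (induced_volume ?F ?C p model_frame)\<^sup>2" if "p \<in> ?W" for p
    proof -
      obtain x z where p: "p = (x, z)" by (cases p)
      then have xz: "x \<in> V" "z \<in> K" using that by auto
      show ?thesis
        unfolding p
        by (rule iffD2[OF hyperbolic_volume_iff[OF V K g xz \<alpha> lam scale bl[OF xz(1)]] vol[OF xz(1)]])
           (simp add: h_def)
    qed
  qed
  then show ?thesis by blast
qed

text \<open>All data of \<open>g\<close> are read off one slice of constant \<open>z\<close>. The
  hypothesis \<open>JT\<close> places the base directions in the invariant distribution, which is
  what makes the tangent spaces of \<open>g\<close> invariant under J.\<close>

lemma hyperbolic_sphere_imp_pc_data:
  fixes g :: "'n::finite base \<Rightarrow> 'n ambient"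
  assumes V: "open V" and K: "open K" "z \<in> K" and g: "smooth_on V g"
    and sd: "sphere_data (V \<times> K) (hyperbolic_form g) (\<lambda>p. - lam *\<^sub>R hyperbolic_form g p) lam h"
    and nz: "lam \<noteq> 0" "\<alpha> \<noteq> 0" and scale: "\<bar>\<alpha>\<bar> ^ (2 * CARD('n) + 4) = \<bar>lam\<bar> ^ (2 * CARD('n) + 3)"
    and JT: "\<And>x z u. x \<in> V \<Longrightarrow> z \<in> K \<Longrightarrow>
      Jt (fd (hyperbolic_form g) (x, z) (u, 0)) \<in> tangent_image (hyperbolic_form g) (x, z)"
  shows "\<exists>h1 h2. pc_data V g \<alpha> h1 h2"
proof -
  let ?F = "hyperbolic_form g" and ?W = "V \<times> K"
  have C: "transversal_on ?W ?F (\<lambda>p. - lam *\<^sub>R ?F p)" and im: "immersion_on ?W ?F"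
    and D2F: "\<And>p v w. p \<in> ?W \<Longrightarrow> D2 ?F p v w - h p v w *\<^sub>R (- lam *\<^sub>R ?F p) \<in> tangent_image ?F p"
    and nd: "nondegenerate_on ?W h"
    and vol: "\<And>p X. p \<in> ?W \<Longrightarrow> \<bar>gram_det (h p) X\<bar> =
       (induced_volume ?F (\<lambda>p. - lam *\<^sub>R ?F p) p X)\<^sup>2"
    using sd unfolding sphere_data_def by blast+
  have p: "(x, z) \<in> ?W" if "x \<in> V" for x using that K by simp
  have sub: "subspace (tangent_image ?F (x, z))" if "x \<in> V" for x
    by (rule hyperbolic_tangent_subspace[OF V K(1) g that K(2)])
  have fdF: "fd ?F (x, z) (u, s) = boost z (Jt (fd g x u)) - s *\<^sub>R boost z (g x)" if "x \<in> V" for x u s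
    by (rule fd_hyperbolic_form[OF V K(1) g that K(2)])
  have tr: "a = 0" if x: "x \<in> V" and a: "a *\<^sub>R ?F (x, z) \<in> tangent_image ?F (x, z)" for x a
  proof (rule ccontr)
    assume "a \<noteq> 0"
    then have "(- lam / a) *\<^sub>R (a *\<^sub>R ?F (x, z)) = - lam *\<^sub>R ?F (x, z)" by simp
    then have "- lam *\<^sub>R ?F (x, z) \<in> tangent_image ?F (x, z)"
      using subspace_scale[OF sub[OF x] a, of "- lam / a"] by metis
    then show False using C p[OF x] unfolding transversal_on_def by blast
  qed
  have J: "Jt (fd g x u) \<in> tangent_image g x" if x: "x \<in> V" for x u
  proof -
    obtain u' s' where "Jt (fd ?F (x, z) (u, 0)) = fd ?F (x, z) (u', s')"
      using JT[OF x K(2), of u] by auto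
    then have "boost z (fd g x u) = boost z (Jt (fd g x u') - s' *\<^sub>R g x)"
      by (simp add: fdF[OF x] Jt_boost)
    then have e: "fd g x u = Jt (fd g x u') - s' *\<^sub>R g x" by (simp only: boost_eq_iff)
    then have e': "Jt (fd g x u) = fd g x u' - s' *\<^sub>R Jt (g x)" by simp
    \<comment> \<open>The difference of two tangent vectors is a multiple of the transversal vector
      F, so the coefficient \<open>s'\<close> must vanish.\<close>
    then have "s' *\<^sub>R ?F (x, z) = Jt (fd ?F (x, z) (u', 0)) - fd ?F (x, z) (u, 0)"
      by (simp add: fdF[OF x] Jt_boost hyperbolic_form_boost)
    also have "\<dots> \<in> tangent_image ?F (x, z)"
      by (intro subspace_diff[OF sub[OF x]] JT[OF x K(2)] rangeI)
    finally have "s' = 0" by (rule tr[OF x])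
    then show ?thesis using e' by simp
  qed
  have ind: "u = 0 \<and> a = 0 \<and> b = 0" if x: "x \<in> V" and e: "fd g x u = a *\<^sub>R g x + b *\<^sub>R Jt (g x)" for x u a b
  proof -
    have *: "fd ?F (x, z) (u, b) = a *\<^sub>R ?F (x, z)"
      by (simp add: fdF[OF x] e hyperbolic_form_boost)
    then have "a *\<^sub>R ?F (x, z) \<in> tangent_image ?F (x, z)" by (metis rangeI)
    then have a: "a = 0" by (rule tr[OF x])
    then have "fd ?F (x, z) (u, b) = fd ?F (x, z) (0, 0)"
      using * linear_0[OF smooth_on_linear_fd[OF g x]] by (simp add: fdF[OF x])
    then have "(u, b) = (0, 0)"
      using im p[OF x] unfolding immersion_on_def by (metis injD)
    then show ?thesis using a by simp
  qed
  \<comment> \<open>The normal components of \<open>D2 g\<close> in the frame \<open>g\<close>,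
    \<open>Jt g\<close>, divided by - \<alpha>, serve as \<open>h1\<close> and
    \<open>h2\<close>.\<close>
  have "\<exists>a b. D2 g x u w + (\<alpha> * a) *\<^sub>R g x + (\<alpha> * b) *\<^sub>R Jt (g x) \<in> tangent_image g x" if x: "x \<in> V" for x u w
  proof -
    obtain n a b where "D2 g x u w = fd g x n + a *\<^sub>R g x + b *\<^sub>R Jt (g x)"
      by (rule pc_frame_decompose[OF smooth_on_linear_fd[OF g x] ind[OF x]])
    then have "D2 g x u w + (\<alpha> * (- a / \<alpha>)) *\<^sub>R g x + (\<alpha> * (- b / \<alpha>)) *\<^sub>R Jt (g x) = fd g x n"
      using nz by simp
    then show ?thesis by (metis rangeI)
  qed
  then obtain h1 h2 where D2g: "\<And>x u w. x \<in> V \<Longrightarrow>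
      D2 g x u w + (\<alpha> * h1 x u w) *\<^sub>R g x + (\<alpha> * h2 x u w) *\<^sub>R Jt (g x) \<in> tangent_image g x"
    by metis
  have bl: "linear (\<lambda>u. h1 x u w)" "linear (h1 x u)" if "x \<in> V" for x u w
    by (rule pc_h1_bilinear[where ?h1.0 = h1 and ?h2.0 = h2, OF V g that nz(2) ind[OF that] D2g[OF that]]; assumption)+
  have h: "h (x, z) (u, s) (u', s') = (\<alpha> * h1 x u u' - s * s') / lam" if x: "x \<in> V" for x u s u' s'
  proof -
    \<comment> \<open>Two descriptions of the normal part of the same second derivative; their
      difference is a tangential multiple of F.\<close>
    have "(D2 ?F (x, z) (u, s) (u', s') - h (x, z) (u, s) (u', s') *\<^sub>R (- lam *\<^sub>R ?F (x, z)))
       - (D2 ?F (x, z) (u, s) (u', s') - (s * s' - \<alpha> * h1 x u u') *\<^sub>R ?F (x, z)) \<in> tangent_image ?F (x, z)"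
      by (intro subspace_diff[OF sub[OF x]] D2F p x
          hyperbolic_D2_normal_part[OF V K(1) g x K(2) J[OF x] D2g[OF x]])
    then have "(h (x, z) (u, s) (u', s') * lam + s * s' - \<alpha> * h1 x u u') *\<^sub>R ?F (x, z) \<in> tangent_image ?F (x, z)"
      by (simp add: algebra_simps)
    from tr[OF x this] show ?thesis using nz by (simp add: field_simps)
  qed
  have "pc_data V g \<alpha> h1 h2"
    unfolding pc_data_def
  proof (intro conjI V g nz(2))
    show "\<forall>x\<in>V. \<forall>u. Jt (fd g x u) \<in> tangent_image g x" using J by blast
    show "\<forall>x\<in>V. \<forall>u a b. fd g x u = a *\<^sub>R g x + b *\<^sub>R Jt (g x) \<longrightarrow> u = 0 \<and> a = 0 \<and> b = 0"
      by (intro ballI allI impI) (rule ind)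
    show "\<forall>x\<in>V. \<forall>u w. D2 g x u w + (\<alpha> * h1 x u w) *\<^sub>R g x + (\<alpha> * h2 x u w) *\<^sub>R Jt (g x) \<in> tangent_image g x"
      using D2g by blast
    show "nondegenerate_on V h1"
      unfolding nondegenerate_on_def
    proof (intro ballI allI impI)
      fix x u assume x: "x \<in> V" and 0: "\<forall>w. h1 x u w = 0"
      have "h (x, z) (u, 0) w = 0" for w
        by (cases w) (simp add: h[OF x] 0)
      then have "(u, 0 :: real) = 0" using nd p[OF x] unfolding nondegenerate_on_def by blast
      then show "u = 0" by (simp add: prod_eq_iff)
    qed
    show "\<forall>x\<in>V. \<bar>gram_det (h1 x) (\<lambda>i. axis i 1)\<bar> =
        (pc_volume g (\<lambda>x. - \<alpha> *\<^sub>R g x) x (\<lambda>i. axis i 1))\<^sup>2"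
    proof
      fix x assume x: "x \<in> V"
      show "\<bar>gram_det (h1 x) (\<lambda>i. axis i 1)\<bar> =
        (pc_volume g (\<lambda>x. - \<alpha> *\<^sub>R g x) x (\<lambda>i. axis i 1))\<^sup>2"
        by (rule iffD1[OF hyperbolic_volume_iff[OF V K(1) g x K(2) nz(2,1) scale bl[OF x] h[OF x]] vol[OF p[OF x]]])
    qed
  qed
  then show ?thesis by blast
qed

section \<open>Invariant distributions, and the converse direction\<close>

lemma invariant_distribution_iff:
  "v \<in> invariant_distribution f x \<longleftrightarrow> Jt (fd f x v) \<in> tangent_image f x"
proof -
  have "fd f x v \<in> Jt ` tangent_image f x \<longleftrightarrow> Jt (fd f x v) \<in> tangent_image f x"
  proof
    assume "fd f x v \<in> Jt ` tangent_image f x"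
    then obtain w where "w \<in> tangent_image f x" "fd f x v = Jt w" by blast
    then show "Jt (fd f x v) \<in> tangent_image f x" by simp
  next
    assume "Jt (fd f x v) \<in> tangent_image f x"
    then have "Jt (Jt (fd f x v)) \<in> Jt ` tangent_image f x" by (rule imageI)
    then show "fd f x v \<in> Jt ` tangent_image f x" by simp
  qed
  then show ?thesis by (simp add: invariant_distribution_def)
qed

lemma exists_power_eq_power:
  fixes c :: real
  assumes "c > 0" "p > 0"
  obtains a where "a > 0" "a ^ p = c ^ q"
proof
  show "root p (c ^ q) > 0" "root p (c ^ q) ^ p = c ^ q"
    using assms by (simp_all add: real_root_pow_pos2)
qed

lemma invariant_distribution_hyperbolic_form:
  assumes pc: "pc_data V g \<alpha> h1 h2" and K: "open K" and p: "p \<in> V \<times> K"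
  shows "v \<in> invariant_distribution (hyperbolic_form g) p \<longleftrightarrow> snd v = 0"
proof -
  obtain x z where xz: "p = (x, z)" "x \<in> V" "z \<in> K" using p by blast
  have "open V" "smooth_on V g" "\<And>u. Jt (fd g x u) \<in> tangent_image g x"
    "\<And>u a b. fd g x u = a *\<^sub>R g x + b *\<^sub>R Jt (g x) \<Longrightarrow> u = 0 \<and> a = 0 \<and> b = 0"
    using pc xz unfolding pc_data_def by blast+
  from hyperbolic_transversal_immersion(3)[OF this(1) K this(2) xz(2,3) this(3,4), of "fst v" "snd v"]
  show ?thesis by (simp add: invariant_distribution_iff xz(1))
qed

lemma Jt_tangent_hypersphere_hyperbolic_form:
  fixes W :: "'n::finite base set"
  assumes pc: "pc_data W g \<alpha> h1 h2" and W: "connected W" and I: "open I" "is_interval I"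
  shows "Jt_tangent_hypersphere (top_of_set (W \<times> I)) {(W \<times> I, id)} (hyperbolic_form g)"
    and "involutive_invariant_distribution {(W \<times> I, id)} (hyperbolic_form g)"
proof -
  let ?F = "hyperbolic_form g" and ?W = "W \<times> I"
  have op: "open W" and g: "smooth_on W g" and \<alpha>: "\<alpha> \<noteq> 0"
    using pc unfolding pc_data_def by blast+
  have opW: "open ?W" by (rule open_Times[OF op I(1)])
  have F: "smooth_on ?W ?F" by (rule smooth_on_hyperbolic_form[OF op I(1) g])
  \<comment> \<open>The representative of F in the chart \<open>id\<close> agrees with F on
    \<open>?W\<close> only, because \<open>inv_into\<close> is unspecified outside; hence the
    transfers by congruence on open sets.\<close>
  define F' where "F' = ?F \<circ> inv_into ?W id"
  have inv: "inv_into ?W id p = p" if "p \<in> ?W" for p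
    using inv_into_f_f[of id ?W p] that by simp
  have F': "F' p = ?F p" if "p \<in> ?W" for p using inv[OF that] by (simp add: F'_def)
  have fdF': "fd F' p = fd ?F p" if "p \<in> ?W" for p using fd_cong[OF opW that] F' by blast
  \<comment> \<open>Here \<alpha> is given and the scaling relation is solved for
    \<open>lam\<close>. Only \<bar>\<open>lam\<close>\<bar> matters, so the positive root is
    taken.\<close>
  obtain lam where lam: "lam > 0" "lam ^ (2 * CARD('n) + 3) = \<bar>\<alpha>\<bar> ^ (2 * CARD('n) + 4)"
    using exists_power_eq_power[of "\<bar>\<alpha>\<bar>" "2 * CARD('n) + 3" "2 * CARD('n) + 4"] \<alpha> by auto
  obtain h where sd: "sphere_data ?W ?F (\<lambda>p. - lam *\<^sub>R ?F p) lam h"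
    using pc_data_imp_sphere_data[OF pc I(1), of lam] lam by auto
  define C where "C p = - lam *\<^sub>R ?F p" for p
  have "sphere_data ?W F' (C \<circ> inv_into ?W id) lam h"
  proof (rule sphere_data_cong[OF opW _ fdF' _ sd])
    show "F' differentiable (at p)" if "p \<in> ?W" for p
      using differentiable_cong_open[OF opW that, of ?F F'] F' smooth_on_differentiable[OF F that] by auto
    show "(C \<circ> inv_into ?W id) p = - lam *\<^sub>R ?F p" if "p \<in> ?W" for p
      using inv[OF that] by (simp add: C_def)
  qed
  then have hs: "hypersphere_on ?W F' (C \<circ> inv_into ?W id) lam"
    by (rule sphere_data_imp_hypersphere_on[OF bij_betw_model_frame opW])
  have chart: "is_chart (top_of_set ?W) (?W, id)"
    unfolding is_chart_def using opW by (simp add: subtopology_subtopology)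
  have man: "smooth_manifold (top_of_set ?W) {(?W, id)}"
    unfolding smooth_manifold_def
  proof (intro conjI)
    show "Hausdorff_space (top_of_set ?W)" by (simp add: Hausdorff_space_subtopology)
    show "second_countable (top_of_set ?W)"
    proof (rule second_countable_subtopology)
      obtain \<B> :: "'n model set set" where \<B>: "countable \<B>" "\<And>C. C \<in> \<B> \<Longrightarrow> open C"
        "\<And>S. open S \<Longrightarrow> \<exists>U. U \<subseteq> \<B> \<and> S = \<Union>U"
        using univ_second_countable by blast
      have "\<exists>V\<in>\<B>. x \<in> V \<and> V \<subseteq> S" if "open S" "x \<in> S" for S x
        using \<B>(3)[OF that(1)] that(2) by blast
      then show "second_countable (euclidean :: 'n model topology)"
        unfolding second_countable_def using \<B>(1,2) by auto
    qed
    have "smooth_on ?W (id \<circ> inv_into ?W id)"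
      by (rule smooth_on_cong[OF opW _ smooth_on_ident]) (simp add: inv)
    then show "\<forall>(U, \<phi>)\<in>{(?W, id)}. \<forall>(V, \<psi>)\<in>{(?W, id)}. smooth_on (\<phi> ` (U \<inter> V)) (\<psi> \<circ> inv_into U \<phi>)"
      by simp
  qed (use chart in auto)
  have conn: "connected_space (top_of_set ?W)"
    using W I(2) by (simp add: connected_space_subtopology connected_Times is_interval_connected)
  have ah: "affine_hypersphere (top_of_set ?W) {(?W, id)} ?F C lam"
    unfolding affine_hypersphere_def using man conn hs by (simp add: F'_def)
  have "Jt (C p) \<in> tangent_image F' p" if p: "p \<in> ?W" for p
  proof -
    obtain x z where xz: "p = (x, z)" "x \<in> W" "z \<in> I" using p by blast
    have "Jt (C p) = - lam *\<^sub>R boost z (g x)"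
      by (simp add: C_def xz(1) hyperbolic_form_boost Jt_boost)
    moreover have "tangent_image F' p = tangent_image ?F (x, z)"
      using fdF'[OF p] xz(1) by simp
    ultimately show ?thesis
      using subspace_scale[OF hyperbolic_tangent_subspace[OF op I(1) g xz(2,3)]
          hyperbolic_tangent_z[OF op I(1) g xz(2,3)], of "- lam"] by simp
  qed
  then show "Jt_tangent_hypersphere (top_of_set ?W) {(?W, id)} ?F"
    unfolding Jt_tangent_hypersphere_def using ah by (intro exI[of _ C] exI[of _ lam]) (simp add: F'_def)
  have dist: "v \<in> invariant_distribution F' p \<longleftrightarrow> snd v = 0" if p: "p \<in> ?W" for p v
    using invariant_distribution_hyperbolic_form[OF pc I(1) p]
    unfolding invariant_distribution_iff fdF'[OF p] .
  \<comment> \<open>The distribution is the kernel of dz: differentiating a field with zero last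
    component again gives zero last component, so brackets stay in the kernel.\<close>
  have snd0: "snd (fd X p v) = 0" if X: "smooth_on W' X" "open W'" "\<And>y. y \<in> W' \<Longrightarrow> snd (X y) = 0" "p \<in> W'"
    for X :: "'n model \<Rightarrow> 'n model" and W' p v
  proof -
    have "((\<lambda>y. snd (X y)) has_derivative (\<lambda>v. snd (fd X p v))) (at p)"
      by (rule has_derivative_snd[OF smooth_on_has_derivative[OF X(1,4)]])
    then have "((\<lambda>y. 0) has_derivative (\<lambda>v. snd (fd X p v))) (at p)"
      by (rule has_derivative_transform_within_open[OF _ X(2,4)]) (use X(3) in auto)
    then have "(\<lambda>v. snd (fd X p v)) = (\<lambda>v. 0)"
      using has_derivative_unique has_derivative_const by blast
    then show ?thesis by metis
  qed
  have "involutive_on ?W (invariant_distribution F')"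
    unfolding involutive_on_def
  proof (intro allI impI ballI)
    fix W' X Y p
    assume a: "open W' \<and> W' \<subseteq> ?W \<and> smooth_on W' X \<and> smooth_on W' Y \<and>
      (\<forall>x\<in>W'. X x \<in> invariant_distribution F' x \<and> Y x \<in> invariant_distribution F' x)" and p: "p \<in> W'"
    then have W': "open W'" "W' \<subseteq> ?W" "smooth_on W' X" "smooth_on W' Y" by blast+
    have "snd (X y) = 0" "snd (Y y) = 0" if "y \<in> W'" for y
      using a that W'(2) dist[of y] by blast+
    then have "snd (fd X p v) = 0" "snd (fd Y p v) = 0" for v
      using snd0[OF W'(3,1) _ p] snd0[OF W'(4,1) _ p] by blast+
    then have "snd (lie_bracket X Y p) = 0"
      unfolding lie_bracket_def flat_D_def by simp
    then show "lie_bracket X Y p \<in> invariant_distribution F' p" using dist a p by blast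
  qed
  then show "involutive_invariant_distribution {(?W, id)} ?F"
    unfolding involutive_invariant_distribution_def by (simp add: F'_def)
qed

section \<open>The local form of tangent hyperspheres\<close>

text \<open>Projecting along \<zeta> onto the kernel of \<eta> changes neither slot of \<Omega>, so
  \<Omega> is determined by its values on the kernel. It is applied to \<Omega> = d\<eta> at a
  point.\<close>

lemma closed_form_by_kernel:
  fixes \<Omega> :: "'a::real_vector \<Rightarrow> 'a \<Rightarrow> real" and \<eta> :: "'a \<Rightarrow> real"
  assumes l: "\<And>w. linear (\<lambda>v. \<Omega> v w)" and anti: "\<And>v w. \<Omega> v w = - \<Omega> w v"
    and \<eta>: "linear \<eta>" "\<eta> \<zeta> = 1" and \<zeta>: "\<And>w. \<Omega> \<zeta> w = 0"
    and ker: "\<And>v w. \<eta> v = 0 \<Longrightarrow> \<eta> w = 0 \<Longrightarrow> \<Omega> v w = 0"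
  shows "\<Omega> v w = 0"
proof -
  define p where "p v = v - \<eta> v *\<^sub>R \<zeta>" for v :: 'a
  have p0: "\<eta> (p v) = 0" for v
    by (simp add: p_def linear_diff[OF \<eta>(1)] linear_cmul[OF \<eta>(1)] \<eta>(2))
  have left: "\<Omega> v w = \<Omega> (p v) w" for v w
    by (simp add: p_def linear_diff[OF l] linear_cmul[OF l] \<zeta>)
  have "\<Omega> v w = - \<Omega> (p w) (p v)" using left[of v w] anti[of "p v" w] left[of w "p v"] by simp
  then show ?thesis using ker[OF p0 p0] by simp
qed

context
  fixes F :: "'n::finite model \<Rightarrow> 'n ambient" and B :: "'n model set" and lam :: real and h
  assumes B: "open B" and sd: "sphere_data B F (\<lambda>y. - lam *\<^sub>R F y) lam h" and lam: "lam \<noteq> 0"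
    and JF: "\<And>y. y \<in> B \<Longrightarrow> Jt (F y) \<in> tangent_image F y"
    and inv: "involutive_on B (invariant_distribution F)"
begin

lemma sphere_smooth: "smooth_on B F"
  using sd by (simp add: sphere_data_def immersion_on_def)

text \<open>\<open>\<eta>\<close> is the transversal component of \<open>J F\<^sub>*\<close>; its kernel is the invariant distribution, and
  it is invariant under the flow of the field \<open>\<zeta>\<close> with \<open>F\<^sub>* \<zeta> = J F\<close>.  Hence involutivity of the kernel
  makes \<open>\<eta>\<close> closed.\<close>

lemma transversal_form:
  obtains \<eta> where "\<And>y. y \<in> B \<Longrightarrow> linear (\<eta> y)" "\<And>v. smooth_on B (\<lambda>y. \<eta> y v)"
    "\<And>y v. y \<in> B \<Longrightarrow> Jt (fd F y v) - \<eta> y v *\<^sub>R F y \<in> tangent_image F y"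
    "\<And>y v. y \<in> B \<Longrightarrow> \<eta> y v = 0 \<longleftrightarrow> Jt (fd F y v) \<in> tangent_image F y"
    "\<And>y v w. y \<in> B \<Longrightarrow> fd (\<lambda>z. \<eta> z w) y v = fd (\<lambda>z. \<eta> z v) y w"
proof -
  note F = sphere_smooth
  obtain \<mu> where \<mu>: "smooth_on B \<mu>" "\<And>y. y \<in> B \<Longrightarrow> \<mu> y \<bullet> (- lam *\<^sub>R F y) = 1"
    "\<And>y v. y \<in> B \<Longrightarrow> \<mu> y \<bullet> fd F y v = 0"
    "\<And>y w. y \<in> B \<Longrightarrow> w \<in> tangent_image F y \<longleftrightarrow> \<mu> y \<bullet> w = 0"
    "\<And>y v w. y \<in> B \<Longrightarrow> h y v w = \<mu> y \<bullet> D2 F y v w"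
    "\<And>y v. y \<in> B \<Longrightarrow> fd \<mu> y v \<bullet> (- lam *\<^sub>R F y) = 0"
    "\<And>y v w. y \<in> B \<Longrightarrow> fd \<mu> y v \<bullet> fd F y w = - h y v w"
    by (rule sphere_data_conormal[OF bij_betw_model_frame B sd]) (rule that)
  have linF: "linear (fd F y)" if "y \<in> B" for y by (rule smooth_on_linear_fd[OF F that])
  have \<mu>F: "\<mu> y \<bullet> F y = - 1 / lam" if "y \<in> B" for y
    using \<mu>(2)[OF that] lam by (simp add: field_simps)
  have d\<mu>F: "fd \<mu> y v \<bullet> F y = 0" if "y \<in> B" for y v
    using \<mu>(6)[OF that, of v] lam by simp
  \<comment> \<open>The factor - \<open>lam\<close> compensates
    \<open>\<mu> y \<bullet> F y = - 1 / lam\<close>, so that \<eta> is the coefficient of F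
    itself.\<close>
  define \<eta> where "\<eta> y v = - lam * (\<mu> y \<bullet> Jt (fd F y v))" for y v
  have lin: "linear (\<eta> y)" if "y \<in> B" for y
    by (rule linearI) (simp_all add: \<eta>_def linear_add[OF linF[OF that]] linear_cmul[OF linF[OF that]]
        inner_add_right algebra_simps)
  have sm: "smooth_on B (\<lambda>y. \<eta> y v)" for v
    unfolding \<eta>_def
    by (intro smooth_on_bounded_bilinear[OF bounded_bilinear_mult] smooth_on_const smooth_on_inner B \<mu>(1)
        smooth_on_bounded_linear[OF bounded_linear_Jt] smooth_on_fd F)
  have normal: "Jt (fd F y v) - \<eta> y v *\<^sub>R F y \<in> tangent_image F y" if "y \<in> B" for y v
    unfolding \<mu>(4)[OF that] inner_diff_right inner_scaleR_right \<mu>F[OF that]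
    using lam by (simp add: \<eta>_def)
  have ker: "\<eta> y v = 0 \<longleftrightarrow> Jt (fd F y v) \<in> tangent_image F y" if "y \<in> B" for y v
    unfolding \<mu>(4)[OF that] using lam by (simp add: \<eta>_def)
  have d\<eta>: "fd (\<lambda>z. \<eta> z w) y v = - lam * (fd \<mu> y v \<bullet> Jt (fd F y w) + \<mu> y \<bullet> Jt (D2 F y v w))"
    if y: "y \<in> B" for y v w
  proof -
    have "((\<lambda>z. - lam * (\<mu> z \<bullet> Jt (fd F z w))) has_derivative
      (\<lambda>v. - lam * (\<mu> y \<bullet> Jt (D2 F y v w) + fd \<mu> y v \<bullet> Jt (fd F y w)))) (at y)"
      by (intro has_derivative_mult_right has_derivative_inner smooth_on_has_derivative[OF \<mu>(1) y]
          bounded_linear.has_derivative[OF bounded_linear_Jt] fd_has_derivative_D2[OF F y])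
    from fd_eqI[OF this] show ?thesis by (simp add: \<eta>_def add.commute)
  qed
  have d\<mu>JF: "fd \<mu> y v \<bullet> Jt (F y) = - (\<mu> y \<bullet> Jt (fd F y v))" if y: "y \<in> B" for y v
  proof -
    have "((\<lambda>z. \<mu> z \<bullet> Jt (F z)) has_derivative (\<lambda>v. \<mu> y \<bullet> Jt (fd F y v) + fd \<mu> y v \<bullet> Jt (F y))) (at y)"
      by (intro has_derivative_inner smooth_on_has_derivative[OF \<mu>(1) y]
          bounded_linear.has_derivative[OF bounded_linear_Jt] smooth_on_has_derivative[OF F y])
    then have "((\<lambda>z. 0) has_derivative (\<lambda>v. \<mu> y \<bullet> Jt (fd F y v) + fd \<mu> y v \<bullet> Jt (F y))) (at y)"
      by (rule has_derivative_transform_within_open[OF _ B y]) (use JF \<mu>(4) in auto)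
    then have "(\<lambda>v. \<mu> y \<bullet> Jt (fd F y v) + fd \<mu> y v \<bullet> Jt (F y)) = (\<lambda>v. 0)"
      using has_derivative_unique has_derivative_const by blast
    then have "\<mu> y \<bullet> Jt (fd F y v) + fd \<mu> y v \<bullet> Jt (F y) = 0" by metis
    then show ?thesis by simp
  qed
  have closed: "fd (\<lambda>z. \<eta> z w) y v = fd (\<lambda>z. \<eta> z v) y w" if y: "y \<in> B" for y v w
  proof -
    obtain \<zeta> where \<zeta>: "Jt (F y) = fd F y \<zeta>" using JF[OF y] by blast
    have \<eta>\<zeta>: "\<eta> y \<zeta> = 1" using \<zeta>[symmetric] \<mu>F[OF y] lam by (simp add: \<eta>_def)
    define \<Omega> where "\<Omega> v w = fd (\<lambda>z. \<eta> z w) y v - fd (\<lambda>z. \<eta> z v) y w" for v w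
    \<comment> \<open>Symmetry of the second derivative cancels all terms with \<open>D2 F\<close>;
      only derivatives of the conormal remain.\<close>
    have \<Omega>: "\<Omega> v w = - lam * (fd \<mu> y v \<bullet> Jt (fd F y w) - fd \<mu> y w \<bullet> Jt (fd F y v))" for v w
      unfolding \<Omega>_def d\<eta>[OF y] D2_sym[OF B y F, of w v] by (simp add: algebra_simps)
    note lin\<mu> = smooth_on_linear_fd[OF \<mu>(1) y]
    have "\<Omega> v w = 0"
    proof (rule closed_form_by_kernel[of \<Omega> "\<eta> y" \<zeta>])
      show "linear (\<lambda>v. \<Omega> v w)" for w
        by (rule linearI) (simp_all add: \<Omega> linear_add[OF lin\<mu>] linear_cmul[OF lin\<mu>]
            linear_add[OF linF[OF y]] linear_cmul[OF linF[OF y]] inner_add_left inner_add_right algebra_simps)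
      show "\<Omega> v w = - \<Omega> w v" for v w by (simp add: \<Omega>_def)
      show "linear (\<eta> y)" by (rule lin[OF y])
      show "\<eta> y \<zeta> = 1" by (rule \<eta>\<zeta>)
      show "\<Omega> \<zeta> w = 0" for w
      proof -
        \<comment> \<open>Applying J to
          \<open>Jt (fd F y w) = fd F y u + \<eta> y w *\<^sub>R F y\<close> shows that
          \<open>u\<close> lies in the kernel of \<eta>. Differentiating
          \<open>\<mu> \<bullet> Jt F = 0\<close> along \<open>u\<close> then gives h(\<zeta>, u) =
          0, which kills the first term of \<Omega>. The second vanishes since J maps the
          pushforward of \<zeta> to F.\<close>
        obtain u where u: "Jt (fd F y w) - \<eta> y w *\<^sub>R F y = fd F y u" using normal[OF y] by blast
        then have Jw: "Jt (fd F y w) = fd F y u + \<eta> y w *\<^sub>R F y" by (simp add: algebra_simps)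
        then have "Jt (Jt (fd F y w)) = Jt (fd F y u + \<eta> y w *\<^sub>R F y)" by simp
        then have "fd F y w = Jt (fd F y u) + \<eta> y w *\<^sub>R Jt (F y)" by simp
        then have "\<mu> y \<bullet> (Jt (fd F y u) + \<eta> y w *\<^sub>R Jt (F y)) = 0" using \<mu>(3)[OF y] by metis
        then have "\<mu> y \<bullet> Jt (fd F y u) = 0" using JF[OF y] \<mu>(4)[OF y] by (simp add: inner_add_right)
        then have "fd \<mu> y u \<bullet> fd F y \<zeta> = 0" using d\<mu>JF[OF y] \<zeta> by simp
        then have "h y \<zeta> u = 0" using \<mu>(5,7)[OF y] D2_sym[OF B y F] by (metis neg_equal_0_iff_equal)
        then have "fd \<mu> y \<zeta> \<bullet> Jt (fd F y w) = 0"
          unfolding Jw by (simp add: inner_add_right \<mu>(7)[OF y] d\<mu>F[OF y])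
        moreover have "fd \<mu> y w \<bullet> Jt (fd F y \<zeta>) = 0"
          using \<zeta>[symmetric] d\<mu>F[OF y] by simp
        ultimately show ?thesis by (simp add: \<Omega>)
      qed
      show "\<Omega> v w = 0" if v: "\<eta> y v = 0" and w: "\<eta> y w = 0" for v w
      proof -
        \<comment> \<open>Extends a kernel vector at \<open>y\<close> to a smooth field in the
          distribution, with the vector \<zeta> frozen at its value at \<open>y\<close>. Multiplying
          by \<open>\<eta> z \<zeta>\<close>, which is 1 at \<open>y\<close>, avoids a
          division.\<close>
        define X where "X u z = \<eta> z \<zeta> *\<^sub>R u - \<eta> z u *\<^sub>R \<zeta>" for u z
        have smX: "smooth_on B (X u)" for u
          unfolding X_def[abs_def] by (intro smooth_on_diff smooth_on_scaleR smooth_on_const B sm)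
        have D: "X u z \<in> invariant_distribution F z" if "z \<in> B" for u z
          unfolding invariant_distribution_iff ker[OF that, symmetric]
          by (simp add: X_def linear_diff[OF lin[OF that]] linear_cmul[OF lin[OF that]])
        have dX: "fd (X u) y r = fd (\<lambda>z. \<eta> z \<zeta>) y r *\<^sub>R u - fd (\<lambda>z. \<eta> z u) y r *\<^sub>R \<zeta>" for u r
        proof -
          have "(X u has_derivative (\<lambda>r. fd (\<lambda>z. \<eta> z \<zeta>) y r *\<^sub>R u - fd (\<lambda>z. \<eta> z u) y r *\<^sub>R \<zeta>)) (at y)"
            unfolding X_def[abs_def]
            by (intro has_derivative_diff has_derivative_scaleR_left smooth_on_has_derivative[OF sm y])
          from fd_eqI[OF this] show ?thesis by simp
        qed
        have Xy: "X u y = u" if "\<eta> y u = 0" for u using that \<eta>\<zeta> by (simp add: X_def)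
        have "\<forall>x\<in>B. lie_bracket (X v) (X w) x \<in> invariant_distribution F x"
          using inv B smX D unfolding involutive_on_def by blast
        then have "\<eta> y (lie_bracket (X v) (X w) y) = 0"
          using y ker[OF y] by (simp add: invariant_distribution_iff)
        \<comment> \<open>For kernel vectors, \<eta> of this bracket at \<open>y\<close> is -
          \<Omega> v w: the derivatives of \<open>\<eta> z \<zeta>\<close> only multiply
          \<open>v\<close> and \<open>w\<close>, on which \<eta> vanishes.\<close>
        then show "\<Omega> v w = 0"
          by (simp add: lie_bracket_def flat_D_def dX Xy v w linear_diff[OF lin[OF y]] linear_cmul[OF lin[OF y]]
              \<eta>\<zeta> \<Omega>_def)
      qed
    qed
    then show ?thesis by (simp add: \<Omega>_def)
  qed
  show thesis by (rule that[OF lin sm normal ker closed])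
qed

text \<open>With \<open>dt = \<eta>\<close>, the map \<open>G = exp (- t J) (J F)\<close> is constant along the integral curves of \<open>\<zeta>\<close> and has rank
  \<open>2n\<close>; a linear image of \<open>G\<close> provides the first \<open>2n\<close> coordinates and \<open>- t\<close> the last one.\<close>

lemma sphere_local_coordinates:
  assumes p0: "p0 \<in> B"
  obtains U V K \<Phi> \<Psi> g where "open U" "U \<subseteq> B" "p0 \<in> U" "open V" "open K" "is_interval K" "K \<noteq> {}"
    "homeomorphism U (V \<times> K) \<Phi> \<Psi>" "smooth_on U \<Phi>" "smooth_on (V \<times> K) \<Psi>"
    "\<And>p. p \<in> V \<times> K \<Longrightarrow> bij (fd \<Psi> p)" "smooth_on V g"
    "\<And>x z. x \<in> V \<Longrightarrow> z \<in> K \<Longrightarrow> F (\<Psi> (x, z)) = hyperbolic_form g (x, z)"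
    "\<And>x z u. x \<in> V \<Longrightarrow> z \<in> K \<Longrightarrow> Jt (fd F (\<Psi> (x, z)) (fd \<Psi> (x, z) (u, 0))) \<in> tangent_image F (\<Psi> (x, z))"
proof -
  note F = sphere_smooth
  obtain \<eta> where lin: "\<And>y. y \<in> B \<Longrightarrow> linear (\<eta> y)" and sm: "\<And>v. smooth_on B (\<lambda>y. \<eta> y v)"
    and normal: "\<And>y v. y \<in> B \<Longrightarrow> Jt (fd F y v) - \<eta> y v *\<^sub>R F y \<in> tangent_image F y"
    and ker: "\<And>y v. y \<in> B \<Longrightarrow> \<eta> y v = 0 \<longleftrightarrow> Jt (fd F y v) \<in> tangent_image F y"
    and closed: "\<And>y v w. y \<in> B \<Longrightarrow> fd (\<lambda>z. \<eta> z w) y v = fd (\<lambda>z. \<eta> z v) y w"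
    by (rule transversal_form) (rule that)
  have linF: "linear (fd F y)" and injF: "inj (fd F y)" if "y \<in> B" for y
    using smooth_on_linear_fd[OF F that] sd that by (auto simp: sphere_data_def immersion_on_def)
  have sub: "subspace (tangent_image F y)" if "y \<in> B" for y
    by (rule linear_subspace_image[OF linF[OF that] subspace_UNIV])
  have FT: "F y \<notin> tangent_image F y" if "y \<in> B" for y
  proof
    assume "F y \<in> tangent_image F y"
    from subspace_scale[OF sub[OF that] this, of "- lam"] show False
      using sd that unfolding sphere_data_def transversal_on_def by blast
  qed
  have "\<exists>\<zeta>. Jt (F y) = fd F y \<zeta>" if "y \<in> B" for y using JF[OF that] by blast
  then obtain \<zeta> where \<zeta>: "\<And>y. y \<in> B \<Longrightarrow> Jt (F y) = fd F y (\<zeta> y)" by metis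
  have \<eta>\<zeta>: "\<eta> y (\<zeta> y) = 1" if y: "y \<in> B" for y
  proof (rule ccontr)
    assume ne: "\<eta> y (\<zeta> y) \<noteq> 1"
    have "(1 - \<eta> y (\<zeta> y)) *\<^sub>R F y \<in> tangent_image F y"
      using normal[OF y, of "\<zeta> y"] \<zeta>[OF y, symmetric] by (simp add: algebra_simps)
    from subspace_scale[OF sub[OF y] this, of "1 / (1 - \<eta> y (\<zeta> y))"] show False
      using FT[OF y] ne by simp
  qed
  obtain r where r: "r > 0" "ball p0 r \<subseteq> B" using B p0 open_contains_ball by blast
  let ?B = "ball p0 r"
  have inB: "y \<in> B" if "y \<in> ?B" for y using that r by blast
  obtain t where dt: "\<And>y. y \<in> ?B \<Longrightarrow> (t has_derivative \<eta> y) (at y)"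
    by (rule poincare_lemma_one_forms[OF lin[OF inB] smooth_on_subset[OF sm r(2)] closed[OF inB]];
        (assumption | (rule that, assumption)))
  have smt: "smooth_on ?B t"
  proof (rule iffD2[OF smooth_on_iff], intro conjI ballI allI)
    show "t differentiable (at y)" if "y \<in> ?B" for y 
      unfolding differentiable_def by (rule exI[of _ "\<eta> y"], rule dt[OF that])
    show "smooth_on ?B (\<lambda>y. fd t y v)" for v
      by (rule smooth_on_cong[OF open_ball _ smooth_on_subset[OF sm[of v] r(2)]]) (simp add: fd_eqI[OF dt])
  qed
  define G where "G y = boost (t y) (Jt (F y))" for y
  have smG: "smooth_on ?B G"
    unfolding G_def[abs_def]
    by (intro smooth_on_boost open_ball smt smooth_on_bounded_linear[OF bounded_linear_Jt] smooth_on_subset[OF F r(2)])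
  have fdG: "fd G y v = boost (t y) (Jt (fd F y v) - \<eta> y v *\<^sub>R F y)" if y: "y \<in> ?B" for y v
  proof -
    have "(G has_derivative (\<lambda>v. boost (t y) (Jt (fd F y v)) - \<eta> y v *\<^sub>R Jt (boost (t y) (Jt (F y))))) (at y)"
      unfolding G_def[abs_def]
      by (intro has_derivative_boost dt[OF y] bounded_linear.has_derivative[OF bounded_linear_Jt]
          smooth_on_has_derivative[OF F inB[OF y]])
    from fd_eqI[OF this] show ?thesis by (simp add: Jt_boost)
  qed
  have fdG\<zeta>: "fd G y (\<zeta> y) = 0" if y: "y \<in> ?B" for y
    using \<zeta>[OF inB[OF y], symmetric] \<eta>\<zeta>[OF inB[OF y]] by (simp add: fdG[OF y])
  have fdG0: "v = 0" if y: "y \<in> ?B" and 0: "fd G y v = 0" "\<eta> y v = 0" for y v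
  proof -
    have "boost (t y) (Jt (fd F y v)) = boost (t y) 0" using fdG[OF y, of v] 0 by simp
    then have "Jt (fd F y v) = 0" by (simp only: boost_eq_iff)
    then have "Jt (Jt (fd F y v)) = Jt 0" by simp
    then have "fd F y v = 0" by simp
    then show "v = 0" using injF[OF inB[OF y]] linear_injective_0[OF linF[OF inB[OF y]]] by blast
  qed
  have p0B: "p0 \<in> ?B" using r by simp
  let ?H = "{v. \<eta> p0 v = 0}"
  have linp: "linear (\<eta> p0)" by (rule lin[OF p0])
  \<comment> \<open>A linear parametrisation of the kernel of \<eta> at \<open>p0\<close> by the
    base space. The kernel is a hyperplane, as \<eta>(\<zeta>) = 1, so it has the right dimension
    2n.\<close>
  obtain k :: "'n base \<Rightarrow> 'n model" where k: "linear k" "inj k" "range k = ?H"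
  proof -
    have subH: "subspace ?H"
      using linear_add[OF linp] linear_cmul[OF linp] linear_0[OF linp] by (auto simp: subspace_def)
    define a where "a = (\<Sum>b\<in>Basis. \<eta> p0 b *\<^sub>R b)"
    have e: "\<eta> p0 v = a \<bullet> v" for v
      using linear_eq_sum_Basis[OF linp, of v] unfolding a_def inner_sum_left inner_scaleR_left
      by (simp add: mult.commute inner_commute)
    have "a \<noteq> 0" using e[of "\<zeta> p0"] \<eta>\<zeta>[OF p0] by auto
    then have "dim ?H = DIM('n model) - 1" using dim_hyperplane[of a] by (simp add: e)
    then have "dim (UNIV :: 'n base set) = dim ?H" by (simp add: dim_UNIV)
    from subspace_isomorphism[OF subspace_UNIV subH this] show ?thesis using that by blast
  qed
  have linG: "linear (fd G p0)" by (rule smooth_on_linear_fd[OF smG p0B])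
  \<comment> \<open>On the kernel of \<eta> the derivative of \<open>G\<close> is injective, so a
    left inverse \<open>L\<close> exists. It projects the ambient space to 2n coordinates in which
    \<open>L (G y)\<close> has full rank at \<open>p0\<close>.\<close>
  obtain L where L: "linear L" "L \<circ> (fd G p0 \<circ> k) = id"
  proof -
    have l: "linear (fd G p0 \<circ> k)" by (rule linear_compose[OF k(1) linG])
    have "inj (fd G p0 \<circ> k)"
      unfolding linear_injective_0[OF l]
    proof (intro allI impI)
      fix u assume "(fd G p0 \<circ> k) u = 0"
      moreover have "\<eta> p0 (k u) = 0" using k(3) by blast
      ultimately have "k u = 0" using fdG0[OF p0B] by simp
      then show "u = 0" using k(2) linear_injective_0[OF k(1)] by blast
    qed
    from linear_injective_left_inverse[OF l this] show ?thesis using that by blast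
  qed
  have bL: "bounded_linear L" using L(1) linear_conv_bounded_linear by blast
  define \<Phi> where "\<Phi> y = (L (G y), - t y)" for y
  have sm\<Phi>: "smooth_on ?B \<Phi>"
    unfolding \<Phi>_def[abs_def]
    by (intro smooth_on_Pair open_ball smooth_on_bounded_linear[OF bL] smG smooth_on_uminus smt)
  have fd\<Phi>: "fd \<Phi> y v = (L (fd G y v), - \<eta> y v)" if y: "y \<in> ?B" for y v
  proof -
    have "(\<Phi> has_derivative (\<lambda>v. (L (fd G y v), - \<eta> y v))) (at y)"
      unfolding \<Phi>_def[abs_def]
      by (intro has_derivative_Pair bounded_linear.has_derivative[OF bL] smooth_on_has_derivative[OF smG y]
          has_derivative_minus dt[OF y])
    from fd_eqI[OF this] show ?thesis by simp
  qed
  have "inj (fd \<Phi> p0)"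
    unfolding linear_injective_0[OF smooth_on_linear_fd[OF sm\<Phi> p0B]]
  proof (intro allI impI)
    fix v assume "fd \<Phi> p0 v = 0"
    then have 0: "L (fd G p0 v) = 0" "\<eta> p0 v = 0" by (simp_all add: fd\<Phi>[OF p0B] prod_eq_iff)
    then obtain u where u: "v = k u" using k(3) by blast
    then have "u = 0" using 0(1) L(2) by (metis comp_apply id_apply)
    then show "v = 0" using u linear_0[OF k(1)] by simp
  qed
  from smooth_inverse_function[OF bij_betw_model_frame open_ball sm\<Phi> p0B this]
  obtain U1 V1 \<Psi> where U1: "open U1" "U1 \<subseteq> ?B" "p0 \<in> U1" "open V1" "homeomorphism U1 V1 \<Phi> \<Psi>"
    and sm\<Psi>: "smooth_on V1 \<Psi>"
    and i1: "\<And>y v. y \<in> V1 \<Longrightarrow> fd \<Phi> (\<Psi> y) (fd \<Psi> y v) = v"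
    and i2: "\<And>y v. y \<in> V1 \<Longrightarrow> fd \<Psi> y (fd \<Phi> (\<Psi> y) v) = v"
    by metis
  have \<Phi>\<Psi>: "\<Phi> (\<Psi> p) = p" "\<Psi> p \<in> U1" "\<Psi> p \<in> ?B" if "p \<in> V1" for p
    using U1(2,5) that by (auto simp: homeomorphism_def)
  have "\<Phi> p0 \<in> V1" using U1(3,5) by (auto simp: homeomorphism_def)
  then obtain V K0 where VK0: "open V" "open K0" "\<Phi> p0 \<in> V \<times> K0" "V \<times> K0 \<subseteq> V1"
    by (rule open_prod_elim[OF U1(4)])
  define z0 where "z0 = - t p0"
  have \<Phi>p0: "\<Phi> p0 = (L (G p0), z0)" by (simp add: \<Phi>_def z0_def)
  have "z0 \<in> K0" using VK0(3) \<Phi>p0 by simp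
  then obtain \<epsilon> where \<epsilon>: "\<epsilon> > 0" "ball z0 \<epsilon> \<subseteq> K0" using openE[OF VK0(2)] by metis
  \<comment> \<open>A ball in the real line is an interval: connected, as the constancy of
    \<open>G\<close> in \<open>z\<close> requires, and containing the slice value \<open>z0\<close>
    on which \<open>g\<close> is defined.\<close>
  define K where "K = ball z0 \<epsilon>"
  have K: "open K" "is_interval K" "z0 \<in> K" "convex K" "K \<subseteq> K0"
    using \<epsilon> by (auto simp: K_def is_interval_convex_1)
  have VK: "V \<times> K \<subseteq> V1" using VK0(4) K(5) by blast
  have opVK: "open (V \<times> K)" by (rule open_Times[OF VK0(1) K(1)])
  have \<Psi>VK: "\<Phi> (\<Psi> p) = p" "\<Psi> p \<in> ?B" "\<Psi> p \<in> B" if "p \<in> V \<times> K" for p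
    using \<Phi>\<Psi>[of p] that VK inB by blast+
  define U where "U = \<Psi> ` (V \<times> K)"
  have UU1: "U \<subseteq> U1" using \<Phi>\<Psi>(2) VK by (auto simp: U_def)
  have hom: "homeomorphism U (V \<times> K) \<Phi> \<Psi>"
    by (rule homeomorphism_of_subsets[OF U1(5) UU1 VK])
       (use \<Phi>\<Psi>(1) VK in \<open>force simp: U_def image_image\<close>)
  have opU: "open U"
  proof -
    have "U = U1 \<inter> \<Phi> -` (V \<times> K)"
    proof (intro equalityI subsetI)
      show "p \<in> U1 \<inter> \<Phi> -` (V \<times> K)" if "p \<in> U" for p
        using that UU1 \<Psi>VK(1) by (auto simp: U_def)
      show "p \<in> U" if p: "p \<in> U1 \<inter> \<Phi> -` (V \<times> K)" for p
      proof -
        have "\<Psi> (\<Phi> p) = p" using p U1(5) by (auto simp: homeomorphism_def)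
        then show ?thesis using p unfolding U_def by (metis IntD2 imageI vimageD)
      qed
    qed
    moreover have "continuous_on U1 \<Phi>" using U1(5) by (simp add: homeomorphism_def)
    ultimately show ?thesis using continuous_on_open_vimage[OF U1(1)] opVK by (metis Int_commute)
  qed
  have p0U: "p0 \<in> U"
  proof -
    have "\<Psi> (\<Phi> p0) = p0" using U1(3,5) by (auto simp: homeomorphism_def)
    moreover have "\<Phi> p0 \<in> V \<times> K" using VK0(3) K(3) \<Phi>p0 by simp
    ultimately show ?thesis unfolding U_def by (metis imageI)
  qed
  \<comment> \<open>The coordinate direction of \<open>z\<close> corresponds to - \<zeta>: \<Phi>
    maps - s \<zeta> to \<open>(0, s)\<close>, since \<open>G\<close> is stationary along \<zeta>
    and - t decreases at unit rate.\<close>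
  have fdGz: "fd G (\<Psi> p) (fd \<Psi> p (0, s)) = 0" if p: "p \<in> V \<times> K" for p s
  proof -
    let ?y = "\<Psi> p"
    note y = \<Psi>VK(2)[OF p]
    have "fd \<Phi> ?y (- s *\<^sub>R \<zeta> ?y) = (0, s)"
      using fdG\<zeta>[OF y] \<eta>\<zeta>[OF inB[OF y]] linear_cmul[OF lin[OF inB[OF y]], of "- s"]
        linear_cmul[OF smooth_on_linear_fd[OF smG y], of "- s"] linear_0[OF L(1)]
      by (simp add: fd\<Phi>[OF y])
    then have "fd \<Psi> p (0, s) = - s *\<^sub>R \<zeta> ?y" using i2[of p "- s *\<^sub>R \<zeta> ?y"] p VK by auto
    then show ?thesis using linear_cmul[OF smooth_on_linear_fd[OF smG y], of "- s"] fdG\<zeta>[OF y] by simp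
  qed
  have const: "G (\<Psi> (x, z)) = G (\<Psi> (x, z0))" if x: "x \<in> V" and z: "z \<in> K" for x z
  proof (rule has_derivative_zero_unique_connected[OF K(1) convex_connected[OF K(4)] _ z K(3)])
    fix z assume z: "z \<in> K"
    have p: "(x, z) \<in> V \<times> K" using x z by simp
    have 1: "((\<lambda>z. (x, z)) has_derivative (\<lambda>s. (0, s))) (at z)"
      by (auto intro!: derivative_eq_intros)
    have 2: "(\<Psi> has_derivative fd \<Psi> (x, z)) (at (x, z))"
      using p VK by (intro smooth_on_has_derivative[OF sm\<Psi>]) blast
    have "((\<lambda>z. G (\<Psi> (x, z))) has_derivative (\<lambda>s. fd G (\<Psi> (x, z)) (fd \<Psi> (x, z) (0, s)))) (at z)"
      by (rule has_derivative_compose[OF has_derivative_compose[OF 1 2]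
            smooth_on_has_derivative[OF smG \<Psi>VK(2)[OF p]]])
    then show "((\<lambda>z. G (\<Psi> (x, z))) has_derivative (\<lambda>s. 0)) (at z)" by (simp add: fdGz[OF p])
  qed
  define g where "g x = G (\<Psi> (x, z0))" for x
  have smg: "smooth_on V g"
  proof -
    have "smooth_on V (\<lambda>x. (x, z0))" by (intro smooth_on_Pair VK0(1) smooth_on_ident smooth_on_const)
    then have "smooth_on V (\<lambda>x. \<Psi> (x, z0))"
      by (intro smooth_on_compose[OF VK0(1) opVK _ smooth_on_subset[OF sm\<Psi> VK], where F = "\<lambda>x. (x, z0)"])
         (use K(3) in auto)
    then show ?thesis
      unfolding g_def[abs_def]
      by (intro smooth_on_compose[OF VK0(1) open_ball _ smG, where F = "\<lambda>x. \<Psi> (x, z0)"])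
         (use \<Psi>VK(2) K(3) in blast)+
  qed
  have form: "F (\<Psi> (x, z)) = hyperbolic_form g (x, z)" if x: "x \<in> V" and z: "z \<in> K" for x z
  proof -
    have "\<Phi> (\<Psi> (x, z)) = (x, z)" using \<Psi>VK(1) x z by blast
    then have t: "t (\<Psi> (x, z)) = - z" by (simp add: \<Phi>_def)
    have "boost z (g x) = boost z (boost (- z) (Jt (F (\<Psi> (x, z)))))"
      using const[OF x z] t by (simp add: g_def G_def)
    then have "Jt (boost z (g x)) = F (\<Psi> (x, z))" by (simp add: boost_boost)
    then show ?thesis by (simp add: hyperbolic_form_boost Jt_boost)
  qed
  show thesis
  proof (rule that[OF opU _ p0U VK0(1) K(1,2) _ hom _ smooth_on_subset[OF sm\<Psi> VK] _ smg form])
    show "U \<subseteq> B" using \<Psi>VK(3) by (auto simp: U_def)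
    show "K \<noteq> {}" using K(3) by blast
    show "smooth_on U \<Phi>" using UU1 U1(2) by (intro smooth_on_subset[OF sm\<Phi>]) blast
    show "bij (fd \<Psi> p)" if "p \<in> V \<times> K" for p
      using i1[of p] i2[of p] that VK by (intro bijI' ; metis subsetD)
    show "Jt (fd F (\<Psi> (x, z)) (fd \<Psi> (x, z) (u, 0))) \<in> tangent_image F (\<Psi> (x, z))"
      if "x \<in> V" "z \<in> K" for x z u
    proof -
      have p: "(x, z) \<in> V \<times> K" using that by simp
      \<comment> \<open>The last component of the derivative of \<Phi> is - \<eta>, so the base
        directions of these coordinates lie in the kernel of \<eta>, the invariant
        distribution.\<close>
      have "fd \<Phi> (\<Psi> (x, z)) (fd \<Psi> (x, z) (u, 0)) = (u, 0)" using i1 p VK by blast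
      then have "\<eta> (\<Psi> (x, z)) (fd \<Psi> (x, z) (u, 0)) = 0" by (simp add: fd\<Phi>[OF \<Psi>VK(2)[OF p]])
      then show ?thesis unfolding ker[OF \<Psi>VK(3)[OF p]] .
    qed
  qed
qed

end

text \<open>Composing a chart with a diffeomorphism yields transition maps that are old ones
  composed with \<Phi> or \<Psi>. The identity for \<open>inv_into\<close>, valid on
  \<open>Y\<close>, is what lets them be compared there.\<close>

lemma compatible_chart_compose:
  fixes A :: "('p, 'e::euclidean_space) chart set"
  assumes man: "smooth_manifold M A" and A0: "(U0, \<phi>0) \<in> A"
    and U: "open U" "U \<subseteq> \<phi>0 ` U0" and Y: "open Y" and hom: "homeomorphism U Y \<Phi> \<Psi>"
    and sm: "smooth_on U \<Phi>" "smooth_on Y \<Psi>"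
  defines "U' \<equiv> {q \<in> U0. \<phi>0 q \<in> U}"
  shows "compatible_chart M A (U', \<Phi> \<circ> \<phi>0)" "(\<Phi> \<circ> \<phi>0) ` U' = Y"
    "\<And>y. y \<in> Y \<Longrightarrow> inv_into U' (\<Phi> \<circ> \<phi>0) y = inv_into U0 \<phi>0 (\<Psi> y)"
proof -
  note mD = smooth_manifoldD[OF man]
  note c0 = mD(1)[OF A0]
  note c0D = is_chartD[OF c0]
  have U'U0: "U' \<subseteq> U0" by (auto simp: U'_def)
  have im0: "\<phi>0 ` U' = U" using U(2) by (auto simp: U'_def)
  have \<Phi>: "\<Phi> y \<in> Y" "\<Psi> (\<Phi> y) = y" if "y \<in> U" for y using hom that by (auto simp: homeomorphism_def)
  have \<Psi>: "\<Psi> y \<in> U" "\<Phi> (\<Psi> y) = y" if "y \<in> Y" for y using hom that by (auto simp: homeomorphism_def)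
  have imY: "\<Phi> ` U = Y" using hom by (simp add: homeomorphism_def)
  show im: "(\<Phi> \<circ> \<phi>0) ` U' = Y" unfolding image_comp[symmetric] im0 imY ..
  have inj: "inj_on (\<Phi> \<circ> \<phi>0) U'"
    using inj_on_subset[OF c0D(4) U'U0] im0 \<Phi>(2) by (intro comp_inj_on) (auto intro: inj_on_inverseI)
  have inv0: "inv_into U0 \<phi>0 y \<in> U'" "\<phi>0 (inv_into U0 \<phi>0 y) = y" if "y \<in> U" for y
  proof -
    have y: "y \<in> \<phi>0 ` U0" using U(2) that by blast
    show "\<phi>0 (inv_into U0 \<phi>0 y) = y" by (rule f_inv_into_f[OF y])
    then show "inv_into U0 \<phi>0 y \<in> U'" using inv_into_into[OF y] that by (simp add: U'_def)
  qed
  show inv: "inv_into U' (\<Phi> \<circ> \<phi>0) y = inv_into U0 \<phi>0 (\<Psi> y)" if y: "y \<in> Y" for y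
    using inv0[OF \<Psi>(1)[OF y]] \<Psi>(2)[OF y] by (intro inv_into_f_eq[OF inj]) auto
  have openU': "openin M U'" unfolding U'_def by (rule is_chart_preimage[OF c0 U(1)])
  have hom1: "homeomorphic_map (subtopology M U') (top_of_set U) \<phi>0"
  proof -
    have "\<phi>0 ` (topspace (subtopology M U0) \<inter> U') = topspace (top_of_set (\<phi>0 ` U0)) \<inter> U"
      using im0 U'U0 U(2) c0D(2) by (simp add: Int_absorb1 Int_absorb2)
    from homeomorphic_map_subtopologies[OF c0D(5) this]
    show ?thesis using U'U0 U(2) by (simp add: subtopology_subtopology Int_absorb1)
  qed
  have hom2: "homeomorphic_map (top_of_set U) (top_of_set Y) \<Phi>"
    unfolding homeomorphic_map_maps by (rule exI[of _ \<Psi>])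
      (use hom in \<open>auto simp: homeomorphic_maps_def homeomorphism_def continuous_map_subtopology_eu\<close>)
  have chart: "is_chart M (U', \<Phi> \<circ> \<phi>0)"
    unfolding is_chart_def prod.case im
    using openU' Y homeomorphic_map_compose[OF hom1 hom2] by blast
  have new_new: "smooth_on Y ((\<Phi> \<circ> \<phi>0) \<circ> inv_into U' (\<Phi> \<circ> \<phi>0))"
    by (rule smooth_on_cong[OF Y _ smooth_on_ident]) (use inv inv0 \<Psi> in auto)
  have new_old: "smooth_on ((\<Phi> \<circ> \<phi>0) ` (U' \<inter> V)) (\<psi> \<circ> inv_into U' (\<Phi> \<circ> \<phi>0))" if V: "(V, \<psi>) \<in> A" for V \<psi>
  proof -
    let ?D = "(\<Phi> \<circ> \<phi>0) ` (U' \<inter> V)"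
    note cV = is_chartD[OF mD(1)[OF V]]
    have D: "open ?D" by (rule is_chart_image[OF chart]) (use openU' cV(1) in auto)
    have DY: "?D \<subseteq> Y" using im by blast
    have D0: "open (\<phi>0 ` (U0 \<inter> V))" by (rule is_chart_image[OF c0]) (use c0D(1) cV(1) in auto)
    have "smooth_on ?D (\<lambda>y. (\<psi> \<circ> inv_into U0 \<phi>0) (\<Psi> y))"
    proof (rule smooth_on_compose[OF D D0 _ mD(3)[OF A0 V] smooth_on_subset[OF sm(2) DY]])
      fix y assume "y \<in> ?D"
      then obtain q where q: "q \<in> U'" "q \<in> V" "y = \<Phi> (\<phi>0 q)" by auto
      then have "\<Psi> y = \<phi>0 q" using \<Phi>(2) by (simp add: U'_def)
      then show "\<Psi> y \<in> \<phi>0 ` (U0 \<inter> V)" using q U'U0 by blast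
    qed
    then show ?thesis
      by (rule smooth_on_cong[OF D, rotated]) (use inv DY in auto)
  qed
  have old_new: "smooth_on (\<psi> ` (V \<inter> U')) ((\<Phi> \<circ> \<phi>0) \<circ> inv_into V \<psi>)" if V: "(V, \<psi>) \<in> A" for V \<psi>
  proof -
    let ?D = "\<psi> ` (V \<inter> U')"
    note cV = is_chartD[OF mD(1)[OF V]]
    have D: "open ?D" by (rule is_chart_image[OF mD(1)[OF V]]) (use openU' cV(1) in auto)
    have sub: "?D \<subseteq> \<psi> ` (V \<inter> U0)" using U'U0 by blast
    have "smooth_on ?D (\<lambda>y. \<Phi> ((\<phi>0 \<circ> inv_into V \<psi>) y))"
    proof (rule smooth_on_compose[OF D U(1) _ sm(1) smooth_on_subset[OF mD(3)[OF V A0] sub]])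
      fix y assume "y \<in> ?D"
      then obtain q where "q \<in> V" "q \<in> U'" "y = \<psi> q" by blast
      then show "(\<phi>0 \<circ> inv_into V \<psi>) y \<in> U" using cV(6) by (simp add: U'_def)
    qed
    then show ?thesis by (simp add: o_def)
  qed
  have "smooth_manifold M (insert (U', \<Phi> \<circ> \<phi>0) A)"
    unfolding smooth_manifold_def
  proof (intro conjI)
    show "Hausdorff_space M" using man unfolding smooth_manifold_def by (elim conjE)
    show "second_countable M" using man unfolding smooth_manifold_def by (elim conjE)
    show "\<forall>c\<in>insert (U', \<Phi> \<circ> \<phi>0) A. is_chart M c" using mD(1) chart by simp
    have "\<Union>(fst ` A) = topspace M" using man unfolding smooth_manifold_def by (elim conjE)
    then show "\<Union>(fst ` insert (U', \<Phi> \<circ> \<phi>0) A) = topspace M" using is_chartD(2)[OF chart] by auto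
    show "\<forall>(U, \<phi>)\<in>insert (U', \<Phi> \<circ> \<phi>0) A. \<forall>(V, \<psi>)\<in>insert (U', \<Phi> \<circ> \<phi>0) A.
        smooth_on (\<phi> ` (U \<inter> V)) (\<psi> \<circ> inv_into U \<phi>)"
    proof (safe)
      show "smooth_on ((\<Phi> \<circ> \<phi>0) ` (U' \<inter> U')) (\<Phi> \<circ> \<phi>0 \<circ> inv_into U' (\<Phi> \<circ> \<phi>0))"
        using new_new im by simp
    qed (use new_old old_new mD(3) in blast)+
  qed
  then show "compatible_chart M A (U', \<Phi> \<circ> \<phi>0)" unfolding compatible_chart_def .
qed

text \<open>The centre comes with a Blaschke field \<open>C\<close> and the tangency with another
  one, \<open>C0\<close>. Both are parallel to F = f - c by uniqueness, so J F is tangent.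
  Involutivity passes to F because translation leaves derivatives unchanged.\<close>

lemma Jt_tangent_hypersphere_local_form:
  fixes A :: "('p, 'n::finite model) chart set"
  assumes Jt: "Jt_tangent_hypersphere M A f" and invol: "involutive_invariant_distribution A f"
    and centre: "hypersphere_centre M A f c" and p: "p \<in> topspace M"
  shows "\<exists>U \<phi> V K g. p \<in> U \<and> compatible_chart M A (U, \<phi>) \<and> \<phi> ` U = V \<times> K \<and>
             open V \<and> open K \<and> is_interval K \<and>
             proper_pc_hypersphere V g \<and> pc_hypersphere_centre V g 0 \<and>
             (\<forall>x\<in>V. \<forall>z\<in>K. f (inv_into U \<phi> (x, z)) - c = hyperbolic_form g (x, z))"
proof -
  obtain C lam where ah: "affine_hypersphere M A f C lam" and lam: "lam \<noteq> 0"
    and C: "\<And>p. p \<in> topspace M \<Longrightarrow> C p = - lam *\<^sub>R (f p - c)"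
    using centre unfolding hypersphere_centre_def by blast
  from Jt obtain C0 lam0 where
    ch: "\<And>U \<phi>. (U, \<phi>) \<in> A \<Longrightarrow> is_chart M (U, \<phi>)"
    and sd0: "\<And>U \<phi>. (U, \<phi>) \<in> A \<Longrightarrow> \<exists>h. sphere_data (\<phi> ` U) (f \<circ> inv_into U \<phi>) (C0 \<circ> inv_into U \<phi>) lam0 h"
    and J0: "\<And>U \<phi> y. (U, \<phi>) \<in> A \<Longrightarrow> y \<in> \<phi> ` U \<Longrightarrow> Jt ((C0 \<circ> inv_into U \<phi>) y) \<in> tangent_image (f \<circ> inv_into U \<phi>) y"
    by (rule Jt_tangent_hypersphere_charts) blast
  note man = affine_hypersphereD(1)[OF ah]
  obtain U0 \<phi>0 where A0: "(U0, \<phi>0) \<in> A" and pU0: "p \<in> U0" using smooth_manifoldD(2)[OF man p] by blast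
  let ?B = "\<phi>0 ` U0" and ?i = "inv_into U0 \<phi>0"
  note chD = is_chartD[OF ch[OF A0]]
  have B: "open ?B" by (rule chD(3))
  have i: "?i y \<in> topspace M" if "y \<in> ?B" for y using inv_into_into[OF that] chD(2) by blast
  define f0 where "f0 = f \<circ> ?i"
  define F where "F y = f0 y - c" for y
  obtain h where sd: "sphere_data ?B f0 (C \<circ> ?i) lam h"
    unfolding f0_def by (rule hypersphere_on_imp_sphere_data[OF bij_betw_model_frame B affine_hypersphereD(3)[OF ah A0]])
  obtain h0 where sd0': "sphere_data ?B f0 (C0 \<circ> ?i) lam0 h0" unfolding f0_def using sd0[OF A0] by blast
  have smf0: "smooth_on ?B f0" using sd by (simp add: sphere_data_def immersion_on_def)
  have dF: "(F has_derivative fd f0 y) (at y)" if "y \<in> ?B" for y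
    unfolding F_def[abs_def]
    by (rule has_derivative_eq_rhs[OF has_derivative_diff[OF smooth_on_has_derivative[OF smf0 that] has_derivative_const]]) simp
  have fdF: "fd F y = fd f0 y" if "y \<in> ?B" for y by (rule fd_eqI[OF dF[OF that]])
  have Ci: "(C \<circ> ?i) y = - lam *\<^sub>R F y" if "y \<in> ?B" for y
    using C[OF i[OF that]] by (simp add: F_def f0_def)
  have sdF: "sphere_data ?B F (\<lambda>y. - lam *\<^sub>R F y) lam h"
  proof (rule sphere_data_cong[OF B _ fdF _ sd])
    show "F differentiable (at y)" if "y \<in> ?B" for y
      unfolding differentiable_def by (rule exI, rule dF[OF that])
  qed (assumption, rule Ci[symmetric])
  have JF: "Jt (F y) \<in> tangent_image F y" if y: "y \<in> ?B" for y
  proof -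
    have sub: "subspace (tangent_image F y)"
      unfolding fdF[OF y] by (rule linear_subspace_image[OF smooth_on_linear_fd[OF smf0 y] subspace_UNIV])
    have "Jt ((C0 \<circ> ?i) y) \<in> tangent_image F y" unfolding fdF[OF y] using J0[OF A0 y] by (simp add: f0_def)
    \<comment> \<open>The sign is undetermined, but the tangent space is a linear subspace, so
      tangency of J applied to either multiple gives that of J F.\<close>
    moreover have "(C0 \<circ> ?i) y = - lam *\<^sub>R F y \<or> (C0 \<circ> ?i) y = lam *\<^sub>R F y"
      using sphere_data_unique[OF bij_betw_model_frame B sd sd0' y] Ci[OF y] by auto
    ultimately obtain a where "Jt (a *\<^sub>R F y) \<in> tangent_image F y" "a \<noteq> 0"
      using lam by (metis neg_equal_0_iff_equal)
    then show ?thesis using subspace_scale[OF sub, of "Jt (a *\<^sub>R F y)" "1 / a"] by simp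
  qed
  have inv: "involutive_on ?B (invariant_distribution F)"
  proof -
    have inv0: "involutive_on ?B (invariant_distribution f0)"
      using invol A0 unfolding involutive_invariant_distribution_def f0_def by blast
    have eq: "invariant_distribution F y = invariant_distribution f0 y" if "y \<in> ?B" for y
      by (rule set_eqI) (simp add: invariant_distribution_iff fdF[OF that])
    show ?thesis
      unfolding involutive_on_def
    proof (intro allI impI ballI)
      fix W' X Y y
      assume a: "open W' \<and> W' \<subseteq> ?B \<and> smooth_on W' X \<and> smooth_on W' Y \<and>
        (\<forall>x\<in>W'. X x \<in> invariant_distribution F x \<and> Y x \<in> invariant_distribution F x)" and y: "y \<in> W'"
      have eq': "invariant_distribution F x = invariant_distribution f0 x" if "x \<in> W'" for x
        using a that by (intro eq) blast
      have "\<forall>x\<in>W'. X x \<in> invariant_distribution f0 x \<and> Y x \<in> invariant_distribution f0 x"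
        using a eq' by blast
      then have "lie_bracket X Y y \<in> invariant_distribution f0 y"
        using inv0 a y unfolding involutive_on_def by blast
      then show "lie_bracket X Y y \<in> invariant_distribution F y" using eq'[OF y] by simp
    qed
  qed
  have pB: "\<phi>0 p \<in> ?B" using pU0 by blast
  obtain U V K \<Phi> \<Psi> g where U: "open U" "U \<subseteq> ?B" "\<phi>0 p \<in> U" and VK: "open V" "open K" "is_interval K" "K \<noteq> {}"
    and hom: "homeomorphism U (V \<times> K) \<Phi> \<Psi>" and sm: "smooth_on U \<Phi>" "smooth_on (V \<times> K) \<Psi>"
    and bij: "\<And>p. p \<in> V \<times> K \<Longrightarrow> bij (fd \<Psi> p)" and g: "smooth_on V g"
    and form: "\<And>x z. x \<in> V \<Longrightarrow> z \<in> K \<Longrightarrow> F (\<Psi> (x, z)) = hyperbolic_form g (x, z)"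
    and JT: "\<And>x z u. x \<in> V \<Longrightarrow> z \<in> K \<Longrightarrow> Jt (fd F (\<Psi> (x, z)) (fd \<Psi> (x, z) (u, 0))) \<in> tangent_image F (\<Psi> (x, z))"
    by (rule sphere_local_coordinates[OF B sdF lam JF inv pB]) (assumption | (rule that; assumption))+
  let ?W = "V \<times> K" and ?H = "hyperbolic_form g"
  have W: "open ?W" by (rule open_Times[OF VK(1,2)])
  have \<Psi>B: "\<Psi> q \<in> ?B" if "q \<in> ?W" for q using hom U(2) that by (auto simp: homeomorphism_def)
  have smH: "smooth_on ?W ?H" by (rule smooth_on_hyperbolic_form[OF VK(1,2) g])
  have form': "F (\<Psi> q) = ?H q" if "q \<in> ?W" for q using form that by (cases q) auto
  note comp = sphere_data_compose[OF B W sm(2) \<Psi>B bij sdF]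
  have fd_comp: "fd (\<lambda>q. F (\<Psi> q)) q v = fd F (\<Psi> q) (fd \<Psi> q v)" if "q \<in> ?W" for q v
    by (rule comp(2)[OF _ _ that])
  have tan_comp: "tangent_image (\<lambda>q. F (\<Psi> q)) q = tangent_image F (\<Psi> q)" if "q \<in> ?W" for q
    by (rule comp(3)[OF _ _ that])
  have fdH: "fd ?H q = fd (\<lambda>q. F (\<Psi> q)) q" if "q \<in> ?W" for q
    by (rule fd_cong[OF W that, symmetric]) (rule form')
  have sdH: "sphere_data ?W ?H (\<lambda>q. - lam *\<^sub>R ?H q) lam (\<lambda>q v w. h (\<Psi> q) (fd \<Psi> q v) (fd \<Psi> q w))"
    by (rule sphere_data_cong[OF W _ fdH _ comp(1)])
       (simp_all add: smooth_on_differentiable[OF smH] form')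
  have JTH: "Jt (fd ?H (x, z) (u, 0)) \<in> tangent_image ?H (x, z)" if "x \<in> V" "z \<in> K" for x z u
  proof -
    have q: "(x, z) \<in> ?W" using that by simp
    show ?thesis
      using JT[OF that, of u] unfolding fdH[OF q] fd_comp[OF q] tan_comp[OF q] .
  qed
  obtain z where z: "z \<in> K" using VK(4) by blast
  \<comment> \<open>Now \<open>lam\<close> is given and the scaling relation is solved for \<alpha>;
    this value makes - \<alpha> g satisfy \<bar>H\<bar> = 1. Its sign is free, and the positive root
    is taken.\<close>
  obtain \<alpha> where \<alpha>: "\<alpha> > 0" "\<alpha> ^ (2 * CARD('n) + 4) = \<bar>lam\<bar> ^ (2 * CARD('n) + 3)"
    using exists_power_eq_power[of "\<bar>lam\<bar>" "2 * CARD('n) + 4" "2 * CARD('n) + 3"] lam by auto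
  obtain h1 h2 where "pc_data V g \<alpha> h1 h2"
    using hyperbolic_sphere_imp_pc_data[OF VK(1,2) z g sdH lam _ _ JTH, of \<alpha>] \<alpha> by auto
  then have pc: "pc_hypersphere_with V g (\<lambda>x. - \<alpha> *\<^sub>R g x) \<alpha>" by (rule pc_data_imp_pc_hypersphere_with)
  have proper: "proper_pc_hypersphere V g" unfolding proper_pc_hypersphere_def using pc by blast
  have centre0: "pc_hypersphere_centre V g 0"
    unfolding pc_hypersphere_centre_def by (rule exI[of _ "\<lambda>x. - \<alpha> *\<^sub>R g x"]) (use pc in auto)
  note cc = compatible_chart_compose[OF man A0 U(1,2) W hom sm]
  have form0: "f (inv_into {q \<in> U0. \<phi>0 q \<in> U} (\<Phi> \<circ> \<phi>0) (x, z)) - c = ?H (x, z)" if "x \<in> V" "z \<in> K" for x z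
    using cc(3)[of "(x, z)"] form[OF that] that by (simp add: F_def f0_def)
  have pU: "p \<in> {q \<in> U0. \<phi>0 q \<in> U}" using pU0 U(3) by simp
  show ?thesis
    by (rule exI[of _ "{q \<in> U0. \<phi>0 q \<in> U}"], rule exI[of _ "\<Phi> \<circ> \<phi>0"], rule exI[of _ V], rule exI[of _ K],
        rule exI[of _ g]) (intro conjI ballI pU cc(1,2) VK(1-3) proper centre0 form0)
qed

theorem theorem4p5:
  fixes M :: "'p topology" and A :: "('p, 'n::finite model) chart set"
    and f :: "'p \<Rightarrow> 'n ambient"
    and W :: "'n base set" and I :: "real set" and g0 :: "'n base \<Rightarrow> 'n ambient"
  shows
    "(Jt_tangent_hypersphere M A f \<and> involutive_invariant_distribution A f \<longrightarrow>
        (\<exists>c. hypersphere_centre M A f c) \<and>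
        (\<forall>c. hypersphere_centre M A f c \<longrightarrow>
          (\<forall>p\<in>topspace M. \<exists>U \<phi> V K g.
             p \<in> U \<and> compatible_chart M A (U, \<phi>) \<and> \<phi> ` U = V \<times> K \<and>
             open V \<and> open K \<and> is_interval K \<and>
             proper_pc_hypersphere V g \<and> pc_hypersphere_centre V g 0 \<and>
             (\<forall>x\<in>V. \<forall>z\<in>K. f (inv_into U \<phi> (x, z)) - c = hyperbolic_form g (x, z)))))
     \<and>
     (proper_pc_hypersphere W g0 \<and> connected W \<and> open I \<and> is_interval I \<longrightarrow>
        (\<exists>c. pc_hypersphere_centre W g0 c) \<and>
        (\<forall>c. pc_hypersphere_centre W g0 c \<longrightarrow>
          (let M0 = top_of_set (W \<times> I); A0 = {(W \<times> I, id)};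
               f0 = hyperbolic_form (\<lambda>x. g0 x - c)
           in Jt_tangent_hypersphere M0 A0 f0 \<and> involutive_invariant_distribution A0 f0)))"
proof (intro conjI impI; (elim conjE)?)
  assume "Jt_tangent_hypersphere M A f"
  then show "\<exists>c. hypersphere_centre M A f c" by (rule Jt_tangent_hypersphere_has_centre)
next
  assume "Jt_tangent_hypersphere M A f" "involutive_invariant_distribution A f"
  then show "\<forall>c. hypersphere_centre M A f c \<longrightarrow>
          (\<forall>p\<in>topspace M. \<exists>U \<phi> V K g.
             p \<in> U \<and> compatible_chart M A (U, \<phi>) \<and> \<phi> ` U = V \<times> K \<and>
             open V \<and> open K \<and> is_interval K \<and>
             proper_pc_hypersphere V g \<and> pc_hypersphere_centre V g 0 \<and>
             (\<forall>x\<in>V. \<forall>z\<in>K. f (inv_into U \<phi> (x, z)) - c = hyperbolic_form g (x, z)))"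
    by (intro allI impI ballI) (rule Jt_tangent_hypersphere_local_form)
next
  assume "proper_pc_hypersphere W g0" "connected W"
  then show "\<exists>c. pc_hypersphere_centre W g0 c" by (rule proper_pc_hypersphere_has_centre)
next
  assume W: "connected W" and I: "open I" "is_interval I"
  show "\<forall>c. pc_hypersphere_centre W g0 c \<longrightarrow>
          (let M0 = top_of_set (W \<times> I); A0 = {(W \<times> I, id)};
               f0 = hyperbolic_form (\<lambda>x. g0 x - c)
           in Jt_tangent_hypersphere M0 A0 f0 \<and> involutive_invariant_distribution A0 f0)"
  proof (intro allI impI)
    fix c assume "pc_hypersphere_centre W g0 c"
    then obtain \<zeta> \<alpha> where pc: "pc_hypersphere_with W g0 \<zeta> \<alpha>" and \<zeta>: "\<And>x. x \<in> W \<Longrightarrow> \<zeta> x = - \<alpha> *\<^sub>R (g0 x - c)"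
      unfolding pc_hypersphere_centre_def by blast
    obtain h1 h2 where "pc_data W (\<lambda>x. g0 x - c) \<alpha> h1 h2"
      by (rule pc_hypersphere_with_imp_pc_data[OF pc \<zeta>])
    from Jt_tangent_hypersphere_hyperbolic_form[OF this W I]
    show "let M0 = top_of_set (W \<times> I); A0 = {(W \<times> I, id)};
               f0 = hyperbolic_form (\<lambda>x. g0 x - c)
           in Jt_tangent_hypersphere M0 A0 f0 \<and> involutive_invariant_distribution A0 f0"
      unfolding Let_def by blast
  qed
qed

end
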